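(* Let $\alpha\in(\tfrac14,\tfrac12]$ and $s\in(\tfrac12-\alpha,2\alpha)$. Then the BBM equation $i\partial_t u=\varphi(D_x)u+\tfrac12\mathcal N(u)$ on $\mathbb T$ is locally well-posed almost surely with respect to the random initial data $$u_0^\omega(x)=\sum_{n\in\mathbb Z}\frac{g_n(\omega)}{\langle n\rangle^\alpha}e^{inx}.$$ More precisely, there exists a set $\Sigma\subset\Omega$ with $\mathbb P(\Sigma)=1$ such that for every $\omega\in\Sigma$ there exist $T^\omega>0$ and a unique solution $u$ with $u|_{t=0}=u_0^\omega$ in the class $$e^{-it\varphi(D_x)}u_0^\omega+C([0,T^\omega];H^s(\mathbb T))\subset C([0,T^\omega];H^{\alpha-\frac12-\varepsilon}(\mathbb T)),$$ where $\varepsilon>0$ is arbitrarily small.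
   Context: $\mathbb T=\mathbb R/(2\pi\mathbb Z)$, $\langle n\rangle=(1+n^2)^{1/2}$, $D_x=-i\partial_x$, and $\varphi(D_x)$ is the Fourier multiplier with symbol $\varphi(n)=\frac{n}{1+n^2}$; $S(t)=e^{-it\varphi(D_x)}$. $\{g_n\}_{n\in\mathbb Z}$ are standard complex-valued Gaussian random variables ($\mathbb E[g_n]=0$, $\mathbb E|g_n|^2=1$) on a probability space $(\Omega,\mathcal F,\mathbb P)$, with $g_{-n}=\overline{g_n}$, $g_0$ real, and $\{g_n\}_{n\ge0}$ independent. The nonlinearity is $$\mathcal N(u)=\sum_{n\ne0}\varphi(n)e^{inx}\sum_{n_1+n_2=n}\widehat u(n_1)\widehat u(n_2)$$ (no zero frequency; it equals $\varphi(D_x)(u^2)$ if $u\in L^2(\mathbb T)$, and then the equation is equivalent to $\partial_tu-\partial_{xxt}u+\partial_xu+\tfrac12\partial_x(u^2)=0$). A solution is a function satisfying the Duhamel formula $u(t)=S(t)u_0-\frac i2\int_0^tS(t-t')\mathcal N(u(t'))\,dt'$. With $z=z^\omega=S(t)u_0^\omega$ and $u=z+v$, $v\in C([0,T];H^s(\mathbb T))$, the nonlinearity means $\mathcal N(u)=\varphi(D_x)(v^2+2zv)+\mathcal N(z)$, where in $\mathcal N(z)$ the inner sum for each $n\neq0$ is the limit in $L^2(\Omega)$ as $M\to\infty$ of the sums restricted to $|n_1|,|n_2|\le M$ (equivalently, $\mathcal N(z)$ is the limit of $\mathcal N$ applied to mollifications of $z$). Uniqueness means uniqueness among functions $u=z^\omega+v$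 with $v\in C([0,T^\omega];H^s(\mathbb T))$. *)

theory Defs
  imports "HOL-Probability.Probability"
begin

text \<open>
  A (periodic, complex-valued) distribution \<open>f\<close> on \<open>\<real>/(2\<pi>\<int>)\<close> is represented by the family
  \<open>int \<Rightarrow> complex\<close> of its Fourier coefficients, so that formally
  \<open>f(x) = \<Sum>n. f n * e^(i n x)\<close>. Functions of time are
  \<open>real \<Rightarrow> int \<Rightarrow> complex\<close>, random ones \<open>real \<Rightarrow> 'a \<Rightarrow> int \<Rightarrow> complex\<close>.
\<close>

definition jap :: "int \<Rightarrow> real" where
  "jap n = sqrt (1 + (real_of_int n)\<^sup>2)"

definition sobolev :: "real \<Rightarrow> (int \<Rightarrow> complex) set" where
  "sobolev s = {f. (\<lambda>n. jap n powr (2 * s) * (cmod (f n))\<^sup>2) summable_on UNIV}"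

definition sobolev_norm :: "real \<Rightarrow> (int \<Rightarrow> complex) \<Rightarrow> real" where
  "sobolev_norm s f = sqrt (\<Sum>\<^sub>\<infinity>n. jap n powr (2 * s) * (cmod (f n))\<^sup>2)"

text \<open>
  \<open>C([0,T]; H^s)\<close>; values outside \<open>[0,T]\<close> are unconstrained.
\<close>

definition cont_sobolev :: "real \<Rightarrow> real \<Rightarrow> (real \<Rightarrow> int \<Rightarrow> complex) set" where
  "cont_sobolev T s = {v. (\<forall>t\<in>{0..T}. v t \<in> sobolev s) \<and>
     (\<forall>t\<in>{0..T}. ((\<lambda>r. sobolev_norm s (\<lambda>n. v r n - v t n)) \<longlongrightarrow> 0) (at t within {0..T}))}"

definition bbm_symbol :: "int \<Rightarrow> real" where
  "bbm_symbol n = real_of_int n / (1 + (real_of_int n)\<^sup>2)"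

definition fourier_mult :: "(int \<Rightarrow> real) \<Rightarrow> (int \<Rightarrow> complex) \<Rightarrow> int \<Rightarrow> complex" where
  "fourier_mult m f n = complex_of_real (m n) * f n"

definition bbm_group :: "real \<Rightarrow> (int \<Rightarrow> complex) \<Rightarrow> int \<Rightarrow> complex" where
  "bbm_group t f n = exp (- \<i> * complex_of_real (t * bbm_symbol n)) * f n"

text \<open>
  Fourier coefficients of a product, whenever the series converge absolutely.
\<close>

definition fourier_prod :: "(int \<Rightarrow> complex) \<Rightarrow> (int \<Rightarrow> complex) \<Rightarrow> int \<Rightarrow> complex" where
  "fourier_prod f h n = (\<Sum>\<^sub>\<infinity>k. f k * h (n - k))"

definition trunc_square :: "nat \<Rightarrow> (int \<Rightarrow> complex) \<Rightarrow> int \<Rightarrow> complex" where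
  "trunc_square K f n = (\<Sum>k\<in>{k. \<bar>k\<bar> \<le> int K \<and> \<bar>n - k\<bar> \<le> int K}. f k * f (n - k))"

definition L2_limit :: "'a measure \<Rightarrow> (nat \<Rightarrow> 'a \<Rightarrow> complex) \<Rightarrow> ('a \<Rightarrow> complex) \<Rightarrow> bool" where
  "L2_limit M X Y \<longleftrightarrow>
     Y \<in> borel_measurable M \<and> integrable M (\<lambda>\<omega>. (cmod (Y \<omega>))\<^sup>2) \<and>
     (\<lambda>K. \<integral>\<^sup>+\<omega>. ennreal ((cmod (X K \<omega> - Y \<omega>))\<^sup>2) \<partial>M) \<longlonglongrightarrow> 0"

text \<open>
  \<open>w\<close> is the (nonzero-frequency part of the) square of the random function \<open>z\<close>. At each time the
  \<open>L\<^sup>2\<close> limit determines \<open>w t \<cdot> n\<close> only up to a null set depending on \<open>t\<close>; joint measurability in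
  \<open>(t, \<omega>)\<close> is what makes time integrals of \<open>w\<close> meaningful, and (by Fubini) almost surely independent
  of the version \<open>w\<close>.
\<close>

definition square_version ::
    "'a measure \<Rightarrow> (real \<Rightarrow> 'a \<Rightarrow> int \<Rightarrow> complex) \<Rightarrow> (real \<Rightarrow> 'a \<Rightarrow> int \<Rightarrow> complex) \<Rightarrow> bool" where
  "square_version M z w \<longleftrightarrow> (\<forall>n. n \<noteq> 0 \<longrightarrow>
     (\<lambda>(t, \<omega>). w t \<omega> n) \<in> borel_measurable (borel \<Otimes>\<^sub>M M) \<and>
     (\<forall>t. L2_limit M (\<lambda>K \<omega>. trunc_square K (z t \<omega>) n) (\<lambda>\<omega>. w t \<omega> n)))"

text \<open>
  \<open>\<N>(z + v) = \<phi>(D)(v\<^sup>2 + 2 z v) + \<N>(z)\<close>, where \<open>w\<close> stands for the square of \<open>z\<close>.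
\<close>

definition bbm_nonlin ::
    "(int \<Rightarrow> complex) \<Rightarrow> (int \<Rightarrow> complex) \<Rightarrow> (int \<Rightarrow> complex) \<Rightarrow> int \<Rightarrow> complex" where
  "bbm_nonlin z w v n =
     fourier_mult bbm_symbol (\<lambda>k. fourier_prod v v k + 2 * fourier_prod z v k) n +
     (if n = 0 then 0 else complex_of_real (bbm_symbol n) * w n)"

definition solution_class ::
    "real \<Rightarrow> real \<Rightarrow> (int \<Rightarrow> complex) \<Rightarrow> (real \<Rightarrow> int \<Rightarrow> complex) set" where
  "solution_class T s u0 = {u. (\<lambda>t n. u t n - bbm_group t u0 n) \<in> cont_sobolev T s}"

text \<open>
  The Duhamel formula, with the time integral taken in the sense of distributions, that is, separately
  in each Fourier coefficient.
\<close>

definition bbm_solution ::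
    "real \<Rightarrow> (int \<Rightarrow> complex) \<Rightarrow> (real \<Rightarrow> int \<Rightarrow> complex) \<Rightarrow> (real \<Rightarrow> int \<Rightarrow> complex) \<Rightarrow> bool" where
  "bbm_solution T u0 w u \<longleftrightarrow>
     (let z = (\<lambda>t. bbm_group t u0);
          N = (\<lambda>t. bbm_nonlin (z t) (w t) (\<lambda>n. u t n - z t n))
      in \<forall>t\<in>{0..T}. \<forall>n.
           set_integrable lborel {0..t} (\<lambda>t'. bbm_group (t - t') (N t') n) \<and>
           u t n = bbm_group t u0 n -
             (\<i> / 2) * set_lebesgue_integral lborel {0..t} (\<lambda>t'. bbm_group (t - t') (N t') n))"

definition std_complex_gaussian :: "'a measure \<Rightarrow> ('a \<Rightarrow> complex) \<Rightarrow> bool" where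
  "std_complex_gaussian M X \<longleftrightarrow>
     prob_space.indep_var M borel (\<lambda>\<omega>. Re (X \<omega>)) borel (\<lambda>\<omega>. Im (X \<omega>)) \<and>
     distributed M lborel (\<lambda>\<omega>. Re (X \<omega>)) (normal_density 0 (1 / sqrt 2)) \<and>
     distributed M lborel (\<lambda>\<omega>. Im (X \<omega>)) (normal_density 0 (1 / sqrt 2))"

definition gaussian_family :: "'a measure \<Rightarrow> (int \<Rightarrow> 'a \<Rightarrow> complex) \<Rightarrow> bool" where
  "gaussian_family M g \<longleftrightarrow>
     (\<forall>n. g n \<in> borel_measurable M) \<and>
     (\<forall>n>0. std_complex_gaussian M (g n)) \<and>
     (AE \<omega> in M. g 0 \<omega> \<in> \<real>) \<and>
     distributed M lborel (\<lambda>\<omega>. Re (g 0 \<omega>)) (normal_density 0 1) \<and>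
     (\<forall>n. AE \<omega> in M. g (- n) \<omega> = cnj (g n \<omega>)) \<and>
     prob_space.indep_vars M (\<lambda>_. borel) g {0..}"

definition random_data :: "real \<Rightarrow> (int \<Rightarrow> 'a \<Rightarrow> complex) \<Rightarrow> 'a \<Rightarrow> int \<Rightarrow> complex" where
  "random_data \<alpha> g \<omega> n = g n \<omega> / complex_of_real (jap n powr \<alpha>)"

end

theory Submission
  imports Defs
begin

text \<open>
  Write \<open>u = z + v\<close> with \<open>z = S(t)u\<^sub>0\<close>. The remainder \<open>v\<close> solves a Duhamel equation whose right-hand side
  consists of \<open>\<phi>(D)(v\<^sup>2 + 2zv)\<close> and of the forcing \<open>\<phi>(D)(z\<^sup>2)\<close>, the latter understood through
  probability. Two estimates make this a contraction in \<open>C([0,T]; H\<^sup>s)\<close>.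

  The first one is deterministic (\<open>fourier_mult_product_energy\<close>). If \<open>0 \<le> \<sigma> < 1/2\<close>, \<open>\<sigma> \<le> s\<close> and
  \<open>s + \<sigma> \<le> 1\<close>, then \<open>(f, h) \<mapsto> \<phi>(D)(fh)\<close> is bounded from \<open>H\<^sup>-\<^sup>\<sigma> \<times> H\<^sup>s\<close> to \<open>H\<^sup>s\<close>, because \<open>\<phi>(n)\<close>
  decays like \<open>1/\<langle>n\<rangle>\<close>. In Fourier variables it says that a weight is dominated by
  \<open>\<langle>n\<rangle>^(\<sigma>-1) + \<langle>n-k\<rangle>^(\<sigma>-1)\<close>; the first summand is handled by the Cauchy-Schwarz inequality, the
  second one by Young's inequality for \<open>l\<^sup>2 * l\<^sup>1\<close>, and both use only that \<open>\<langle>n\<rangle>^(2\<sigma>-2)\<close> is summable.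
  Almost surely \<open>u\<^sub>0\<close>, hence \<open>z(t)\<close>, lies in \<open>H\<^sup>-\<^sup>\<sigma>\<close> for every \<open>\<sigma> > 1/2 - \<alpha>\<close>. The hypotheses on \<open>\<alpha>\<close> and
  \<open>s\<close> allow such a \<open>\<sigma>\<close> to be chosen within the range of the estimate. The nonlinearity is
  then locally Lipschitz on \<open>H\<^sup>s\<close>, so a short time makes the Duhamel map contracting, and a Gronwall
  argument gives uniqueness among all continuous curves, not only among small ones
  (\<open>local_well_posedness\<close>).

  The second one is probabilistic (\<open>forcing_energy_finite_AE\<close>). For \<open>n \<noteq> 0\<close> the products \<open>g\<^sub>k g\<^sub>n\<^sub>-\<^sub>k\<close> and
  \<open>g\<^sub>j g\<^sub>n\<^sub>-\<^sub>j\<close> are orthogonal unless \<open>j \<in> {k, n - k}\<close>: otherwise one of the four frequencies has an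
  absolute value that the other three do not share, and the corresponding Gaussian is centred and
  independent of the rest. Hence the \<open>n\<close>-th coefficient of \<open>z\<^sup>2\<close> has second moment at most a constant
  times \<open>\<Sum>\<^sub>k \<langle>k\<rangle>^(-2\<alpha>) \<langle>n-k\<rangle>^(-2\<alpha>)\<close>, uniformly in time, and these numbers are summable against
  \<open>\<langle>n\<rangle>^(2s-2)\<close> since \<open>s < 2\<alpha>\<close>. By Fubini the forcing lies almost surely in \<open>L\<^sup>2([0,1]; H\<^sup>s)\<close>, whichever
  jointly measurable version of the square is used. The same second moment bound, applied to tails,
  shows that a version exists.

  Squared Sobolev norms are taken with values in \<open>[0,\<infinity>]\<close> throughout. Sums and integrals of them can
  then be interchanged freely, and membership in a Sobolev space becomes finiteness; the price is that
  the triangle inequality carries a factor 2, which is harmless for contraction arguments.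
\<close>

section \<open>Sums of nonnegative families\<close>

abbreviation nnsum :: "('i \<Rightarrow> ennreal) \<Rightarrow> ennreal" where
  "nnsum f \<equiv> (\<integral>\<^sup>+n. f n \<partial>count_space UNIV)"

lemma nnsum_swap:
  fixes f :: "'i::countable \<Rightarrow> 'b \<Rightarrow> ennreal"
  assumes "\<And>i. f i \<in> borel_measurable M"
  shows "(\<integral>\<^sup>+x. nnsum (\<lambda>i. f i x) \<partial>M) = nnsum (\<lambda>i. \<integral>\<^sup>+x. f i x \<partial>M)"
  by (rule nn_integral_count_space_nn_integral) (use assms in auto)

lemma borel_measurable_nnsum:
  fixes f :: "'b \<Rightarrow> int \<Rightarrow> ennreal"
  assumes "\<And>n. (\<lambda>x. f x n) \<in> borel_measurable M"
  shows "(\<lambda>x. nnsum (f x)) \<in> borel_measurable M"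
proof -
  have "(\<lambda>p. (\<lambda>n p. f (fst p) n) (snd p) p) \<in> borel_measurable (M \<Otimes>\<^sub>M count_space UNIV)"
    by (rule measurable_compose_countable'[where I=UNIV])
      (auto intro: measurable_compose[OF measurable_fst assms])
  then show ?thesis
    by (intro sigma_finite_measure.borel_measurable_nn_integral sigma_finite_measure_count_space)
      (simp add: case_prod_beta')
qed

lemma nnsum_commute:
  fixes f :: "'i::countable \<Rightarrow> 'b \<Rightarrow> ennreal"
  shows "nnsum (\<lambda>x. nnsum (\<lambda>i. f i x)) = nnsum (\<lambda>i. nnsum (f i))"
  by (rule nnsum_swap) auto

lemma nnsum_reflect:
  fixes f :: "int \<Rightarrow> ennreal"
  shows "nnsum (\<lambda>k. f (n - k)) = nnsum f"
  by (rule nn_integral_bij_count_space, rule bij_betwI[where g="\<lambda>k. n - k"]) auto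

lemma nnsum_shift:
  fixes f :: "int \<Rightarrow> ennreal"
  shows "nnsum (\<lambda>n. f (n - k)) = nnsum f"
  by (rule nn_integral_bij_count_space, rule bij_betwI[where g="\<lambda>n. n + k"]) auto

lemma nnsum_ge: "f i \<le> nnsum f"
  using nn_integral_ge_point[of i UNIV f] by simp

lemma nnsum_finite_le:
  assumes "finite A"
  shows "sum f A \<le> nnsum f"
proof -
  have "sum f A = (\<integral>\<^sup>+n. f n \<partial>count_space A)"
    by (simp add: nn_integral_count_space_finite assms)
  also have "\<dots> = (\<integral>\<^sup>+n. f n * indicator A n \<partial>count_space UNIV)"
    by (simp add: nn_integral_count_space_indicator)
  also have "\<dots> \<le> nnsum f"
    by (intro nn_integral_mono) (auto split: split_indicator)
  finally show ?thesis .
qed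

lemma nnsum_lt_top_imp: "nnsum f < \<infinity> \<Longrightarrow> f i < \<infinity>"
  using nnsum_ge[of f i] by (auto simp: less_top[symmetric] top_unique)

text \<open>
  The free parameter \<open>c\<close> makes the inequality homogeneous: after integration, its optimal choice turns
  the sum into the product of two norms.
\<close>

lemma ennreal_prod_le_weighted_squares:
  fixes a b :: ennreal
  assumes "0 < c"
  shows "a * b \<le> ennreal (c / 2) * a\<^sup>2 + ennreal (1 / (2 * c)) * b\<^sup>2"
proof (cases "a = \<infinity> \<or> b = \<infinity>")
  case True
  then show ?thesis using assms by (auto simp: ennreal_mult_eq_top_iff ennreal_top_mult ennreal_mult_top)
next
  case False
  then obtain x y where "a = ennreal x" "b = ennreal y" "x \<ge> 0" "y \<ge> 0"
    by (metis ennreal_cases infinity_ennreal_def)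
  moreover have "x * y \<le> (c / 2) * x\<^sup>2 + (1 / (2 * c)) * y\<^sup>2" for x y :: real
  proof -
    have "0 \<le> (c * x - y)\<^sup>2 / (2 * c)" using assms by simp
    also have "\<dots> = (c / 2) * x\<^sup>2 + (1 / (2 * c)) * y\<^sup>2 - x * y"
      using assms by (simp add: field_simps power2_eq_square)
    finally show ?thesis by simp
  qed
  then have "ennreal (x * y) \<le> ennreal ((c / 2) * x\<^sup>2 + (1 / (2 * c)) * y\<^sup>2)"
    by (rule ennreal_leI)
  ultimately show ?thesis using assms
    by (simp add: ennreal_power flip: ennreal_mult ennreal_mult' ennreal_mult'' ennreal_plus)
qed

lemma nn_integral_Cauchy_Schwarz:
  assumes [measurable]: "f \<in> borel_measurable M" "g \<in> borel_measurable M"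
  shows "(\<integral>\<^sup>+x. f x * g x \<partial>M)\<^sup>2 \<le> (\<integral>\<^sup>+x. (f x)\<^sup>2 \<partial>M) * (\<integral>\<^sup>+x. (g x)\<^sup>2 \<partial>M)"
proof -
  let ?F = "\<integral>\<^sup>+x. (f x)\<^sup>2 \<partial>M" and ?G = "\<integral>\<^sup>+x. (g x)\<^sup>2 \<partial>M" and ?I = "\<integral>\<^sup>+x. f x * g x \<partial>M"
  have *: "?I \<le> ennreal (c / 2) * ?F + ennreal (1 / (2 * c)) * ?G" if "c > 0" for c
  proof -
    have "?I \<le> (\<integral>\<^sup>+x. ennreal (c / 2) * (f x)\<^sup>2 + ennreal (1 / (2 * c)) * (g x)\<^sup>2 \<partial>M)"
      by (intro nn_integral_mono ennreal_prod_le_weighted_squares that)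
    then show ?thesis by (simp add: nn_integral_add nn_integral_cmult)
  qed
  have zero: "?I = 0" if "?F = 0 \<or> ?G = 0"
  proof -
    have "AE x in M. f x * g x = 0"
      using that by (auto simp: nn_integral_0_iff_AE)
    then show ?thesis by (subst nn_integral_0_iff_AE) auto
  qed
  consider "?F = 0 \<or> ?G = 0" | "?F \<noteq> 0" "?G \<noteq> 0" "?F = \<infinity> \<or> ?G = \<infinity>"
    | "?F \<noteq> 0" "?G \<noteq> 0" "?F \<noteq> \<infinity>" "?G \<noteq> \<infinity>" by blast
  then show ?thesis
  proof cases
    case 1 then show ?thesis using zero by simp
  next
    case 2 then show ?thesis by (auto simp: ennreal_mult_top ennreal_top_mult)
  next
    case 3
    \<comment> \<open>The choice \<open>c = sqrt (y / x)\<close> makes both summands equal.\<close>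
    then obtain x y where xy: "?F = ennreal x" "?G = ennreal y" "x \<ge> 0" "y \<ge> 0"
      by (metis ennreal_cases infinity_ennreal_def)
    with 3 have pos: "x > 0" "y > 0" by (auto simp: less_le)
    have "?I \<le> ennreal (sqrt (y / x) / 2) * ?F + ennreal (1 / (2 * sqrt (y / x))) * ?G"
      using pos by (intro *) simp
    also have "\<dots> = ennreal (sqrt (y / x) / 2 * x + 1 / (2 * sqrt (y / x)) * y)"
      using pos by (simp add: xy flip: ennreal_mult ennreal_mult' ennreal_mult'' ennreal_plus)
    also have "sqrt (y / x) / 2 * x + 1 / (2 * sqrt (y / x)) * y = sqrt x * sqrt y"
    proof -
      have "x = sqrt x * sqrt x" "y = sqrt y * sqrt y" using pos by simp_all
      moreover have "sqrt x > 0" "sqrt y > 0" using pos by simp_all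
      ultimately show ?thesis
        by (simp add: real_sqrt_divide field_simps)
    qed
    finally have "?I\<^sup>2 \<le> (ennreal (sqrt x * sqrt y))\<^sup>2" by (rule power_mono) simp
    also have "\<dots> = ?F * ?G"
      using pos by (simp add: xy ennreal_power power_mult_distrib flip: ennreal_mult)
    finally show ?thesis .
  qed
qed

lemma nnsum_convolution_le:
  fixes f h :: "int \<Rightarrow> ennreal"
  shows "(nnsum (\<lambda>k. f k * h (n - k)))\<^sup>2 \<le> nnsum (\<lambda>k. (f k)\<^sup>2) * nnsum (\<lambda>k. (h k)\<^sup>2)"
  using nn_integral_Cauchy_Schwarz[of f "count_space UNIV" "\<lambda>k. h (n - k)"]
  by (simp add: nnsum_reflect[of "\<lambda>k. (h k)\<^sup>2"])

lemma ennreal_sqrt_exists: "\<exists>y::ennreal. y\<^sup>2 = x"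
proof (cases x)
  case (real r)
  then have "(ennreal (sqrt r))\<^sup>2 = x" by (simp add: ennreal_power)
  then show ?thesis by blast
next
  case top
  then have "(top::ennreal)\<^sup>2 = x" by (simp add: power2_eq_square)
  then show ?thesis by blast
qed

text \<open>
  Young's inequality for \<open>l\<^sup>2 * l\<^sup>1\<close>: split \<open>h\<close> into two square roots, give one of them to \<open>f\<close>, and apply
  the Cauchy-Schwarz inequality; the remaining double sum factorizes by translation invariance.
\<close>

lemma nnsum_convolution_Young:
  fixes f h :: "int \<Rightarrow> ennreal"
  shows "nnsum (\<lambda>n. (nnsum (\<lambda>k. f k * h (n - k)))\<^sup>2) \<le> nnsum (\<lambda>k. (f k)\<^sup>2) * (nnsum h)\<^sup>2"
proof -
  obtain r where r: "\<And>k. (r k)\<^sup>2 = h k" using choice[of "\<lambda>k y. y\<^sup>2 = h k"] ennreal_sqrt_exists by blast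
  have "(nnsum (\<lambda>k. f k * h (n - k)))\<^sup>2 \<le> nnsum (\<lambda>k. (f k)\<^sup>2 * h (n - k)) * nnsum h" for n
  proof -
    have "nnsum (\<lambda>k. f k * h (n - k)) = nnsum (\<lambda>k. (f k * r (n - k)) * r (n - k))"
      by (intro nn_integral_cong) (simp add: r[symmetric] power2_eq_square ac_simps)
    also have "\<dots>\<^sup>2 \<le> nnsum (\<lambda>k. (f k * r (n - k))\<^sup>2) * nnsum (\<lambda>k. (r (n - k))\<^sup>2)"
      by (rule nn_integral_Cauchy_Schwarz) auto
    finally show ?thesis by (simp add: power_mult_distrib r nnsum_reflect)
  qed
  then have "nnsum (\<lambda>n. (nnsum (\<lambda>k. f k * h (n - k)))\<^sup>2)
     \<le> nnsum (\<lambda>n. nnsum (\<lambda>k. (f k)\<^sup>2 * h (n - k)) * nnsum h)"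
    by (intro nn_integral_mono)
  also have "\<dots> = nnsum (\<lambda>n. nnsum (\<lambda>k. (f k)\<^sup>2 * h (n - k))) * nnsum h"
    by (simp add: nn_integral_multc)
  also have "nnsum (\<lambda>n. nnsum (\<lambda>k. (f k)\<^sup>2 * h (n - k))) = nnsum (\<lambda>k. nnsum (\<lambda>n. (f k)\<^sup>2 * h (n - k)))"
    by (rule nnsum_commute)
  also have "\<dots> = nnsum (\<lambda>k. (f k)\<^sup>2) * nnsum h"
    by (simp add: nn_integral_cmult nn_integral_multc nnsum_shift)
  finally show ?thesis by (simp add: power2_eq_square mult.assoc)
qed

lemma ennreal_square_add_le: "(a + b :: ennreal)\<^sup>2 \<le> 2 * a\<^sup>2 + 2 * b\<^sup>2"
proof (cases "a = \<infinity> \<or> b = \<infinity>")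
  case True
  then show ?thesis by (auto simp: power2_eq_square ennreal_mult_top)
next
  case False
  then obtain x y where xy: "a = ennreal x" "b = ennreal y" "x \<ge> 0" "y \<ge> 0"
    by (metis ennreal_cases infinity_ennreal_def)
  have "(x + y)\<^sup>2 \<le> 2 * x\<^sup>2 + 2 * y\<^sup>2"
    using sum_squares_bound[of x y] by (simp add: power2_eq_square algebra_simps)
  then have "ennreal ((x + y)\<^sup>2) \<le> ennreal (2 * x\<^sup>2 + 2 * y\<^sup>2)" by (rule ennreal_leI)
  moreover have "(a + b)\<^sup>2 = ennreal ((x + y)\<^sup>2)"
    using xy by (simp add: ennreal_power flip: ennreal_plus)
  moreover have "2 * a\<^sup>2 + 2 * b\<^sup>2 = ennreal (2 * x\<^sup>2 + 2 * y\<^sup>2)"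
    using xy by (simp add: ennreal_power ennreal_mult)
  ultimately show ?thesis by simp
qed

lemma cmod_square_add_le: "(cmod (x + y))\<^sup>2 \<le> 2 * (cmod x)\<^sup>2 + 2 * (cmod y)\<^sup>2"
proof -
  have "(cmod (x + y))\<^sup>2 \<le> (cmod x + cmod y)\<^sup>2"
    by (intro power_mono norm_triangle_ineq) simp
  also have "\<dots> \<le> 2 * (cmod x)\<^sup>2 + 2 * (cmod y)\<^sup>2"
    using sum_squares_bound[of "cmod x" "cmod y"] by (simp add: power2_eq_square algebra_simps)
  finally show ?thesis .
qed

section \<open>Japanese brackets\<close>

lemma jap_ge_1 [simp]: "1 \<le> jap n" and jap_pos [simp]: "0 < jap n" and jap_nonzero [simp]: "jap n \<noteq> 0"
  and jap_nonneg [simp]: "0 \<le> jap n"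
proof -
  show *: "1 \<le> jap n" by (simp add: jap_def)
  then show "0 < jap n" "jap n \<noteq> 0" "0 \<le> jap n" by linarith+
qed

lemma abs_le_jap: "\<bar>real_of_int n\<bar> \<le> jap n"
  unfolding jap_def by (rule real_le_rsqrt) simp

lemma jap_triangle: "jap (k + m) \<le> jap k + jap m"
proof -
  have "jap (k + m) = sqrt ((1 :: real)^2 + (real_of_int k + real_of_int m)^2)"
    by (simp add: jap_def)
  also have "\<dots> \<le> sqrt ((1 + 0)^2 + (real_of_int k + real_of_int m)^2)" by simp
  also have "\<dots> \<le> sqrt (1\<^sup>2 + (real_of_int k)\<^sup>2) + sqrt (0\<^sup>2 + (real_of_int m)\<^sup>2)"
    by (rule real_sqrt_sum_squares_triangle_ineq)
  also have "\<dots> \<le> jap k + jap m" unfolding jap_def by (intro add_mono real_sqrt_le_mono) auto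
  finally show ?thesis .
qed

lemma jap_triangle_diff: "jap k \<le> jap n + jap (n - k)"
  using jap_triangle[of n "k - n"] by (simp add: jap_def power2_commute)

lemma bbm_symbol_bound: "\<bar>bbm_symbol n\<bar> \<le> 1 / jap n"
proof -
  have "\<bar>bbm_symbol n\<bar> = \<bar>real_of_int n\<bar> / (jap n)\<^sup>2"
    by (simp add: bbm_symbol_def jap_def)
  also have "\<dots> \<le> jap n / (jap n)\<^sup>2" by (intro divide_right_mono abs_le_jap) simp
  finally show ?thesis by (simp add: power2_eq_square)
qed

text \<open>
  Comparison of each half line with the series of \<open>i\<^sup>-\<^sup>p\<close>.
\<close>

lemma nnsum_jap_powr_finite:
  assumes "1 < p"
  shows "nnsum (\<lambda>n. ennreal (jap n powr - p)) < \<infinity>"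
proof -
  let ?f = "\<lambda>n. ennreal (jap n powr - p)"
  have "summable (\<lambda>i. real (Suc i) powr - p)"
    using summable_real_powr_iff[of "-p"] assms by (subst summable_Suc_iff) simp
  then have nat: "nnsum (\<lambda>i. ennreal (real (Suc i) powr - p)) < \<infinity>"
    by (simp add: nn_integral_count_space_nat suminf_ennreal2 less_top[symmetric] del: of_nat_Suc)
  have le: "?f n \<le> ennreal (real (Suc i) powr - p)" if "\<bar>n\<bar> = int i + 1" for n i
  proof -
    have "real (Suc i) \<le> jap n" using abs_le_jap[of n] that by linarith
    then show ?thesis using assms by (intro ennreal_leI powr_mono2') auto
  qed
  have split: "?f n \<le> ?f 0 * indicator {0} n + (?f n * indicator {1..} n + ?f n * indicator {..-1} n)" for n
    by (auto split: split_indicator)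
  let ?S = "nnsum (\<lambda>i. ennreal (real (Suc i) powr - p))"
  have "nnsum (\<lambda>n. ?f n * indicator {1..} n) = (\<integral>\<^sup>+n. ?f n \<partial>count_space {1..})"
    by (simp add: nn_integral_count_space_indicator)
  also have "\<dots> = nnsum (\<lambda>i. ?f (int i + 1))"
    by (rule nn_integral_bij_count_space[symmetric], rule bij_betwI[where g="\<lambda>n. nat (n - 1)"]) auto
  also have "\<dots> \<le> ?S"
    by (intro nn_integral_mono le) auto
  finally have pos: "nnsum (\<lambda>n. ?f n * indicator {1..} n) \<le> ?S" .
  have "nnsum (\<lambda>n. ?f n * indicator {..-1} n) = (\<integral>\<^sup>+n. ?f n \<partial>count_space {..-1})"
    by (simp add: nn_integral_count_space_indicator)
  also have "\<dots> = nnsum (\<lambda>i. ?f (- int i - 1))"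
    by (rule nn_integral_bij_count_space[symmetric], rule bij_betwI[where g="\<lambda>n. nat (- n - 1)"]) auto
  also have "\<dots> \<le> ?S"
    by (intro nn_integral_mono le) auto
  finally have neg: "nnsum (\<lambda>n. ?f n * indicator {..-1} n) \<le> ?S" .
  have "nnsum ?f \<le> nnsum (\<lambda>n. ?f 0 * indicator {0} n + (?f n * indicator {1..} n + ?f n * indicator {..-1} n))"
    by (intro nn_integral_mono split)
  also have "\<dots> = ?f 0 +
     (nnsum (\<lambda>n. ?f n * indicator {1..} n) + nnsum (\<lambda>n. ?f n * indicator {..-1} n))"
    by (simp add: nn_integral_add)
  also have "\<dots> \<le> ?f 0 + (?S + ?S)"
    by (intro add_mono pos neg order_refl)
  also have "\<dots> < \<infinity>"
    using nat by simp
  finally show ?thesis .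
qed

section \<open>Sobolev spaces\<close>

lemma summable_on_iff_integrable_nonneg:
  fixes f :: "'i \<Rightarrow> real"
  assumes "\<And>i. 0 \<le> f i"
  shows "f summable_on UNIV \<longleftrightarrow> integrable (count_space UNIV) f"
  using abs_summable_equivalent[of f UNIV] assms by (simp add: abs_summable_on_def)

text \<open>
  Unconditional and absolute summability agree for complex families, so this holds for every \<open>f\<close>. It
  makes linearity and measurability of Bochner integrals available for Fourier products.
\<close>

lemma infsum_complex_eq_integral:
  fixes f :: "'i \<Rightarrow> complex"
  shows "infsum f UNIV = integral\<^sup>L (count_space UNIV) f"
proof (cases "integrable (count_space UNIV) f")
  case True
  then show ?thesis
    using infsetsum_infsum[of f UNIV] by (simp add: abs_summable_on_def infsetsum_def)
next
  case False
  then have "\<not> f summable_on UNIV"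
    by (metis abs_summable_equivalent abs_summable_on_def summable_on_iff_abs_summable_on_complex)
  with False show ?thesis
    by (simp add: infsum_not_exists not_integrable_integral_eq)
qed

text \<open>
  The squared \<open>H\<^sup>s\<close> norm, with value \<open>\<infinity>\<close> outside \<open>H\<^sup>s\<close>.
\<close>

definition energy :: "real \<Rightarrow> (int \<Rightarrow> complex) \<Rightarrow> ennreal" where
  "energy s f = nnsum (\<lambda>n. ennreal (jap n powr (2 * s) * (cmod (f n))\<^sup>2))"

lemma sobolev_iff: "f \<in> sobolev s \<longleftrightarrow> energy s f < \<infinity>"
  unfolding sobolev_def energy_def mem_Collect_eq
  by (subst summable_on_iff_integrable_nonneg)
    (auto simp: integrable_iff_bounded)

lemma sobolev_norm_square:
  assumes "f \<in> sobolev s"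
  shows "ennreal ((sobolev_norm s f)\<^sup>2) = energy s f"
proof -
  let ?g = "\<lambda>n. jap n powr (2 * s) * (cmod (f n))\<^sup>2"
  have int: "integrable (count_space UNIV) ?g"
    using assms unfolding sobolev_def mem_Collect_eq
    by (subst (asm) summable_on_iff_integrable_nonneg) auto
  have "infsum ?g UNIV = integral\<^sup>L (count_space UNIV) ?g"
    using infsetsum_infsum[of ?g UNIV] int by (simp add: abs_summable_on_def infsetsum_def)
  moreover have "energy s f = ennreal (integral\<^sup>L (count_space UNIV) ?g)"
    unfolding energy_def by (rule nn_integral_eq_integral[OF int]) auto
  moreover have "0 \<le> integral\<^sup>L (count_space UNIV) ?g" by (intro Bochner_Integration.integral_nonneg) simp
  ultimately show ?thesis by (simp add: sobolev_norm_def)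
qed

lemma energy_mono_index:
  assumes "s \<le> s'"
  shows "energy s f \<le> energy s' f"
  unfolding energy_def
  by (intro nn_integral_mono ennreal_leI mult_right_mono powr_mono) (use assms in auto)

lemma energy_cong_cmod:
  "(\<And>n. cmod (f n) = cmod (h n)) \<Longrightarrow> energy s f = energy s h"
  by (simp add: energy_def)

lemma energy_scale:
  "energy s (\<lambda>n. c * f n) = ennreal ((cmod c)\<^sup>2) * energy s f"
proof -
  have "ennreal (jap n powr (2 * s) * (cmod (c * f n))\<^sup>2)
     = ennreal ((cmod c)\<^sup>2) * ennreal (jap n powr (2 * s) * (cmod (f n))\<^sup>2)" for n
    by (simp add: norm_mult power_mult_distrib ac_simps flip: ennreal_mult')
  then show ?thesis
    by (simp add: energy_def nn_integral_cmult)
qed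

lemma energy_zero [simp]: "energy s (\<lambda>n. 0) = 0"
  by (simp add: energy_def)

lemma energy_add:
  "energy s (\<lambda>n. f n + h n) \<le> 2 * energy s f + 2 * energy s h"
proof -
  have "ennreal (jap n powr (2 * s) * (cmod (f n + h n))\<^sup>2)
      \<le> 2 * ennreal (jap n powr (2 * s) * (cmod (f n))\<^sup>2) + 2 * ennreal (jap n powr (2 * s) * (cmod (h n))\<^sup>2)" for n
  proof -
    have "jap n powr (2 * s) * (cmod (f n + h n))\<^sup>2
       \<le> jap n powr (2 * s) * (2 * (cmod (f n))\<^sup>2 + 2 * (cmod (h n))\<^sup>2)"
      by (intro mult_left_mono cmod_square_add_le) simp
    also have "\<dots> = 2 * (jap n powr (2 * s) * (cmod (f n))\<^sup>2) + 2 * (jap n powr (2 * s) * (cmod (h n))\<^sup>2)"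
      by (simp add: algebra_simps)
    finally show ?thesis using ennreal_leI by (fastforce simp: ennreal_mult)
  qed
  then have "energy s (\<lambda>n. f n + h n) \<le> nnsum (\<lambda>n. 2 * ennreal (jap n powr (2 * s) * (cmod (f n))\<^sup>2)
      + 2 * ennreal (jap n powr (2 * s) * (cmod (h n))\<^sup>2))"
    unfolding energy_def by (rule nn_integral_mono)
  also have "\<dots> = 2 * energy s f + 2 * energy s h"
    by (simp add: energy_def nn_integral_add nn_integral_cmult)
  finally show ?thesis .
qed

lemma energy_diff:
  "energy s (\<lambda>n. f n - h n) \<le> 2 * energy s f + 2 * energy s h"
  using energy_add[of s f "\<lambda>n. - h n"] energy_cong_cmod[of "\<lambda>n. - h n" h s] by simp

lemma energy_commute: "energy s (\<lambda>n. f n - h n) = energy s (\<lambda>n. h n - f n)"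
  by (rule energy_cong_cmod) (rule norm_minus_commute)

lemma energy_triangle:
  "energy s (\<lambda>n. f n - h n)
    \<le> 2 * energy s (\<lambda>n. f n - k n) + 2 * energy s (\<lambda>n. k n - h n)"
  using energy_add[of s "\<lambda>n. f n - k n" "\<lambda>n. k n - h n"] by simp

lemma cmod_square_le_energy:
  assumes "0 \<le> s"
  shows "ennreal ((cmod (f n))\<^sup>2) \<le> energy s f"
proof -
  have "ennreal ((cmod (f n))\<^sup>2) \<le> ennreal (jap n powr (2 * s) * (cmod (f n))\<^sup>2)"
    using mult_right_mono[OF ge_one_powr_ge_zero[of "jap n" "2 * s"], of "(cmod (f n))\<^sup>2"] assms
    by (intro ennreal_leI) simp
  also have "\<dots> \<le> energy s f"
    unfolding energy_def by (rule nnsum_ge)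
  finally show ?thesis .
qed

lemma energy_eq_0_iff: "energy s f = 0 \<longleftrightarrow> (\<forall>n. f n = 0)"
  by (simp add: energy_def nn_integral_0_iff_AE AE_count_space ennreal_eq_0_iff mult_le_0_iff
      power2_less_eq_zero_iff)

section \<open>The product estimate\<close>

text \<open>
  The convolution of the absolute values, a majorant of the Fourier coefficients of a product that makes
  sense for arbitrary factors.
\<close>

definition fourier_abs :: "(int \<Rightarrow> complex) \<Rightarrow> (int \<Rightarrow> complex) \<Rightarrow> int \<Rightarrow> ennreal" where
  "fourier_abs f h n = nnsum (\<lambda>k. ennreal (cmod (f k) * cmod (h (n - k))))"

text \<open>
  Since \<open>\<langle>k\<rangle> \<le> \<langle>n\<rangle> + \<langle>n-k\<rangle>\<close>, the frequency \<open>k\<close> carrying the bad factor \<open>\<langle>k\<rangle>\<^sup>\<sigma>\<close> is at most twice the larger of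
  \<open>n\<close> and \<open>n - k\<close>. If \<open>n - k\<close> is the larger one, \<open>\<sigma> \<le> s\<close> allows the loss to be traded for a power of \<open>n\<close>;
  if \<open>n\<close> is, \<open>s + \<sigma> \<le> 1\<close> allows it to be traded for a power of \<open>n - k\<close>.
\<close>

lemma product_weight_bound:
  assumes "0 \<le> \<sigma>" "\<sigma> \<le> s" "s + \<sigma> \<le> 1"
  shows "jap n powr (s - 1)
      \<le> 2 * (jap n powr (\<sigma> - 1) + jap (n - k) powr (\<sigma> - 1)) * (jap k powr - \<sigma> * jap (n - k) powr s)"
proof -
  let ?N = "jap n" and ?K = "jap k" and ?M = "jap (n - k)"
  have two: "2 powr \<sigma> \<le> 2" using powr_mono[of \<sigma> 1 2] assms by simp
  have "?N powr (s - 1) * ?K powr \<sigma> * ?M powr - s \<le> 2 * (?N powr (\<sigma> - 1) + ?M powr (\<sigma> - 1))"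
  proof (cases "?N \<le> ?M")
    case True
    then have "?K \<le> 2 * ?M" using jap_triangle_diff[of k n] by simp
    then have "?K powr \<sigma> \<le> (2 * ?M) powr \<sigma>" using assms by (intro powr_mono2) auto
    also have "\<dots> \<le> 2 * ?M powr \<sigma>" using two by (simp add: powr_mult)
    finally have "?N powr (s - 1) * ?K powr \<sigma> * ?M powr - s \<le> ?N powr (s - 1) * (2 * ?M powr \<sigma>) * ?M powr - s"
      by (intro mult_left_mono mult_right_mono) auto
    also have "\<dots> = 2 * ?N powr (s - 1) * ?M powr (\<sigma> - s)"
      by (simp add: powr_diff powr_minus field_simps)
    also have "\<dots> \<le> 2 * ?N powr (s - 1) * ?N powr (\<sigma> - s)"
      using True assms by (intro mult_left_mono powr_mono2') auto
    also have "\<dots> = 2 * ?N powr (\<sigma> - 1)"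
      by (simp add: mult.assoc flip: powr_add)
    finally show ?thesis using powr_ge_zero[of ?M "\<sigma> - 1"] by argo
  next
    case False
    then have "?K \<le> 2 * ?N" using jap_triangle_diff[of k n] by simp
    then have "?K powr \<sigma> \<le> (2 * ?N) powr \<sigma>" using assms by (intro powr_mono2) auto
    also have "\<dots> \<le> 2 * ?N powr \<sigma>" using two by (simp add: powr_mult)
    finally have "?N powr (s - 1) * ?K powr \<sigma> * ?M powr - s \<le> ?N powr (s - 1) * (2 * ?N powr \<sigma>) * ?M powr - s"
      by (intro mult_left_mono mult_right_mono) auto
    also have "\<dots> = 2 * ?N powr (s + \<sigma> - 1) * ?M powr - s"
      by (simp add: powr_diff powr_add field_simps)
    also have "\<dots> \<le> 2 * ?M powr (s + \<sigma> - 1) * ?M powr - s"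
      using False assms by (intro mult_left_mono mult_right_mono powr_mono2') auto
    also have "\<dots> = 2 * ?M powr (\<sigma> - 1)"
      by (simp add: mult.assoc flip: powr_add)
    finally show ?thesis using powr_ge_zero[of ?N "\<sigma> - 1"] by argo
  qed
  then show ?thesis by (simp add: powr_minus field_simps)
qed

definition product_const :: "real \<Rightarrow> ennreal" where
  "product_const \<sigma> = 16 * nnsum (\<lambda>n. ennreal (jap n powr - (2 - 2 * \<sigma>)))"

lemma product_const_finite: "\<sigma> < 1 / 2 \<Longrightarrow> product_const \<sigma> < \<infinity>"
  unfolding product_const_def
  using nnsum_jap_powr_finite[of "2 - 2 * \<sigma>"] by (simp add: ennreal_mult_less_top)

lemma powr_half_square: "(jap n powr a)\<^sup>2 = jap n powr (2 * a)"
  by (simp add: power2_eq_square flip: powr_add)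

text \<open>
  The two summands of the weight bound lead to the product of a square summable weight with a bounded
  convolution, and to an \<open>l\<^sup>2 * l\<^sup>1\<close> convolution. In the second one the weight makes \<open>h\<close> summable.
\<close>

lemma fourier_abs_estimate:
  assumes "0 \<le> \<sigma>" "\<sigma> \<le> s" "s + \<sigma> \<le> 1"
  shows "nnsum (\<lambda>n. ennreal (jap n powr (2 * s - 2)) * (fourier_abs f h n)\<^sup>2)
     \<le> product_const \<sigma> * (energy (- \<sigma>) f * energy s h)"
proof -
  define F where "F k = ennreal (jap k powr - \<sigma> * cmod (f k))" for k
  define H where "H k = ennreal (jap k powr s * cmod (h k))" for k
  define J where "J k = ennreal (jap k powr (\<sigma> - 1))" for k
  let ?Z = "nnsum (\<lambda>n. ennreal (jap n powr - (2 - 2 * \<sigma>)))"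
  let ?A = "\<lambda>n. nnsum (\<lambda>k. F k * H (n - k))" and ?B = "\<lambda>n. nnsum (\<lambda>k. F k * (J (n - k) * H (n - k)))"
    and ?E = "energy (- \<sigma>) f * energy s h"
  have F: "nnsum (\<lambda>k. (F k)\<^sup>2) = energy (- \<sigma>) f"
    unfolding F_def energy_def by (simp add: ennreal_power power_mult_distrib powr_half_square)
  have H: "nnsum (\<lambda>k. (H k)\<^sup>2) = energy s h"
    unfolding H_def energy_def by (simp add: ennreal_power power_mult_distrib powr_half_square)
  have J: "nnsum (\<lambda>k. (J k)\<^sup>2) = ?Z"
    unfolding J_def by (simp add: ennreal_power powr_half_square algebra_simps)
  have pt: "ennreal (jap n powr (s - 1)) * fourier_abs f h n
     \<le> 2 * (J n * ?A n + ?B n)" for n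
  proof -
    have "ennreal (jap n powr (s - 1)) * fourier_abs f h n
       = nnsum (\<lambda>k. ennreal (jap n powr (s - 1)) * ennreal (cmod (f k) * cmod (h (n - k))))"
      by (simp add: fourier_abs_def nn_integral_cmult)
    also have "\<dots> \<le> nnsum (\<lambda>k. 2 * (J n * (F k * H (n - k)) + F k * (J (n - k) * H (n - k))))"
    proof (rule nn_integral_mono)
      fix k
      have "jap n powr (s - 1) * (cmod (f k) * cmod (h (n - k)))
        \<le> (2 * (jap n powr (\<sigma> - 1) + jap (n - k) powr (\<sigma> - 1)) * (jap k powr - \<sigma> * jap (n - k) powr s))
            * (cmod (f k) * cmod (h (n - k)))"
        by (intro mult_right_mono product_weight_bound assms) simp
      also have "\<dots> = 2 * (jap n powr (\<sigma> - 1) * ((jap k powr - \<sigma> * cmod (f k)) * (jap (n - k) powr s * cmod (h (n - k))))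
         + (jap k powr - \<sigma> * cmod (f k)) * (jap (n - k) powr (\<sigma> - 1) * (jap (n - k) powr s * cmod (h (n - k)))))"
        by (simp add: algebra_simps)
      finally show "ennreal (jap n powr (s - 1)) * ennreal (cmod (f k) * cmod (h (n - k)))
         \<le> 2 * (J n * (F k * H (n - k)) + F k * (J (n - k) * H (n - k)))"
        unfolding J_def F_def H_def
        using ennreal_leI by (fastforce simp: ennreal_mult)
    qed
    also have "\<dots> = 2 * (J n * ?A n + ?B n)"
      by (simp add: nn_integral_add nn_integral_cmult)
    finally show ?thesis .
  qed
  have "ennreal (jap n powr (2 * s - 2)) * (fourier_abs f h n)\<^sup>2
     \<le> 8 * ((J n)\<^sup>2 * ?E
         + (?B n)\<^sup>2)" for n
  proof -
    have "ennreal (jap n powr (2 * s - 2)) * (fourier_abs f h n)\<^sup>2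
       = (ennreal (jap n powr (s - 1)) * fourier_abs f h n)\<^sup>2"
      by (simp add: power_mult_distrib ennreal_power powr_half_square algebra_simps)
    also have "\<dots> \<le> (2 * (J n * ?A n + ?B n))\<^sup>2"
      by (rule power_mono[OF pt]) simp
    also have "\<dots> = 4 * (J n * ?A n + ?B n)\<^sup>2"
      by (simp only: power_mult_distrib) simp
    also have "\<dots> \<le> 4 * (2 * (J n * ?A n)\<^sup>2
         + 2 * (?B n)\<^sup>2)"
      by (intro mult_left_mono ennreal_square_add_le) simp
    also have "\<dots> = 8 * ((J n)\<^sup>2 * (?A n)\<^sup>2
         + (?B n)\<^sup>2)"
      by (simp add: power_mult_distrib distrib_left mult.assoc[symmetric])
    also have "\<dots> \<le> 8 * ((J n)\<^sup>2 * ?E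
         + (?B n)\<^sup>2)"
      using nnsum_convolution_le[of F H n] unfolding F H
      by (intro mult_left_mono add_mono order_refl) auto
    finally show ?thesis .
  qed
  then have "nnsum (\<lambda>n. ennreal (jap n powr (2 * s - 2)) * (fourier_abs f h n)\<^sup>2)
     \<le> nnsum (\<lambda>n. 8 * ((J n)\<^sup>2 * ?E
         + (?B n)\<^sup>2))"
    by (rule nn_integral_mono)
  also have "\<dots> = 8 * (?Z * ?E
         + nnsum (\<lambda>n. (?B n)\<^sup>2))"
    by (simp add: nn_integral_add nn_integral_cmult nn_integral_multc J)
  also have "\<dots> \<le> 8 * (?Z * ?E
         + energy (- \<sigma>) f * (?Z * energy s h))"
  proof (intro mult_left_mono add_mono order_refl)
    have "nnsum (\<lambda>n. (nnsum (\<lambda>k. F k * (J (n - k) * H (n - k))))\<^sup>2)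
        \<le> energy (- \<sigma>) f * (nnsum (\<lambda>k. J k * H k))\<^sup>2"
      using nnsum_convolution_Young[of F "\<lambda>k. J k * H k"] by (simp add: F)
    also have "\<dots> \<le> energy (- \<sigma>) f * (?Z * energy s h)"
      using nn_integral_Cauchy_Schwarz[of J "count_space UNIV" H]
      by (intro mult_left_mono) (auto simp: J H)
    finally show "nnsum (\<lambda>n. (nnsum (\<lambda>k. F k * (J (n - k) * H (n - k))))\<^sup>2)
       \<le> energy (- \<sigma>) f * (?Z * energy s h)" .
  qed simp_all
  also have "\<dots> = product_const \<sigma> * (energy (- \<sigma>) f * energy s h)"
  proof -
    have double: "8 * (a + a) = 16 * (a::ennreal)" for a
      by (simp add: distrib_left flip: distrib_right)
    have comm: "energy (- \<sigma>) f * (?Z * energy s h)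
        = ?Z * (energy (- \<sigma>) f * energy s h)"
      by (simp only: ac_simps)
    show ?thesis by (simp only: comm double product_const_def mult.assoc)
  qed
  finally show ?thesis .
qed

lemma fourier_abs_finite:
  assumes "0 \<le> \<sigma>" "\<sigma> < 1 / 2" "\<sigma> \<le> s" "s + \<sigma> \<le> 1"
    and "energy (- \<sigma>) f < \<infinity>" "energy s h < \<infinity>"
  shows "fourier_abs f h n < \<infinity>"
proof -
  have "nnsum (\<lambda>n. ennreal (jap n powr (2 * s - 2)) * (fourier_abs f h n)\<^sup>2) < \<infinity>"
    by (rule le_less_trans[OF fourier_abs_estimate[of \<sigma>]])
      (use assms product_const_finite[of \<sigma>] in \<open>auto simp: ennreal_mult_less_top\<close>)
  from nnsum_lt_top_imp[OF this, of n] show ?thesis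
    by (auto simp: ennreal_mult_less_top power_less_top_ennreal)
qed

lemma fourier_prod_eq_integral:
  "fourier_prod f h n = (\<integral>k. f k * h (n - k) \<partial>count_space UNIV)"
  unfolding fourier_prod_def by (rule infsum_complex_eq_integral)

lemma fourier_prod_le_abs: "ennreal (cmod (fourier_prod f h n)) \<le> fourier_abs f h n"
proof (cases "integrable (count_space UNIV) (\<lambda>k. f k * h (n - k))")
  case True
  then show ?thesis
    unfolding fourier_prod_eq_integral fourier_abs_def
    using integral_norm_bound_ennreal[OF True] by (simp add: norm_mult)
next
  case False
  then show ?thesis by (simp add: fourier_prod_eq_integral not_integrable_integral_eq)
qed

lemma fourier_abs_integrable:
  "fourier_abs f h n < \<infinity> \<Longrightarrow> integrable (count_space UNIV) (\<lambda>k. f k * h (n - k))"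
  by (simp add: integrable_iff_bounded fourier_abs_def norm_mult)

text \<open>
  Products are defined by series that need not converge, so bilinearity requires absolute convergence.
\<close>

lemma fourier_prod_diff_left:
  assumes "fourier_abs f h n < \<infinity>" "fourier_abs f' h n < \<infinity>"
  shows "fourier_prod (\<lambda>k. f k - f' k) h n = fourier_prod f h n - fourier_prod f' h n"
  using assms[THEN fourier_abs_integrable]
  by (simp add: fourier_prod_eq_integral left_diff_distrib)

lemma fourier_prod_diff_right:
  assumes "fourier_abs f h n < \<infinity>" "fourier_abs f h' n < \<infinity>"
  shows "fourier_prod f (\<lambda>k. h k - h' k) n = fourier_prod f h n - fourier_prod f h' n"
  using assms[THEN fourier_abs_integrable]
  by (simp add: fourier_prod_eq_integral right_diff_distrib)

text \<open>
  The symbol \<open>\<phi>\<close> gains one derivative, exactly the one lost in the estimate of the product.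
\<close>

lemma fourier_mult_product_energy:
  assumes "0 \<le> \<sigma>" "\<sigma> \<le> s" "s + \<sigma> \<le> 1"
  shows "energy s (fourier_mult bbm_symbol (fourier_prod f h))
     \<le> product_const \<sigma> * (energy (- \<sigma>) f * energy s h)"
proof -
  have "ennreal (jap n powr (2 * s) * (cmod (fourier_mult bbm_symbol (fourier_prod f h) n))\<^sup>2)
     \<le> ennreal (jap n powr (2 * s - 2)) * (fourier_abs f h n)\<^sup>2" for n
  proof -
    have "cmod (fourier_mult bbm_symbol (fourier_prod f h) n) \<le> 1 / jap n * cmod (fourier_prod f h n)"
      unfolding fourier_mult_def norm_mult norm_of_real
      by (intro mult_right_mono bbm_symbol_bound) simp
    then have "jap n powr (2 * s) * (cmod (fourier_mult bbm_symbol (fourier_prod f h) n))\<^sup>2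
       \<le> jap n powr (2 * s) * (1 / jap n * cmod (fourier_prod f h n))\<^sup>2"
      by (intro mult_left_mono power_mono) auto
    also have "\<dots> = jap n powr (2 * s - 2) * (cmod (fourier_prod f h n))\<^sup>2"
      by (simp add: powr_diff power_mult_distrib power_divide powr_numeral)
    finally have "ennreal (jap n powr (2 * s) * (cmod (fourier_mult bbm_symbol (fourier_prod f h) n))\<^sup>2)
      \<le> ennreal (jap n powr (2 * s - 2)) * (ennreal (cmod (fourier_prod f h n)))\<^sup>2"
      using ennreal_leI by (fastforce simp: ennreal_mult ennreal_power)
    also have "\<dots> \<le> ennreal (jap n powr (2 * s - 2)) * (fourier_abs f h n)\<^sup>2"
      by (intro mult_left_mono power_mono fourier_prod_le_abs) auto
    finally show ?thesis .
  qed
  then have "energy s (fourier_mult bbm_symbol (fourier_prod f h))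
     \<le> nnsum (\<lambda>n. ennreal (jap n powr (2 * s - 2)) * (fourier_abs f h n)\<^sup>2)"
    unfolding energy_def by (rule nn_integral_mono)
  also have "\<dots> \<le> product_const \<sigma> * (energy (- \<sigma>) f * energy s h)"
    by (rule fourier_abs_estimate[OF assms])
  finally show ?thesis .
qed

section \<open>Duhamel integrals and continuous curves in Sobolev spaces\<close>

lemma cmod_bbm_group [simp]: "cmod (bbm_group t f n) = cmod (f n)"
  by (simp add: bbm_group_def norm_mult)

lemma energy_bbm_group [simp]: "energy s (bbm_group t f) = energy s f"
  by (rule energy_cong_cmod) simp

lemma bbm_group_diff: "bbm_group t f n - bbm_group t h n = bbm_group t (\<lambda>n. f n - h n) n"
  by (simp add: bbm_group_def right_diff_distrib)

text \<open>
  The integral term of the Duhamel formula with right-hand side \<open>F\<close>, one Fourier coefficient at a time.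
\<close>

definition duhamel :: "(real \<Rightarrow> int \<Rightarrow> complex) \<Rightarrow> real \<Rightarrow> int \<Rightarrow> complex" where
  "duhamel F t n = - (\<i> / 2) * set_lebesgue_integral lborel {0..t} (\<lambda>t'. bbm_group (t - t') (F t') n)"

text \<open>
  Cauchy-Schwarz in time. The squared form is what passes through the sum over frequencies by Tonelli,
  and so replaces Minkowski's integral inequality.
\<close>

lemma set_lebesgue_integral_square_le:
  fixes G :: "real \<Rightarrow> complex"
  assumes G: "set_integrable lborel {0..t} G" and "t \<le> T"
  shows "ennreal ((cmod (set_lebesgue_integral lborel {0..t} G))\<^sup>2)
    \<le> ennreal T * (\<integral>\<^sup>+r. ennreal ((cmod (G r))\<^sup>2) * indicator {0..t} r \<partial>lborel)"
proof -
  let ?G = "\<lambda>r. indicator {0..t} r *\<^sub>R G r"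
  have [measurable]: "?G \<in> borel_measurable lborel"
    using G by (simp add: set_integrable_def)
  have "ennreal (cmod (set_lebesgue_integral lborel {0..t} G)) \<le> (\<integral>\<^sup>+r. ennreal (cmod (?G r)) \<partial>lborel)"
    unfolding set_lebesgue_integral_def
    by (rule integral_norm_bound_ennreal) (use G in \<open>simp add: set_integrable_def\<close>)
  also have "\<dots> = (\<integral>\<^sup>+r. ennreal (cmod (?G r)) * indicator {0..t} r \<partial>lborel)"
    by (intro nn_integral_cong) (auto split: split_indicator)
  finally have "(ennreal (cmod (set_lebesgue_integral lborel {0..t} G)))\<^sup>2
      \<le> (\<integral>\<^sup>+r. ennreal (cmod (?G r)) * indicator {0..t} r \<partial>lborel)\<^sup>2"
    by (rule power_mono) simp
  also have "\<dots> \<le> (\<integral>\<^sup>+r. (ennreal (cmod (?G r)))\<^sup>2 \<partial>lborel) * (\<integral>\<^sup>+r. (indicator {0..t} r)\<^sup>2 \<partial>lborel)"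
    by (rule nn_integral_Cauchy_Schwarz) measurable
  also have "(\<integral>\<^sup>+r. (ennreal (cmod (?G r)))\<^sup>2 \<partial>lborel)
      = (\<integral>\<^sup>+r. ennreal ((cmod (G r))\<^sup>2) * indicator {0..t} r \<partial>lborel)"
    by (intro nn_integral_cong) (auto split: split_indicator simp: ennreal_power)
  also have "(\<integral>\<^sup>+r. (indicator {0..t} r)\<^sup>2 \<partial>lborel) = (\<integral>\<^sup>+r. indicator {0..t} r \<partial>lborel)"
    by (intro nn_integral_cong) (auto split: split_indicator)
  also have "(\<integral>\<^sup>+r. ennreal ((cmod (G r))\<^sup>2) * indicator {0..t} r \<partial>lborel) * (\<integral>\<^sup>+r. indicator {0..t} r \<partial>lborel)
      \<le> (\<integral>\<^sup>+r. ennreal ((cmod (G r))\<^sup>2) * indicator {0..t} r \<partial>lborel) * ennreal T"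
    using \<open>t \<le> T\<close> by (intro mult_left_mono, cases "0 \<le> t") (auto intro: ennreal_leI)
  finally show ?thesis
    by (simp add: ennreal_power mult.commute)
qed

text \<open>
  The group preserves the absolute value of each coefficient, so it disappears from the estimate.
\<close>

lemma duhamel_energy_diff:
  assumes t: "0 \<le> t" "t \<le> T"
    and F: "\<And>n. set_integrable lborel {0..t} (\<lambda>t'. bbm_group (t - t') (F t') n)"
    and F': "\<And>n. set_integrable lborel {0..t} (\<lambda>t'. bbm_group (t - t') (F' t') n)"
  shows "energy s (\<lambda>n. duhamel F t n - duhamel F' t n)
    \<le> ennreal T * (\<integral>\<^sup>+r. energy s (\<lambda>n. F r n - F' r n) * indicator {0..t} r \<partial>lborel)"
proof -
  define G where "G n r = bbm_group (t - r) (F r) n - bbm_group (t - r) (F' r) n" for n r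
  have G: "set_integrable lborel {0..t} (G n)" for n
    unfolding G_def using F F' by (rule set_integral_diff)
  have cG: "cmod (G n r) = cmod (F r n - F' r n)" for n r
    by (simp add: G_def bbm_group_diff)
  have D: "duhamel F t n - duhamel F' t n = - (\<i> / 2) * set_lebesgue_integral lborel {0..t} (G n)" for n
    unfolding duhamel_def G_def using F F'
    by (subst set_integral_diff) (auto simp: algebra_simps)
  let ?I = "\<lambda>n. \<integral>\<^sup>+r. ennreal ((cmod (G n r))\<^sup>2) * indicator {0..t} r \<partial>lborel"
  have meas: "(\<lambda>r. ennreal (jap n powr (2 * s)) * (ennreal ((cmod (G n r))\<^sup>2) * indicator {0..t} r)) \<in> borel_measurable lborel"
    and meas': "(\<lambda>r. ennreal ((cmod (G n r))\<^sup>2) * indicator {0..t} r) \<in> borel_measurable lborel" for n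
  proof -
    have [measurable]: "(\<lambda>r. indicator {0..t} r *\<^sub>R G n r) \<in> borel_measurable lborel"
      using G[of n] by (simp add: set_integrable_def)
    have "(\<lambda>r. ennreal ((cmod (G n r))\<^sup>2) * indicator {0..t} r)
       = (\<lambda>r. ennreal ((cmod (indicator {0..t} r *\<^sub>R G n r))\<^sup>2))"
      by (auto split: split_indicator)
    then show *: "(\<lambda>r. ennreal ((cmod (G n r))\<^sup>2) * indicator {0..t} r) \<in> borel_measurable lborel"
      by (simp only:) measurable
    then show "(\<lambda>r. ennreal (jap n powr (2 * s)) * (ennreal ((cmod (G n r))\<^sup>2) * indicator {0..t} r)) \<in> borel_measurable lborel"
      by measurable
  qed
  have "energy s (\<lambda>n. duhamel F t n - duhamel F' t n)
     \<le> nnsum (\<lambda>n. ennreal T * (ennreal (jap n powr (2 * s)) * ?I n))"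
    unfolding energy_def
  proof (rule nn_integral_mono)
    fix n
    have "(cmod (duhamel F t n - duhamel F' t n))\<^sup>2 \<le> (cmod (set_lebesgue_integral lborel {0..t} (G n)))\<^sup>2"
      unfolding D by (intro power_mono) (simp_all add: norm_mult norm_divide)
    then have "ennreal (jap n powr (2 * s) * (cmod (duhamel F t n - duhamel F' t n))\<^sup>2)
       \<le> ennreal (jap n powr (2 * s)) * ennreal ((cmod (set_lebesgue_integral lborel {0..t} (G n)))\<^sup>2)"
      by (simp add: mult_left_mono flip: ennreal_mult)
    also have "\<dots> \<le> ennreal (jap n powr (2 * s)) * (ennreal T * ?I n)"
      by (intro mult_left_mono set_lebesgue_integral_square_le G t) simp
    finally show "ennreal (jap n powr (2 * s) * (cmod (duhamel F t n - duhamel F' t n))\<^sup>2)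
       \<le> ennreal T * (ennreal (jap n powr (2 * s)) * ?I n)"
      by (simp add: ac_simps)
  qed
  also have "\<dots> = ennreal T * nnsum (\<lambda>n. ennreal (jap n powr (2 * s)) * ?I n)"
    by (simp add: nn_integral_cmult)
  also have "nnsum (\<lambda>n. ennreal (jap n powr (2 * s)) * ?I n)
     = nnsum (\<lambda>n. \<integral>\<^sup>+r. ennreal (jap n powr (2 * s)) * (ennreal ((cmod (G n r))\<^sup>2) * indicator {0..t} r) \<partial>lborel)"
    using meas' by (simp add: nn_integral_cmult)
  also have "\<dots> = (\<integral>\<^sup>+r. nnsum (\<lambda>n. ennreal (jap n powr (2 * s)) * (ennreal ((cmod (G n r))\<^sup>2) * indicator {0..t} r)) \<partial>lborel)"
    using meas by (rule nnsum_swap[symmetric])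
  also have "\<dots> = (\<integral>\<^sup>+r. energy s (\<lambda>n. F r n - F' r n) * indicator {0..t} r \<partial>lborel)"
    by (intro nn_integral_cong)
      (simp add: energy_def cG ennreal_mult nn_integral_multc flip: mult.assoc)
  finally show ?thesis .
qed

lemma duhamel_energy:
  assumes t: "0 \<le> t" "t \<le> T"
    and F: "\<And>n. set_integrable lborel {0..t} (\<lambda>t'. bbm_group (t - t') (F t') n)"
  shows "energy s (duhamel F t)
    \<le> ennreal T * (\<integral>\<^sup>+r. energy s (F r) * indicator {0..t} r \<partial>lborel)"
proof -
  have "duhamel (\<lambda>_ _. 0) t n = 0" for n
    by (simp add: duhamel_def bbm_group_def set_lebesgue_integral_def)
  moreover have "set_integrable lborel {0..t} (\<lambda>t'. bbm_group (t - t') (\<lambda>_. 0) n)" for n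
    by (simp add: bbm_group_def set_integrable_def)
  ultimately show ?thesis
    using duhamel_energy_diff[OF t F, of "\<lambda>_ _. 0" s] by simp
qed

text \<open>
  On a bounded time interval a square integrable coefficient is integrable, because \<open>x \<le> 1 + x\<^sup>2\<close>.
\<close>

lemma duhamel_integrable:
  assumes "0 \<le> s" and t: "t \<le> T"
    and [measurable]: "\<And>n. (\<lambda>r. F r n) \<in> borel_measurable borel"
    and fin: "(\<integral>\<^sup>+r. energy s (F r) * indicator {0..T} r \<partial>lborel) < \<infinity>"
  shows "set_integrable lborel {0..t} (\<lambda>r. exp (\<i> * complex_of_real (c * r)) * F r n)"
proof -
  have "(\<integral>\<^sup>+r. ennreal (cmod (indicator {0..t} r *\<^sub>R (exp (\<i> * complex_of_real (c * r)) * F r n))) \<partial>lborel)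
     \<le> (\<integral>\<^sup>+r. indicator {0..T} r + ennreal ((cmod (F r n))\<^sup>2) * indicator {0..T} r \<partial>lborel)"
  proof (rule nn_integral_mono)
    fix r
    have "cmod (F r n) \<le> 1 + (cmod (F r n))\<^sup>2"
      using sum_squares_bound[of 1 "cmod (F r n)"] by (simp add: power2_eq_square)
        (smt (verit) norm_ge_zero)
    then have "ennreal (cmod (F r n)) \<le> 1 + ennreal ((cmod (F r n))\<^sup>2)"
      by (metis ennreal_1 ennreal_leI ennreal_plus zero_le_one zero_le_power2)
    then show "ennreal (cmod (indicator {0..t} r *\<^sub>R (exp (\<i> * complex_of_real (c * r)) * F r n)))
       \<le> indicator {0..T} r + ennreal ((cmod (F r n))\<^sup>2) * indicator {0..T} r"
      using t by (auto split: split_indicator simp: norm_mult)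
  qed
  also have "\<dots> = (\<integral>\<^sup>+r. indicator {0..T} r \<partial>lborel) + (\<integral>\<^sup>+r. ennreal ((cmod (F r n))\<^sup>2) * indicator {0..T} r \<partial>lborel)"
    by (rule nn_integral_add) auto
  also have "\<dots> \<le> (\<integral>\<^sup>+r. indicator {0..T} r \<partial>lborel) + (\<integral>\<^sup>+r. energy s (F r) * indicator {0..T} r \<partial>lborel)"
    by (intro add_mono nn_integral_mono mult_right_mono cmod_square_le_energy assms) auto
  also have "\<dots> < \<infinity>"
    using fin by (cases "0 \<le> T") auto
  finally show ?thesis
    unfolding set_integrable_def by (simp add: integrable_iff_bounded)
qed

lemma bbm_group_split:
  "bbm_group (t - r) f n = exp (- \<i> * complex_of_real (t * bbm_symbol n)) * (exp (\<i> * complex_of_real (bbm_symbol n * r)) * f n)"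
  by (simp add: bbm_group_def algebra_simps flip: exp_add)

lemma tendsto_zero_of_square:
  fixes a :: "nat \<Rightarrow> real"
  assumes "(\<lambda>i. ennreal ((a i)\<^sup>2)) \<longlonglongrightarrow> 0"
  shows "a \<longlonglongrightarrow> 0"
proof -
  have "(\<lambda>i. (a i)\<^sup>2) \<longlonglongrightarrow> 0"
    using assms by (subst (asm) ennreal_0[symmetric], subst (asm) tendsto_ennreal_iff) auto
  then have "(\<lambda>i. sqrt ((a i)\<^sup>2)) \<longlonglongrightarrow> sqrt 0" by (rule tendsto_real_sqrt)
  then show ?thesis by (simp add: tendsto_rabs_zero_iff)
qed

text \<open>
  Continuity in \<open>H\<^sup>s\<close> follows from continuity of each coefficient and a majorant that does not depend on
  time, by dominated convergence over the frequencies.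
\<close>

lemma cont_sobolev_dominated:
  assumes cont: "\<And>n. continuous_on {0..T} (\<lambda>t. v t n)"
    and dom: "\<And>t n. t \<in> {0..T} \<Longrightarrow> ennreal ((cmod (v t n))\<^sup>2) \<le> D n"
    and fin: "nnsum (\<lambda>n. ennreal (jap n powr (2 * s)) * D n) < \<infinity>"
  shows "v \<in> cont_sobolev T s"
proof -
  have energy: "energy s (v t) \<le> nnsum (\<lambda>n. ennreal (jap n powr (2 * s)) * D n)" if "t \<in> {0..T}" for t
    unfolding energy_def
    by (intro nn_integral_mono, subst ennreal_mult, simp, simp, intro mult_left_mono dom that, simp)
  then have sob: "v t \<in> sobolev s" if "t \<in> {0..T}" for t
    using that fin by (metis sobolev_iff le_less_trans)
  have "((\<lambda>r. sobolev_norm s (\<lambda>n. v r n - v t n)) \<longlongrightarrow> 0) (at t within {0..T})" if t: "t \<in> {0..T}" for t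
    unfolding tendsto_at_iff_sequentially comp_def
  proof (intro allI impI)
    fix X :: "nat \<Rightarrow> real"
    assume X: "\<forall>i. X i \<in> {0..T} - {t}" "X \<longlonglongrightarrow> t"
    have dsob: "(\<lambda>n. v (X i) n - v t n) \<in> sobolev s" for i
    proof -
      have "energy s (v (X i)) < \<infinity>" "energy s (v t) < \<infinity>"
        using sob X(1) t by (auto simp: sobolev_iff)
      then show ?thesis
        using energy_diff[of s "v (X i)" "v t"]
        by (auto simp: sobolev_iff ennreal_mult_less_top intro: le_less_trans)
    qed
    let ?e = "\<lambda>i n. ennreal (jap n powr (2 * s) * (cmod (v (X i) n - v t n))\<^sup>2)"
    have "(\<lambda>i. nnsum (\<lambda>n. ?e i n))
        \<longlonglongrightarrow> nnsum (\<lambda>n::int. 0)"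
    proof (rule nn_integral_dominated_convergence[where w="\<lambda>n. 4 * (ennreal (jap n powr (2 * s)) * D n)"])
      show "AE n in count_space UNIV. ?e i n
          \<le> 4 * (ennreal (jap n powr (2 * s)) * D n)" for i
      proof (rule AE_I2)
        fix n
        have "ennreal ((cmod (v (X i) n - v t n))\<^sup>2) \<le> ennreal (2 * (cmod (v (X i) n))\<^sup>2 + 2 * (cmod (v t n))\<^sup>2)"
          using cmod_square_add_le[of "v (X i) n" "- v t n"] by (intro ennreal_leI) simp
        also have "\<dots> = 2 * ennreal ((cmod (v (X i) n))\<^sup>2) + 2 * ennreal ((cmod (v t n))\<^sup>2)"
          by (simp add: ennreal_mult)
        also have "\<dots> \<le> 2 * D n + 2 * D n"
          using X(1) t by (intro add_mono mult_left_mono dom) auto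
        also have "\<dots> = 4 * D n" by (simp flip: distrib_right)
        finally have "ennreal ((cmod (v (X i) n - v t n))\<^sup>2) \<le> 4 * D n" .
        from mult_left_mono[OF this, of "ennreal (jap n powr (2 * s))"]
        show "?e i n
          \<le> 4 * (ennreal (jap n powr (2 * s)) * D n)"
          by (simp add: ennreal_mult mult.left_commute)
      qed
      show "(\<integral>\<^sup>+ n. 4 * (ennreal (jap n powr (2 * s)) * D n) \<partial>count_space UNIV) < \<infinity>"
        using fin by (simp add: nn_integral_cmult ennreal_mult_less_top)
      show "AE n in count_space UNIV. (\<lambda>i. ?e i n) \<longlonglongrightarrow> 0"
      proof (rule AE_I2)
        fix n
        have "(\<lambda>i. v (X i) n) \<longlonglongrightarrow> v t n"
          using cont[of n] X t by (auto simp: continuous_on_sequentially comp_def)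
        then have "(\<lambda>i. jap n powr (2 * s) * (cmod (v (X i) n - v t n))\<^sup>2) \<longlonglongrightarrow> jap n powr (2 * s) * (cmod (v t n - v t n))\<^sup>2"
          by (intro tendsto_intros)
        then show "(\<lambda>i. ?e i n) \<longlonglongrightarrow> 0"
          using tendsto_ennrealI by fastforce
      qed
    qed auto
    then have "(\<lambda>i. ennreal ((sobolev_norm s (\<lambda>n. v (X i) n - v t n))\<^sup>2)) \<longlonglongrightarrow> 0"
      by (simp add: sobolev_norm_square[OF dsob] energy_def)
    then show "(\<lambda>i. sobolev_norm s (\<lambda>n. v (X i) n - v t n)) \<longlonglongrightarrow> 0"
      by (rule tendsto_zero_of_square)
  qed
  with sob show ?thesis by (simp add: cont_sobolev_def)
qed

lemma bbm_group_cont_sobolev: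
  assumes "energy s u < \<infinity>"
  shows "(\<lambda>t. bbm_group t u) \<in> cont_sobolev T s"
proof (rule cont_sobolev_dominated[where D="\<lambda>n. ennreal ((cmod (u n))\<^sup>2)"])
  show "continuous_on {0..T} (\<lambda>t. bbm_group t u n)" for n
    unfolding bbm_group_def by (intro continuous_intros)
  show "nnsum (\<lambda>n. ennreal (jap n powr (2 * s)) * ennreal ((cmod (u n))\<^sup>2)) < \<infinity>"
    using assms by (simp add: energy_def ennreal_mult)
qed simp

lemma duhamel_continuous:
  assumes "0 \<le> s"
    and F: "\<And>n. (\<lambda>r. F r n) \<in> borel_measurable borel"
    and fin: "(\<integral>\<^sup>+r. energy s (F r) * indicator {0..T} r \<partial>lborel) < \<infinity>"
  shows "continuous_on {0..T} (\<lambda>t. duhamel F t n)"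
proof -
  let ?G = "\<lambda>r. exp (\<i> * complex_of_real (bbm_symbol n * r)) * F r n"
  have G: "set_integrable lborel {0..t} ?G" if "t \<le> T" for t
    by (rule duhamel_integrable[OF \<open>0 \<le> s\<close> that F fin])
  have "continuous_on {0..T} (\<lambda>t. integral {0..t} ?G)"
    using set_borel_integral_eq_integral(1)[OF G[OF order_refl]]
    by (rule indefinite_integral_continuous_1)
  then have "continuous_on {0..T} (\<lambda>t. - (\<i> / 2) * (exp (- \<i> * complex_of_real (t * bbm_symbol n)) * integral {0..t} ?G))"
    by (intro continuous_intros)
  then show ?thesis
  proof (rule continuous_on_eq)
    fix t assume "t \<in> {0..T}"
    then show "- (\<i> / 2) * (exp (- \<i> * complex_of_real (t * bbm_symbol n)) * integral {0..t} ?G) = duhamel F t n"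
      using set_borel_integral_eq_integral(2)[OF G[of t]]
      by (simp add: duhamel_def bbm_group_split)
  qed
qed

lemma duhamel_cont_sobolev:
  assumes "0 \<le> s"
    and F: "\<And>n. (\<lambda>r. F r n) \<in> borel_measurable borel"
    and fin: "(\<integral>\<^sup>+r. energy s (F r) * indicator {0..T} r \<partial>lborel) < \<infinity>"
  shows "duhamel F \<in> cont_sobolev T s"
proof (rule cont_sobolev_dominated)
  let ?I = "\<lambda>n. \<integral>\<^sup>+r. ennreal ((cmod (F r n))\<^sup>2) * indicator {0..T} r \<partial>lborel"
  note [measurable] = F
  show "continuous_on {0..T} (\<lambda>t. duhamel F t n)" for n
    by (rule duhamel_continuous[OF assms])
  show "ennreal ((cmod (duhamel F t n))\<^sup>2) \<le> ennreal T * ?I n" if t: "t \<in> {0..T}" for t n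
  proof -
    have int: "set_integrable lborel {0..t} (\<lambda>r. bbm_group (t - r) (F r) n)"
      unfolding bbm_group_split using t
      by (intro set_integrable_mult_right impI duhamel_integrable[OF \<open>0 \<le> s\<close> _ F fin]) auto
    have "(cmod (duhamel F t n))\<^sup>2
        \<le> (cmod (set_lebesgue_integral lborel {0..t} (\<lambda>r. bbm_group (t - r) (F r) n)))\<^sup>2"
      unfolding duhamel_def by (intro power_mono) (simp_all add: norm_mult norm_divide)
    then have "ennreal ((cmod (duhamel F t n))\<^sup>2)
        \<le> ennreal ((cmod (set_lebesgue_integral lborel {0..t} (\<lambda>r. bbm_group (t - r) (F r) n)))\<^sup>2)"
      by (rule ennreal_leI)
    also have "\<dots> \<le> ennreal T * (\<integral>\<^sup>+r. ennreal ((cmod (bbm_group (t - r) (F r) n))\<^sup>2) * indicator {0..t} r \<partial>lborel)"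
      using t by (intro set_lebesgue_integral_square_le int) auto
    also have "\<dots> \<le> ennreal T * ?I n"
      using t by (intro mult_left_mono nn_integral_mono) (auto split: split_indicator)
    finally show ?thesis .
  qed
  have "nnsum (\<lambda>n. ennreal (jap n powr (2 * s)) * (ennreal T * ?I n))
      = ennreal T * nnsum (\<lambda>n. \<integral>\<^sup>+r. ennreal (jap n powr (2 * s)) * (ennreal ((cmod (F r n))\<^sup>2) * indicator {0..T} r) \<partial>lborel)"
    by (simp add: nn_integral_cmult mult.left_commute[of _ "ennreal T"])
  also have "\<dots> = ennreal T * (\<integral>\<^sup>+r. nnsum (\<lambda>n. ennreal (jap n powr (2 * s)) * (ennreal ((cmod (F r n))\<^sup>2) * indicator {0..T} r)) \<partial>lborel)"
    by (subst nnsum_swap) auto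
  also have "\<dots> = ennreal T * (\<integral>\<^sup>+r. energy s (F r) * indicator {0..T} r \<partial>lborel)"
    by (simp add: energy_def ennreal_mult nn_integral_multc flip: mult.assoc)
  also have "\<dots> < \<infinity>" using fin by (simp add: ennreal_mult_less_top)
  finally show "nnsum (\<lambda>n. ennreal (jap n powr (2 * s)) * (ennreal T * ?I n)) < \<infinity>" .
qed

lemma cont_sobolev_near:
  assumes v: "v \<in> cont_sobolev T s" and t: "t \<in> {0..T}" and "0 < e"
  shows "\<exists>d>0. \<forall>r\<in>{0..T}. \<bar>r - t\<bar> < d \<longrightarrow> energy s (\<lambda>n. v r n - v t n) \<le> ennreal e"
proof -
  have "((\<lambda>r. sobolev_norm s (\<lambda>n. v r n - v t n)) \<longlongrightarrow> 0) (at t within {0..T})"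
    using v t by (simp add: cont_sobolev_def)
  then have "eventually (\<lambda>r. dist (sobolev_norm s (\<lambda>n. v r n - v t n)) 0 < sqrt e) (at t within {0..T})"
    using \<open>0 < e\<close> by (intro tendstoD) auto
  then obtain d where d: "d > 0" "\<And>r. r \<in> {0..T} \<Longrightarrow> r \<noteq> t \<Longrightarrow> dist r t < d
      \<Longrightarrow> \<bar>sobolev_norm s (\<lambda>n. v r n - v t n)\<bar> < sqrt e"
    by (auto simp: eventually_at)
  show ?thesis
  proof (intro exI[of _ d] conjI ballI impI d(1))
    fix r assume r: "r \<in> {0..T}" "\<bar>r - t\<bar> < d"
    have "(\<lambda>n. v r n - v t n) \<in> sobolev s"
    proof -
      have "energy s (v r) < \<infinity>" "energy s (v t) < \<infinity>"
        using v r t by (auto simp: sobolev_iff cont_sobolev_def)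
      then show ?thesis
        using energy_diff[of s "v r" "v t"]
        by (auto simp: sobolev_iff ennreal_mult_less_top intro: le_less_trans)
    qed
    moreover have "(sobolev_norm s (\<lambda>n. v r n - v t n))\<^sup>2 \<le> e" if "r \<noteq> t"
    proof -
      have "\<bar>sobolev_norm s (\<lambda>n. v r n - v t n)\<bar>\<^sup>2 \<le> (sqrt e)\<^sup>2"
        using d(2)[of r] r that by (intro power_mono) (auto simp: dist_real_def)
      then show ?thesis using \<open>0 < e\<close> by simp
    qed
    ultimately show "energy s (\<lambda>n. v r n - v t n) \<le> ennreal e"
      by (cases "r = t") (auto simp: sobolev_norm_square[symmetric] intro: ennreal_leI)
  qed
qed

text \<open>
  A sequence of times along which the norm blows up would accumulate at a time where continuity fails.
\<close>

lemma cont_sobolev_bounded: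
  assumes v: "v \<in> cont_sobolev T s"
  shows "\<exists>B. \<forall>t\<in>{0..T}. energy s (v t) \<le> ennreal B"
proof (rule ccontr)
  assume "\<not> ?thesis"
  then have "\<exists>t\<in>{0..T}. ennreal (real m) < energy s (v t)" for m :: nat
    by (metis not_le)
  then obtain X where X: "\<And>m. X m \<in> {0..T}" "\<And>m. ennreal (real m) < energy s (v (X m))"
    by metis
  obtain t \<rho> where t: "t \<in> {0..T}" and \<rho>: "strict_mono \<rho>" and lim: "(X \<circ> \<rho>) \<longlonglongrightarrow> t"
    using compact_Icc[of 0 T] X(1) unfolding compact_def by metis
  obtain d where d: "d > 0" "\<And>r. r \<in> {0..T} \<Longrightarrow> \<bar>r - t\<bar> < d \<Longrightarrow> energy s (\<lambda>n. v r n - v t n) \<le> ennreal 1"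
    using cont_sobolev_near[OF v t, of 1] by auto
  have fin: "2 * 1 + 2 * energy s (v t) < \<infinity>"
    using v t by (auto simp: cont_sobolev_def sobolev_iff ennreal_mult_less_top)
  then obtain b where b: "2 * 1 + 2 * energy s (v t) = ennreal b" "0 \<le> b"
    by (metis ennreal_cases infinity_ennreal_def less_irrefl)
  from lim d(1) obtain m0 where m0: "\<And>m. m \<ge> m0 \<Longrightarrow> \<bar>X (\<rho> m) - t\<bar> < d"
    by (auto simp: LIMSEQ_def dist_real_def)
  obtain m1 where m1: "b < real m1" using reals_Archimedean2 by blast
  let ?m = "max m0 m1"
  have "ennreal (real (\<rho> ?m)) < energy s (v (X (\<rho> ?m)))" by (rule X)
  also have "\<dots> \<le> 2 * energy s (\<lambda>n. v (X (\<rho> ?m)) n - v t n) + 2 * energy s (v t)"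
    using energy_add[of s "\<lambda>n. v (X (\<rho> ?m)) n - v t n" "v t"] by simp
  also have "\<dots> \<le> 2 * 1 + 2 * energy s (v t)"
    using d(2)[of "X (\<rho> ?m)"] m0[of ?m] X(1) by (intro add_mono mult_left_mono) auto
  also have "\<dots> = ennreal b" by (rule b)
  finally have "real (\<rho> ?m) < b" using b(2) by (simp add: ennreal_less_iff)
  moreover have "real m1 \<le> real (\<rho> ?m)"
    using seq_suble[OF \<rho>, of ?m] by linarith
  ultimately show False using m1 by linarith
qed

lemma cont_sobolev_coeff_continuous:
  assumes v: "v \<in> cont_sobolev T s" and "0 \<le> s"
  shows "continuous_on {0..T} (\<lambda>t. v t n)"
  unfolding continuous_on_iff
proof (intro ballI allI impI)
  fix t e :: real assume t: "t \<in> {0..T}" and "0 < e"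
  then obtain d where d: "d > 0" "\<And>r. r \<in> {0..T} \<Longrightarrow> \<bar>r - t\<bar> < d \<Longrightarrow> energy s (\<lambda>n. v r n - v t n) \<le> ennreal ((e / 2)\<^sup>2)"
    using cont_sobolev_near[OF v t, of "(e / 2)\<^sup>2"] by auto
  have "dist (v r n) (v t n) < e" if r: "r \<in> {0..T}" "dist r t < d" for r
  proof -
    have "ennreal ((cmod (v r n - v t n))\<^sup>2) \<le> ennreal ((e / 2)\<^sup>2)"
      using order_trans[OF cmod_square_le_energy[OF \<open>0 \<le> s\<close>, of "\<lambda>n. v r n - v t n" n] d(2)[of r]] r
      by (simp add: dist_real_def)
    then have "(cmod (v r n - v t n))\<^sup>2 \<le> (e / 2)\<^sup>2" by (subst (asm) ennreal_le_iff) auto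
    then have "cmod (v r n - v t n) \<le> e / 2" using \<open>0 < e\<close> by (simp add: power2_le_iff_abs_le)
    then show ?thesis using \<open>0 < e\<close> by (simp add: dist_norm)
  qed
  with d(1) show "\<exists>d>0. \<forall>x'\<in>{0..T}. dist x' t < d \<longrightarrow> dist (v x' n) (v t n) < e" by blast
qed

text \<open>
  Continuity in terms of energies; this form avoids the real-valued norm and its summability conditions.
\<close>

lemma cont_sobolev_iff:
  "v \<in> cont_sobolev T s \<longleftrightarrow> (\<forall>t\<in>{0..T}. energy s (v t) < \<infinity> \<and>
     (\<forall>e>0. \<exists>d>0. \<forall>r\<in>{0..T}. \<bar>r - t\<bar> < d \<longrightarrow> energy s (\<lambda>n. v r n - v t n) \<le> ennreal e))"
  (is "_ \<longleftrightarrow> ?R")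
proof
  assume "v \<in> cont_sobolev T s"
  then show ?R using cont_sobolev_near by (auto simp: cont_sobolev_def sobolev_iff)
next
  assume R: ?R
  have "((\<lambda>r. sobolev_norm s (\<lambda>n. v r n - v t n)) \<longlongrightarrow> 0) (at t within {0..T})" if t: "t \<in> {0..T}" for t
  proof (rule tendstoI)
    fix e :: real assume "0 < e"
    then obtain d where d: "d > 0" "\<And>r. r \<in> {0..T} \<Longrightarrow> \<bar>r - t\<bar> < d \<Longrightarrow> energy s (\<lambda>n. v r n - v t n) \<le> ennreal ((e / 2)\<^sup>2)"
      using R[rule_format, OF t, THEN conjunct2, rule_format, of "(e / 2)\<^sup>2"] by auto
    have "dist (sobolev_norm s (\<lambda>n. v r n - v t n)) 0 < e" if r: "r \<in> {0..T}" "dist r t < d" for r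
    proof -
      have le: "energy s (\<lambda>n. v r n - v t n) \<le> ennreal ((e / 2)\<^sup>2)"
        using d(2) r by (simp add: dist_real_def)
      then have "(\<lambda>n. v r n - v t n) \<in> sobolev s"
        by (auto simp: sobolev_iff intro: le_less_trans)
      with le have "(sobolev_norm s (\<lambda>n. v r n - v t n))\<^sup>2 \<le> (e / 2)\<^sup>2"
        by (simp add: sobolev_norm_square[symmetric] ennreal_le_iff)
      then have "\<bar>sobolev_norm s (\<lambda>n. v r n - v t n)\<bar> \<le> e / 2"
        using \<open>0 < e\<close> by (simp add: power2_le_iff_abs_le)
      then show ?thesis using \<open>0 < e\<close> by simp
    qed
    then show "\<forall>\<^sub>F r in at t within {0..T}. dist (sobolev_norm s (\<lambda>n. v r n - v t n)) 0 < e"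
      using d(1) by (auto simp: eventually_at)
  qed
  with R show "v \<in> cont_sobolev T s" by (simp add: cont_sobolev_def sobolev_iff)
qed

lemma cont_sobolev_mono:
  assumes v: "v \<in> cont_sobolev T s" and "s' \<le> s"
  shows "v \<in> cont_sobolev T s'"
  unfolding cont_sobolev_iff
proof (intro ballI conjI allI impI)
  note le = energy_mono_index[OF \<open>s' \<le> s\<close>]
  fix t assume t: "t \<in> {0..T}"
  show "energy s' (v t) < \<infinity>"
    using v t by (intro le_less_trans[OF le]) (simp add: cont_sobolev_iff)
  fix e :: real assume "0 < e"
  from cont_sobolev_near[OF v t this] show "\<exists>d>0. \<forall>r\<in>{0..T}. \<bar>r - t\<bar> < d \<longrightarrow>
      energy s' (\<lambda>n. v r n - v t n) \<le> ennreal e"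
    using order_trans[OF le] by blast
qed

lemma cont_sobolev_add:
  assumes v: "v \<in> cont_sobolev T s" and v': "v' \<in> cont_sobolev T s"
  shows "(\<lambda>t n. v t n + v' t n) \<in> cont_sobolev T s"
  unfolding cont_sobolev_iff
proof (intro ballI conjI allI impI)
  fix t assume t: "t \<in> {0..T}"
  then have "2 * energy s (v t) + 2 * energy s (v' t) < \<infinity>"
    using v v' by (auto simp: cont_sobolev_iff ennreal_mult_less_top)
  then show "energy s (\<lambda>n. v t n + v' t n) < \<infinity>"
    by (rule le_less_trans[OF energy_add])
  fix e :: real assume "0 < e"
  then have "0 < e / 4" by simp
  then obtain d d' where d: "d > 0" "\<forall>r\<in>{0..T}. \<bar>r - t\<bar> < d \<longrightarrow> energy s (\<lambda>n. v r n - v t n) \<le> ennreal (e / 4)"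
    and d': "d' > 0" "\<forall>r\<in>{0..T}. \<bar>r - t\<bar> < d' \<longrightarrow> energy s (\<lambda>n. v' r n - v' t n) \<le> ennreal (e / 4)"
    using cont_sobolev_near[OF v t] cont_sobolev_near[OF v' t] by blast
  show "\<exists>d>0. \<forall>r\<in>{0..T}. \<bar>r - t\<bar> < d \<longrightarrow>
      energy s (\<lambda>n. v r n + v' r n - (v t n + v' t n)) \<le> ennreal e"
  proof (intro exI[of _ "min d d'"] conjI ballI impI)
    fix r assume r: "r \<in> {0..T}" "\<bar>r - t\<bar> < min d d'"
    have "energy s (\<lambda>n. v r n + v' r n - (v t n + v' t n))
       \<le> 2 * energy s (\<lambda>n. v r n - v t n) + 2 * energy s (\<lambda>n. v' r n - v' t n)"
      using energy_add[of s "\<lambda>n. v r n - v t n" "\<lambda>n. v' r n - v' t n"]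
      by (simp add: algebra_simps)
    also have "\<dots> \<le> 2 * ennreal (e / 4) + 2 * ennreal (e / 4)"
      using d d' r by (intro add_mono mult_left_mono) auto
    also have "2 * ennreal (e / 4) = ennreal (e / 2)"
      using ennreal_mult[of 2 "e / 4"] \<open>0 < e\<close> by simp
    also have "ennreal (e / 2) + ennreal (e / 2) = ennreal e"
      using \<open>0 < e\<close> by (simp flip: ennreal_plus)
    finally show "energy s (\<lambda>n. v r n + v' r n - (v t n + v' t n)) \<le> ennreal e" .
  qed (use d d' in auto)
qed

section \<open>Estimates for the nonlinearity\<close>

lemma fourier_prod_zero_left [simp]: "fourier_prod (\<lambda>k. 0) h n = 0"
  and fourier_prod_zero_right [simp]: "fourier_prod f (\<lambda>k. 0) n = 0"
  by (simp_all add: fourier_prod_eq_integral)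

lemma fourier_prod_measurable:
  assumes [measurable]: "\<And>n. (\<lambda>t. f t n) \<in> borel_measurable M" "\<And>n. (\<lambda>t. h t n) \<in> borel_measurable M"
  shows "(\<lambda>t. fourier_prod (f t) (h t) n) \<in> borel_measurable M"
proof -
  interpret sigma_finite_measure "count_space (UNIV :: int set)"
    by (rule sigma_finite_measure_count_space)
  have "(\<lambda>p. (\<lambda>k t. f t k * h t (n - k)) (snd p) (fst p)) \<in> borel_measurable (M \<Otimes>\<^sub>M count_space UNIV)"
    by (rule measurable_compose_countable'[where I=UNIV]) auto
  then have "(\<lambda>(t, k). f t k * h t (n - k)) \<in> borel_measurable (M \<Otimes>\<^sub>M count_space UNIV)"
    by (simp add: case_prod_beta')
  then show ?thesis
    unfolding fourier_prod_eq_integral by (rule borel_measurable_lebesgue_integral)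
qed

text \<open>
  The part of the nonlinearity that does not involve the remainder \<open>v\<close>.
\<close>

definition bbm_forcing :: "(int \<Rightarrow> complex) \<Rightarrow> int \<Rightarrow> complex" where
  "bbm_forcing w n = (if n = 0 then 0 else complex_of_real (bbm_symbol n) * w n)"

lemma bbm_nonlin_zero: "bbm_nonlin z w (\<lambda>n. 0) n = bbm_forcing w n"
  by (simp add: bbm_nonlin_def bbm_forcing_def fourier_mult_def)

lemma ennreal_double_mult: "0 \<le> p \<Longrightarrow> 0 \<le> a \<Longrightarrow> 2 * (ennreal p * ennreal a) = ennreal (2 * (p * a))"
  by (simp add: ennreal_mult)

lemma ennreal_collect_multiples:
  assumes "0 \<le> x" "0 \<le> y" "0 \<le> z"
  shows "2 * (ennreal x * E) + 2 * (2 * (ennreal y * E) + 2 * (4 * (ennreal z * E)))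
    = ennreal (2 * x + 4 * y + 16 * z) * E"
proof -
  have "ennreal (2 * x + 4 * y + 16 * z) = 2 * ennreal x + 4 * ennreal y + 16 * ennreal z"
    using assms by (simp add: ennreal_mult)
  moreover have "2 * (2 * Y) = (4 * Y :: ennreal)" "2 * (2 * (4 * Y)) = (16 * Y :: ennreal)" for Y
    by (simp_all flip: mult.assoc)
  ultimately show ?thesis
    by (simp only: distrib_left distrib_right mult.assoc add.assoc)
qed

text \<open>
  Data of negative regularity with a prescribed square \<open>w\<close> of its evolution. The bounds \<open>A\<close> and \<open>B\<close> for the
  squared norms of data and forcing are real numbers so that a time of existence can be computed from
  them.
\<close>

locale forced_bbm =
  fixes \<sigma> s A B :: real and u0 :: "int \<Rightarrow> complex" and w :: "real \<Rightarrow> int \<Rightarrow> complex"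
  assumes \<sigma>_nonneg: "0 \<le> \<sigma>" and \<sigma>_half: "\<sigma> < 1 / 2" and \<sigma>_le: "\<sigma> \<le> s" and s_le: "s + \<sigma> \<le> 1"
    and A_nonneg: "0 \<le> A" and B_nonneg: "0 \<le> B"
    and data: "energy (- \<sigma>) u0 \<le> ennreal A"
    and w_meas: "\<And>n. n \<noteq> 0 \<Longrightarrow> (\<lambda>t. w t n) \<in> borel_measurable borel"
    and forcing: "(\<integral>\<^sup>+t. energy s (bbm_forcing (w t)) * indicator {0..1} t \<partial>lborel) \<le> ennreal B"
begin

definition z :: "real \<Rightarrow> int \<Rightarrow> complex" where "z t = bbm_group t u0"

definition N :: "(real \<Rightarrow> int \<Rightarrow> complex) \<Rightarrow> real \<Rightarrow> int \<Rightarrow> complex" where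
  "N v t = bbm_nonlin (z t) (w t) (v t)"

definition C :: real where "C = enn2real (product_const \<sigma>)"

lemma product_const_C: "product_const \<sigma> = ennreal C" and C_nonneg: "0 \<le> C"
  using product_const_finite[OF \<sigma>_half] by (auto simp: C_def)

lemma s_nonneg: "0 \<le> s" using \<sigma>_nonneg \<sigma>_le by linarith

lemma z_energy: "energy (- \<sigma>) (z t) \<le> ennreal A"
  using data by (simp add: z_def)

lemma z_meas [measurable]: "(\<lambda>t. z t n) \<in> borel_measurable borel"
  unfolding z_def bbm_group_def by measurable

lemma energy_neg_le: "energy (- \<sigma>) f \<le> energy s f"
  using \<sigma>_nonneg s_nonneg by (intro energy_mono_index) simp

lemma N_meas:
  assumes [measurable]: "\<And>n. (\<lambda>t. v t n) \<in> borel_measurable borel"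
  shows "(\<lambda>t. N v t n) \<in> borel_measurable borel"
proof -
  have [measurable]: "(\<lambda>t. fourier_prod (v t) (v t) n) \<in> borel_measurable borel"
    "(\<lambda>t. fourier_prod (z t) (v t) n) \<in> borel_measurable borel" for n
    by (auto intro!: fourier_prod_measurable)
  show ?thesis
    unfolding N_def bbm_nonlin_def fourier_mult_def
    using w_meas[of n] by (cases "n = 0") auto
qed

text \<open>
  With \<open>d = v - v'\<close> the difference equals \<open>\<phi>(D)(vd + dv' + 2zd)\<close>, because the forcing cancels. Each product
  has a factor in \<open>H\<^sup>-\<^sup>\<sigma>\<close> and a factor in \<open>H\<^sup>s\<close>, where \<open>H\<^sup>s \<subseteq> H\<^sup>-\<^sup>\<sigma>\<close> is used for \<open>v\<close> and \<open>d\<close>.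
\<close>

lemma nonlin_energy_diff:
  assumes v: "energy s v \<le> ennreal a" and v': "energy s v' \<le> ennreal a'"
    and a: "0 \<le> a" "0 \<le> a'"
  shows "energy s (\<lambda>n. bbm_nonlin (z t) W v n - bbm_nonlin (z t) W v' n)
    \<le> ennreal (16 * C * (a + a' + A)) * energy s (\<lambda>n. v n - v' n)"
proof -
  let ?d = "\<lambda>n. v n - v' n"
  let ?P = "\<lambda>f h. fourier_mult bbm_symbol (fourier_prod f h)"
  have fv: "energy s v < \<infinity>" and fv': "energy s v' < \<infinity>"
    and fz: "energy (- \<sigma>) (z t) < \<infinity>"
    using le_less_trans[OF v] le_less_trans[OF v'] le_less_trans[OF z_energy] by simp_all
  have fnv: "energy (- \<sigma>) v < \<infinity>" and fnv': "energy (- \<sigma>) v' < \<infinity>"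
    using le_less_trans[OF energy_neg_le fv] le_less_trans[OF energy_neg_le fv'] by simp_all
  note fin = fourier_abs_finite[OF \<sigma>_nonneg \<sigma>_half \<sigma>_le s_le]
  have id: "bbm_nonlin (z t) W v n - bbm_nonlin (z t) W v' n
     = ?P v ?d n + (?P ?d v' n + 2 * ?P (z t) ?d n)" for n
  proof -
    have "fourier_prod v ?d n = fourier_prod v v n - fourier_prod v v' n"
      by (intro fourier_prod_diff_right fin fnv fv fv')
    moreover have "fourier_prod ?d v' n = fourier_prod v v' n - fourier_prod v' v' n"
      by (intro fourier_prod_diff_left fin fnv fnv' fv fv')
    moreover have "fourier_prod (z t) ?d n = fourier_prod (z t) v n - fourier_prod (z t) v' n"
      by (intro fourier_prod_diff_right fin fz fv fv')
    ultimately show ?thesis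
      by (simp only: bbm_nonlin_def fourier_mult_def) (simp add: algebra_simps)
  qed
  let ?E = "energy s ?d"
  note est = fourier_mult_product_energy[OF \<sigma>_nonneg \<sigma>_le s_le]
  have e1: "energy s (?P v ?d) \<le> ennreal (C * a) * ?E"
  proof -
    have "energy s (?P v ?d) \<le> ennreal C * (energy (- \<sigma>) v * ?E)"
      using est[of v ?d] by (simp add: product_const_C)
    also have "\<dots> \<le> ennreal C * (ennreal a * ?E)"
      using order_trans[OF energy_neg_le v] by (intro mult_left_mono mult_right_mono) auto
    finally show ?thesis using a C_nonneg by (simp add: ennreal_mult mult.assoc)
  qed
  have e2: "energy s (?P ?d v') \<le> ennreal (C * a') * ?E"
  proof -
    have "energy s (?P ?d v') \<le> ennreal C * (energy (- \<sigma>) ?d * energy s v')"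
      using est[of ?d v'] by (simp add: product_const_C)
    also have "\<dots> \<le> ennreal C * (?E * ennreal a')"
      using energy_neg_le v' by (intro mult_left_mono mult_mono) auto
    finally show ?thesis using a C_nonneg by (simp add: ennreal_mult ac_simps)
  qed
  have e3: "energy s (?P (z t) ?d) \<le> ennreal (C * A) * ?E"
  proof -
    have "energy s (?P (z t) ?d) \<le> ennreal C * (energy (- \<sigma>) (z t) * ?E)"
      using est[of "z t" ?d] by (simp add: product_const_C)
    also have "\<dots> \<le> ennreal C * (ennreal A * ?E)"
      using z_energy by (intro mult_left_mono mult_right_mono) auto
    finally show ?thesis using A_nonneg C_nonneg by (simp add: ennreal_mult mult.assoc)
  qed
  have "energy s (\<lambda>n. bbm_nonlin (z t) W v n - bbm_nonlin (z t) W v' n)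
     \<le> 2 * energy s (?P v ?d) + 2 * energy s (\<lambda>n. ?P ?d v' n + 2 * ?P (z t) ?d n)"
    unfolding id by (rule energy_add)
  also have "\<dots> \<le> 2 * energy s (?P v ?d)
      + 2 * (2 * energy s (?P ?d v') + 2 * (4 * energy s (?P (z t) ?d)))"
    using energy_add[of s "?P ?d v'" "\<lambda>n. 2 * ?P (z t) ?d n"]
    by (intro add_mono mult_left_mono order_refl) (auto simp: energy_scale)
  also have "\<dots> \<le> 2 * (ennreal (C * a) * ?E) + 2 * (2 * (ennreal (C * a') * ?E) + 2 * (4 * (ennreal (C * A) * ?E)))"
    by (intro add_mono mult_left_mono e1 e2 e3) auto
  also have "\<dots> = ennreal (2 * C * a + 4 * C * a' + 16 * C * A) * ?E"
    using ennreal_collect_multiples[of "C * a" "C * a'" "C * A" ?E] a A_nonneg C_nonneg by (simp add: mult.assoc)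
  also have "\<dots> \<le> ennreal (16 * C * (a + a' + A)) * ?E"
  proof (intro mult_right_mono ennreal_leI)
    have "0 \<le> C * a" "0 \<le> C * a'" using a C_nonneg by simp_all
    then show "2 * C * a + 4 * C * a' + 16 * C * A \<le> 16 * C * (a + a' + A)"
      by (simp add: algebra_simps)
  qed simp
  finally show ?thesis .
qed

lemma nonlin_energy:
  assumes v: "energy s v \<le> ennreal a" and a: "0 \<le> a"
  shows "energy s (bbm_nonlin (z t) W v)
    \<le> ennreal (32 * C * (a + A) * a) + 2 * energy s (bbm_forcing W)"
proof -
  let ?N = "bbm_nonlin (z t) W"
  have "energy s (?N v) \<le> 2 * energy s (\<lambda>n. ?N v n - ?N (\<lambda>n. 0) n) + 2 * energy s (?N (\<lambda>n. 0))"
    using energy_add[of s "\<lambda>n. ?N v n - ?N (\<lambda>n. 0) n" "?N (\<lambda>n. 0)"] by simp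
  also have "\<dots> \<le> 2 * (ennreal (16 * C * (a + 0 + A)) * energy s (\<lambda>n. v n - 0)) + 2 * energy s (?N (\<lambda>n. 0))"
    using nonlin_energy_diff[OF v, of "\<lambda>n. 0" 0 t W] a by (intro add_mono mult_left_mono order_refl) auto
  also have "\<dots> \<le> 2 * (ennreal (16 * C * (a + 0 + A)) * ennreal a) + 2 * energy s (?N (\<lambda>n. 0))"
    using v by (intro add_mono mult_left_mono order_refl) auto
  also have "2 * (ennreal (16 * C * (a + 0 + A)) * ennreal a) = ennreal (2 * (16 * C * (a + 0 + A) * a))"
    using a A_nonneg C_nonneg by (intro ennreal_double_mult) auto
  finally show ?thesis by (simp add: bbm_nonlin_zero[abs_def] mult.assoc)
qed

lemma N_energy_integral:
  assumes T: "0 \<le> T" "T \<le> 1" and v: "\<And>t. t \<in> {0..T} \<Longrightarrow> energy s (v t) \<le> ennreal a" and a: "0 \<le> a"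
  shows "(\<integral>\<^sup>+t. energy s (N v t) * indicator {0..T} t \<partial>lborel) \<le> ennreal (32 * C * (a + A) * a + 2 * B)"
proof -
  let ?c = "32 * C * (a + A) * a"
  have c: "0 \<le> ?c" using a A_nonneg C_nonneg by simp
  have "(\<integral>\<^sup>+t. energy s (N v t) * indicator {0..T} t \<partial>lborel)
     \<le> (\<integral>\<^sup>+t. ennreal ?c * indicator {0..1} t + 2 * (energy s (bbm_forcing (w t)) * indicator {0..1} t) \<partial>lborel)"
  proof (rule nn_integral_mono)
    fix t
    show "energy s (N v t) * indicator {0..T} t
       \<le> ennreal ?c * indicator {0..1} t + 2 * (energy s (bbm_forcing (w t)) * indicator {0..1} t)"
    proof (cases "t \<in> {0..T}")
      case True
      then show ?thesis
        using nonlin_energy[OF v[OF True] a, of t "w t"] T by (simp add: N_def)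
    qed simp
  qed
  also have "\<dots> = ennreal ?c + 2 * (\<integral>\<^sup>+t. energy s (bbm_forcing (w t)) * indicator {0..1} t \<partial>lborel)"
  proof -
    have m: "(\<lambda>t. energy s (bbm_forcing (w t))) \<in> borel_measurable borel"
    proof -
      have [measurable]: "(\<lambda>t. bbm_forcing (w t) n) \<in> borel_measurable borel" for n
        unfolding bbm_forcing_def using w_meas[of n] by (cases "n = 0") auto
      show ?thesis
        unfolding energy_def by (rule borel_measurable_nnsum) measurable
    qed
    then show ?thesis
      by (subst nn_integral_add) (auto simp: nn_integral_cmult)
  qed
  also have "\<dots> \<le> ennreal ?c + 2 * ennreal B"
    by (intro add_mono mult_left_mono forcing order_refl) auto
  also have "\<dots> = ennreal (?c + 2 * B)"
    using c B_nonneg by (simp add: ennreal_mult)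
  finally show ?thesis .
qed

end

section \<open>Picard iteration and uniqueness\<close>

lemma ennreal_double_add: "0 \<le> a \<Longrightarrow> 0 \<le> b \<Longrightarrow> 2 * ennreal a + 2 * ennreal b = ennreal (2 * a + 2 * b)"
  by (simp add: ennreal_mult)

lemma duhamel_zero [simp]: "duhamel F 0 n = 0"
proof -
  have "AE r in lborel. indicator {0..0::real} r *\<^sub>R bbm_group (0 - r) (F r) n = 0"
    using AE_lborel_singleton[of 0] by eventually_elim (auto split: split_indicator)
  then show ?thesis
    unfolding duhamel_def set_lebesgue_integral_def by (simp add: integral_eq_zero_AE)
qed

lemma cont_sobolev_cong:
  "(\<And>t. t \<in> {0..T} \<Longrightarrow> v t = v' t) \<Longrightarrow> v \<in> cont_sobolev T s \<longleftrightarrow> v' \<in> cont_sobolev T s"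
  by (simp add: cont_sobolev_iff)

lemma ennreal_le_null_seq_imp_zero:
  fixes e :: ennreal
  assumes "\<And>m. e \<le> ennreal (x m)" "x \<longlonglongrightarrow> 0"
  shows "e = 0"
proof -
  have "(\<lambda>m. ennreal (x m)) \<longlonglongrightarrow> ennreal 0" using assms(2) by (rule tendsto_ennrealI)
  then have "e \<le> ennreal 0" using assms(1) by (intro LIMSEQ_le_const) auto
  then show ?thesis by simp
qed

lemma nn_integral_exp_le:
  fixes l :: real
  assumes "0 < l" "0 \<le> t" "0 \<le> c"
  shows "(\<integral>\<^sup>+r. ennreal (c * exp (l * r)) * indicator {0..t} r \<partial>lborel) \<le> ennreal (c * exp (l * t) / l)"
proof -
  have "(\<integral>\<^sup>+r. ennreal (c * exp (l * r)) * indicator {0..t} r \<partial>lborel) = c * exp (l * t) / l - c * exp (l * 0) / l"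
    using assms by (intro nn_integral_FTC_Icc[where F="\<lambda>r. c * exp (l * r) / l"]) (auto intro!: derivative_eq_intros)
  also have "\<dots> \<le> ennreal (c * exp (l * t) / l)"
    using assms by (intro ennreal_leI) simp
  finally show ?thesis .
qed

text \<open>
  A bound \<open>c exp(lt)\<close> reproduces itself with half the constant as soon as the exponential rate \<open>l\<close> is at
  least twice \<open>k\<close>; iterating it leaves only zero.
\<close>

lemma gronwall_zero:
  fixes e :: "real \<Rightarrow> ennreal"
  assumes "0 \<le> k" "0 \<le> b"
    and bound: "\<And>t. t \<in> {0..T} \<Longrightarrow> e t \<le> ennreal b"
    and le: "\<And>t. t \<in> {0..T} \<Longrightarrow> e t \<le> ennreal k * (\<integral>\<^sup>+r. e r * indicator {0..t} r \<partial>lborel)"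
    and t: "t \<in> {0..T}"
  shows "e t = 0"
proof -
  \<comment> \<open>The summand 1 keeps the rate positive if \<open>k = 0\<close>.\<close>
  define l where "l = 2 * (k + 1)"
  have l: "0 < l" "k \<le> l / 2" using \<open>0 \<le> k\<close> by (auto simp: l_def)
  have "\<forall>t\<in>{0..T}. e t \<le> ennreal (b / 2 ^ m * exp (l * t))" for m
  proof (induction m)
    case 0
    show ?case
    proof
      fix t assume t: "t \<in> {0..T}"
      have "b * 1 \<le> b * exp (l * t)"
        using t l \<open>0 \<le> b\<close> by (intro mult_left_mono) auto
      then have "ennreal b \<le> ennreal (b / 2 ^ 0 * exp (l * t))"
        by (intro ennreal_leI) simp
      with bound[OF t] show "e t \<le> ennreal (b / 2 ^ 0 * exp (l * t))" by (rule order_trans)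
    qed
  next
    case (Suc m)
    show ?case
    proof
      fix t assume t: "t \<in> {0..T}"
      have "e t \<le> ennreal k * (\<integral>\<^sup>+r. e r * indicator {0..t} r \<partial>lborel)" by (rule le[OF t])
      also have "\<dots> \<le> ennreal k * (\<integral>\<^sup>+r. ennreal (b / 2 ^ m * exp (l * r)) * indicator {0..t} r \<partial>lborel)"
        using Suc t by (intro mult_left_mono nn_integral_mono) (auto split: split_indicator)
      also have "\<dots> \<le> ennreal (l / 2) * ennreal (b / 2 ^ m * exp (l * t) / l)"
        using l t \<open>0 \<le> b\<close> by (intro mult_mono nn_integral_exp_le ennreal_leI) auto
      also have "\<dots> = ennreal (l / 2 * (b / 2 ^ m * exp (l * t) / l))"
        using l \<open>0 \<le> b\<close> by (intro ennreal_mult[symmetric]) auto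
      also have "l / 2 * (b / 2 ^ m * exp (l * t) / l) = b / 2 ^ Suc m * exp (l * t)"
        using l by simp
      finally show "e t \<le> ennreal (b / 2 ^ Suc m * exp (l * t))" .
    qed
  qed
  then have "e t \<le> ennreal (b / 2 ^ m * exp (l * t))" for m using t by blast
  moreover have "(\<lambda>m. b / 2 ^ m * exp (l * t)) \<longlonglongrightarrow> 0"
  proof -
    have "(\<lambda>m. b * (1 / 2) ^ m * exp (l * t)) \<longlonglongrightarrow> b * 0 * exp (l * t)"
      by (intro tendsto_intros LIMSEQ_realpow_zero) auto
    then show ?thesis by (simp add: power_divide)
  qed
  ultimately show ?thesis by (rule ennreal_le_null_seq_imp_zero)
qed

text \<open>
  Fatou's lemma over the frequencies.
\<close>

lemma energy_limit:
  assumes lim: "\<And>n. (\<lambda>m. f m n) \<longlonglongrightarrow> g n" and le: "eventually (\<lambda>m. energy s (f m) \<le> c) sequentially"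
  shows "energy s g \<le> c"
proof -
  have "(\<lambda>m. ennreal (jap n powr (2 * s) * (cmod (f m n))\<^sup>2)) \<longlonglongrightarrow> ennreal (jap n powr (2 * s) * (cmod (g n))\<^sup>2)" for n
    by (intro tendsto_ennrealI tendsto_intros lim)
  then have "liminf (\<lambda>m. ennreal (jap n powr (2 * s) * (cmod (f m n))\<^sup>2)) = ennreal (jap n powr (2 * s) * (cmod (g n))\<^sup>2)" for n
    by (intro lim_imp_Liminf) auto
  then have "energy s g = nnsum (\<lambda>n. liminf (\<lambda>m. ennreal (jap n powr (2 * s) * (cmod (f m n))\<^sup>2)))"
    by (simp add: energy_def)
  also have "\<dots> \<le> liminf (\<lambda>m. energy s (f m))"
    unfolding energy_def by (rule nn_integral_liminf) simp
  also have "\<dots> \<le> liminf (\<lambda>m. c)"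
    by (rule Liminf_mono) (rule le)
  finally show ?thesis by (simp add: Liminf_const)
qed

context forced_bbm
begin

lemma N_integrable:
  assumes T: "0 \<le> T" "T \<le> 1" "t \<le> T"
    and v: "\<And>n. (\<lambda>t. v t n) \<in> borel_measurable borel"
    and bound: "\<And>t. t \<in> {0..T} \<Longrightarrow> energy s (v t) \<le> ennreal a" and a: "0 \<le> a"
  shows "set_integrable lborel {0..t} (\<lambda>r. bbm_group (t - r) (N v r) n)"
proof -
  have "(\<integral>\<^sup>+r. energy s (N v r) * indicator {0..T} r \<partial>lborel) < \<infinity>"
    using N_energy_integral[OF T(1,2) bound a] by (rule le_less_trans) simp_all
  then show ?thesis
    unfolding bbm_group_split
    by (intro set_integrable_mult_right impI duhamel_integrable[OF s_nonneg T(3) N_meas[OF v]])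
qed

lemma duhamel_N_diff:
  assumes t: "0 \<le> t" "t \<le> T"
    and int: "\<And>n. set_integrable lborel {0..t} (\<lambda>r. bbm_group (t - r) (N v r) n)"
    and int': "\<And>n. set_integrable lborel {0..t} (\<lambda>r. bbm_group (t - r) (N v' r) n)"
    and bound: "\<And>t. t \<in> {0..T} \<Longrightarrow> energy s (v t) \<le> ennreal a" and a: "0 \<le> a"
    and bound': "\<And>t. t \<in> {0..T} \<Longrightarrow> energy s (v' t) \<le> ennreal a'" and a': "0 \<le> a'"
  shows "energy s (\<lambda>n. duhamel (N v) t n - duhamel (N v') t n)
    \<le> ennreal T * (\<integral>\<^sup>+r. ennreal (16 * C * (a + a' + A)) * energy s (\<lambda>n. v r n - v' r n) * indicator {0..t} r \<partial>lborel)"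
proof -
  have "energy s (\<lambda>n. duhamel (N v) t n - duhamel (N v') t n)
     \<le> ennreal T * (\<integral>\<^sup>+r. energy s (\<lambda>n. N v r n - N v' r n) * indicator {0..t} r \<partial>lborel)"
    by (rule duhamel_energy_diff[OF t int int'])
  also have "\<dots> \<le> ennreal T * (\<integral>\<^sup>+r. ennreal (16 * C * (a + a' + A)) * energy s (\<lambda>n. v r n - v' r n) * indicator {0..t} r \<partial>lborel)"
    using t a a' unfolding N_def
    by (intro mult_left_mono nn_integral_mono) (auto split: split_indicator intro!: nonlin_energy_diff bound bound')
  finally show ?thesis .
qed

text \<open>
  Both curves are bounded on the compact time interval, so the nonlinearity is Lipschitz along them and
  Gronwall's inequality applies to the energy of their difference.
\<close>

lemma duhamel_unique:
  assumes v: "v \<in> cont_sobolev T s" and v': "v' \<in> cont_sobolev T s" and "0 \<le> T"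
    and int: "\<And>t n. t \<in> {0..T} \<Longrightarrow> set_integrable lborel {0..t} (\<lambda>r. bbm_group (t - r) (N v r) n)"
    and int': "\<And>t n. t \<in> {0..T} \<Longrightarrow> set_integrable lborel {0..t} (\<lambda>r. bbm_group (t - r) (N v' r) n)"
    and eq: "\<And>t n. t \<in> {0..T} \<Longrightarrow> v t n = duhamel (N v) t n"
    and eq': "\<And>t n. t \<in> {0..T} \<Longrightarrow> v' t n = duhamel (N v') t n"
    and t: "t \<in> {0..T}"
  shows "v t = v' t"
proof -
  obtain b0 b0' where "\<forall>t\<in>{0..T}. energy s (v t) \<le> ennreal b0" "\<forall>t\<in>{0..T}. energy s (v' t) \<le> ennreal b0'"
    using cont_sobolev_bounded[OF v] cont_sobolev_bounded[OF v'] by blast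
  moreover define b where "b = max 0 (max b0 b0')"
  moreover have "ennreal b0 \<le> ennreal b" "ennreal b0' \<le> ennreal b" "0 \<le> b"
    unfolding b_def by (auto intro: ennreal_leI)
  ultimately have b: "\<And>t. t \<in> {0..T} \<Longrightarrow> energy s (v t) \<le> ennreal b"
      "\<And>t. t \<in> {0..T} \<Longrightarrow> energy s (v' t) \<le> ennreal b" "0 \<le> b"
    by (meson order_trans)+
  define c where "c = 16 * C * (b + b + A)"
  have c: "0 \<le> c" using b(3) C_nonneg A_nonneg by (simp add: c_def)
  let ?e = "\<lambda>t. energy s (\<lambda>n. v t n - v' t n)"
  have "?e t = 0"
  proof (rule gronwall_zero[of "T * c" "4 * b" T ?e])
    show "0 \<le> T * c" "0 \<le> 4 * b" using \<open>0 \<le> T\<close> c b(3) by simp_all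
    show "?e t \<le> ennreal (4 * b)" if "t \<in> {0..T}" for t
    proof -
      have "?e t \<le> 2 * energy s (v t) + 2 * energy s (v' t)"
        by (rule energy_diff)
      also have "\<dots> \<le> 2 * ennreal b + 2 * ennreal b"
        using b that by (intro add_mono mult_left_mono) auto
      also have "\<dots> = ennreal (4 * b)"
        using b(3) by (simp add: ennreal_mult flip: distrib_right)
      finally show ?thesis .
    qed
    show "?e t \<le> ennreal (T * c) * (\<integral>\<^sup>+r. ?e r * indicator {0..t} r \<partial>lborel)" if t: "t \<in> {0..T}" for t
    proof -
      have "?e t \<le> ennreal T * (\<integral>\<^sup>+r. ennreal c * ?e r * indicator {0..t} r \<partial>lborel)"
        using duhamel_N_diff[of t T v v' b b] int int' b t by (simp add: eq eq' c_def)
      also have "(\<integral>\<^sup>+r. ennreal c * ?e r * indicator {0..t} r \<partial>lborel) = ennreal c * (\<integral>\<^sup>+r. ?e r * indicator {0..t} r \<partial>lborel)"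
      proof -
        have [measurable]: "(\<lambda>r. indicator {0..t} r *\<^sub>R v r n) \<in> borel_measurable borel"
          "(\<lambda>r. indicator {0..t} r *\<^sub>R v' r n) \<in> borel_measurable borel" for n
          using t by (auto intro!: borel_measurable_continuous_on_indicator
              intro: continuous_on_subset cont_sobolev_coeff_continuous[OF v s_nonneg] cont_sobolev_coeff_continuous[OF v' s_nonneg])
        have eqi: "?e r * indicator {0..t} r = nnsum (\<lambda>n. ennreal (jap n powr (2 * s)
           * (cmod (indicator {0..t} r *\<^sub>R v r n - indicator {0..t} r *\<^sub>R v' r n))\<^sup>2))" for r
          by (auto simp: energy_def split: split_indicator)
        have "(\<lambda>r. ?e r * indicator {0..t} r) \<in> borel_measurable borel"
          unfolding eqi by (rule borel_measurable_nnsum) measurable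
        then show ?thesis by (simp add: nn_integral_cmult mult.assoc)
      qed
      finally show ?thesis using c \<open>0 \<le> T\<close> by (simp add: ennreal_mult mult.assoc)
    qed
  qed (rule t)
  then show ?thesis by (auto simp: energy_eq_0_iff)
qed

text \<open>
  Bounds the time integral of the energy of the nonlinearity along curves in the unit ball, and the
  square of its Lipschitz constant there.
\<close>

definition K :: real where "K = 32 * C * (1 + A) + 2 * B"

definition T :: real where "T = min 1 (1 / (4 * (K + 1)))"

lemma K_nonneg: "0 \<le> K" using C_nonneg A_nonneg B_nonneg by (simp add: K_def)

lemma T_pos: "0 < T" and T_le_1: "T \<le> 1" and T_K: "T * K \<le> 1 / 4"
proof -
  show "0 < T" "T \<le> 1" using K_nonneg by (auto simp: T_def)
  have "T * K \<le> 1 / (4 * (K + 1)) * K"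
    using K_nonneg by (intro mult_right_mono) (auto simp: T_def)
  also have "\<dots> \<le> 1 / 4" using K_nonneg by (simp add: field_simps)
  finally show "T * K \<le> 1 / 4" .
qed

text \<open>
  The Duhamel map, set to zero outside \<open>[0,T]\<close> so that measurability of the coefficients and the energy
  bound can be required on the whole line.
\<close>

definition step :: "(real \<Rightarrow> int \<Rightarrow> complex) \<Rightarrow> real \<Rightarrow> int \<Rightarrow> complex" where
  "step v t n = (if t \<in> {0..T} then duhamel (N v) t n else 0)"

text \<open>
  The class on which the Duhamel map contracts: measurability of the coefficients gives meaning to the
  time integrals, and the map itself returns a curve that is continuous on \<open>[0,T]\<close>.
\<close>

definition admissible :: "(real \<Rightarrow> int \<Rightarrow> complex) \<Rightarrow> bool" where
  "admissible v \<longleftrightarrow> (\<forall>n. (\<lambda>t. v t n) \<in> borel_measurable borel) \<and> (\<forall>t. energy s (v t) \<le> 1)"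

lemma admissible_integrable:
  "admissible v \<Longrightarrow> t \<le> T \<Longrightarrow> set_integrable lborel {0..t} (\<lambda>r. bbm_group (t - r) (N v r) n)"
  using T_pos T_le_1 by (intro N_integrable[where a=1]) (auto simp: admissible_def)

lemma admissible_N_energy:
  assumes "admissible v"
  shows "(\<integral>\<^sup>+t. energy s (N v t) * indicator {0..T} t \<partial>lborel) \<le> ennreal K"
  using N_energy_integral[of T v 1] T_pos T_le_1 assms by (simp add: admissible_def K_def)

lemma step_cont_sobolev:
  assumes "admissible v"
  shows "duhamel (N v) \<in> cont_sobolev T s"
  using assms le_less_trans[OF admissible_N_energy[OF assms], of \<infinity>]
  by (intro duhamel_cont_sobolev s_nonneg N_meas) (auto simp: admissible_def)

lemma step_admissible:
  assumes v: "admissible v"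
  shows "admissible (step v)"
  unfolding admissible_def
proof (intro conjI allI)
  fix n
  show "(\<lambda>t. step v t n) \<in> borel_measurable borel"
    unfolding step_def
    using cont_sobolev_coeff_continuous[OF step_cont_sobolev[OF v] s_nonneg]
    by (intro borel_measurable_continuous_on_if) auto
next
  fix t
  show "energy s (step v t) \<le> 1"
  proof (cases "t \<in> {0..T}")
    case True
    then have eq: "step v t = duhamel (N v) t" by (auto simp: step_def)
    have "energy s (step v t) \<le> ennreal T * (\<integral>\<^sup>+r. energy s (N v r) * indicator {0..t} r \<partial>lborel)"
      unfolding eq using True v by (intro duhamel_energy admissible_integrable) auto
    also have "\<dots> \<le> ennreal T * (\<integral>\<^sup>+r. energy s (N v r) * indicator {0..T} r \<partial>lborel)"
      using True by (intro mult_left_mono nn_integral_mono) (auto split: split_indicator)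
    also have "\<dots> \<le> ennreal T * ennreal K"
      by (intro mult_left_mono admissible_N_energy v) simp
    also have "\<dots> = ennreal (T * K)" using T_pos K_nonneg by (simp add: ennreal_mult)
    also have "\<dots> \<le> ennreal 1" using T_K by (intro ennreal_leI) simp
    finally show ?thesis by simp
  next
    case False
    then have "step v t = (\<lambda>n. 0)" by (auto simp: step_def)
    then show ?thesis by simp
  qed
qed

lemma step_contraction:
  assumes v: "admissible v" and v': "admissible v'"
    and le: "\<And>t. energy s (\<lambda>n. v t n - v' t n) \<le> ennreal \<delta>" and "0 \<le> \<delta>"
  shows "energy s (\<lambda>n. step v t n - step v' t n) \<le> ennreal (\<delta> / 4)"
proof (cases "t \<in> {0..T}")
  case True
  let ?c = "16 * C * (1 + 1 + A)"
  have c: "0 \<le> ?c" "?c \<le> K" using C_nonneg A_nonneg B_nonneg mult_nonneg_nonneg[OF C_nonneg A_nonneg]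
    by (auto simp: K_def algebra_simps)
  have "energy s (\<lambda>n. step v t n - step v' t n)
     = energy s (\<lambda>n. duhamel (N v) t n - duhamel (N v') t n)"
    using True by (simp add: step_def)
  also have "\<dots> \<le> ennreal T * (\<integral>\<^sup>+r. ennreal ?c * energy s (\<lambda>n. v r n - v' r n) * indicator {0..t} r \<partial>lborel)"
    using True v v' by (intro duhamel_N_diff admissible_integrable) (auto simp: admissible_def)
  also have "\<dots> \<le> ennreal T * (\<integral>\<^sup>+r. ennreal K * ennreal \<delta> * indicator {0..1} r \<partial>(lborel :: real measure))"
  proof (rule mult_left_mono[OF nn_integral_mono])
    fix r :: real
    have "ennreal ?c * energy s (\<lambda>n. v r n - v' r n) \<le> ennreal K * ennreal \<delta>"
      using c by (intro mult_mono le ennreal_leI) auto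
    then show "ennreal ?c * energy s (\<lambda>n. v r n - v' r n) * indicator {0..t} r
       \<le> ennreal K * ennreal \<delta> * indicator {0..1} r"
      using True T_le_1 by (auto split: split_indicator)
  qed simp
  also have "\<dots> = ennreal (T * K * \<delta>)"
    using T_pos K_nonneg \<open>0 \<le> \<delta>\<close> by (simp add: nn_integral_cmult ennreal_mult mult.assoc)
  also have "\<dots> \<le> ennreal (\<delta> / 4)"
    using mult_right_mono[OF T_K \<open>0 \<le> \<delta>\<close>] by (intro ennreal_leI) simp
  finally show ?thesis .
next
  case False
  then show ?thesis by (simp only: step_def if_False) simp
qed

definition iterate :: "nat \<Rightarrow> real \<Rightarrow> int \<Rightarrow> complex" where
  "iterate m = (step ^^ m) (\<lambda>t n. 0)"

lemma iterate_Suc: "iterate (Suc m) = step (iterate m)"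
  by (simp add: iterate_def)

lemma iterate_admissible: "admissible (iterate m)"
proof (induction m)
  case 0
  show ?case by (simp add: iterate_def admissible_def)
next
  case (Suc m)
  then show ?case by (simp add: iterate_Suc step_admissible)
qed

lemma iterate_succ_diff:
  "energy s (\<lambda>n. iterate (Suc m) t n - iterate m t n) \<le> ennreal ((1 / 4) ^ m)"
proof (induction m arbitrary: t)
  case 0
  show ?case using iterate_admissible[of 1] by (simp add: admissible_def iterate_def)
next
  case (Suc m)
  show ?case
    using step_contraction[OF iterate_admissible iterate_admissible Suc.IH]
    by (simp add: iterate_Suc)
qed

text \<open>
  The factor 2 of the triangle inequality for energies is paid at each term of the telescoping sum, which
  the ratio \<open>1/4\<close> of the contraction can afford.
\<close>

lemma iterate_diff:
  "energy s (\<lambda>n. iterate (m + p) t n - iterate m t n) \<le> ennreal (4 * (1 / 4) ^ m)"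
proof (induction p arbitrary: m)
  case 0
  show ?case by simp
next
  case (Suc p)
  have "energy s (\<lambda>n. iterate (m + Suc p) t n - iterate m t n)
     \<le> 2 * energy s (\<lambda>n. iterate (Suc m + p) t n - iterate (Suc m) t n)
       + 2 * energy s (\<lambda>n. iterate (Suc m) t n - iterate m t n)"
    using energy_triangle[of s "iterate (m + Suc p) t" "iterate m t" "iterate (Suc m) t"] by simp
  also have "\<dots> \<le> 2 * ennreal (4 * (1 / 4) ^ Suc m) + 2 * ennreal ((1 / 4) ^ m)"
    by (intro add_mono mult_left_mono iterate_succ_diff Suc.IH) auto
  also have "\<dots> = ennreal (2 * (4 * (1 / 4) ^ Suc m) + 2 * (1 / 4) ^ m)"
    by (intro ennreal_double_add) auto
  also have "2 * (4 * (1 / 4) ^ Suc m) + 2 * (1 / 4) ^ m = 4 * (1 / 4 :: real) ^ m" by simp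
  finally show ?case .
qed

lemma iterate_coeff_diff:
  assumes "m \<le> i"
  shows "cmod (iterate i t n - iterate m t n) \<le> 2 * (1 / 2) ^ m"
proof -
  have "ennreal ((cmod (iterate i t n - iterate m t n))\<^sup>2) \<le> ennreal (4 * (1 / 4) ^ m)"
    using order_trans[OF cmod_square_le_energy[OF s_nonneg] iterate_diff[of m "i - m" t]] assms by simp
  then have "(cmod (iterate i t n - iterate m t n))\<^sup>2 \<le> 4 * (1 / 4) ^ m"
    by (subst (asm) ennreal_le_iff) auto
  also have "\<dots> = (2 * (1 / 2) ^ m)\<^sup>2"
    by (simp add: power2_eq_square flip: power_mult_distrib)
  finally show ?thesis by (rule power2_le_imp_le) simp
qed

definition fixpoint :: "real \<Rightarrow> int \<Rightarrow> complex" where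
  "fixpoint t n = lim (\<lambda>m. iterate m t n)"

lemma iterate_tendsto: "(\<lambda>m. iterate m t n) \<longlonglongrightarrow> fixpoint t n"
proof -
  have "Cauchy (\<lambda>m. iterate m t n)"
  proof (rule CauchyI')
    fix e :: real assume "0 < e"
    have "(\<lambda>m. 2 * (1 / 2 :: real) ^ m) \<longlonglongrightarrow> 2 * 0"
      by (intro tendsto_intros LIMSEQ_realpow_zero) auto
    then have "eventually (\<lambda>m. 2 * (1 / 2 :: real) ^ m < e) sequentially"
      using \<open>0 < e\<close> by (intro order_tendstoD) auto
    then obtain m0 where m0: "\<And>m. m \<ge> m0 \<Longrightarrow> 2 * (1 / 2 :: real) ^ m < e"
      unfolding eventually_sequentially by blast
    show "\<exists>M. \<forall>m\<ge>M. \<forall>i>m. dist (iterate m t n) (iterate i t n) < e"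
    proof (intro exI[of _ m0] allI impI)
      fix m i assume m: "m0 \<le> m" and "m < i"
      then have "cmod (iterate i t n - iterate m t n) \<le> 2 * (1 / 2) ^ m"
        by (intro iterate_coeff_diff) simp
      also have "\<dots> < e" by (rule m0[OF m])
      finally show "dist (iterate m t n) (iterate i t n) < e"
        by (simp add: dist_norm norm_minus_commute)
    qed
  qed
  then show ?thesis unfolding fixpoint_def by (simp add: Cauchy_convergent flip: convergent_LIMSEQ_iff)
qed

lemma fixpoint_admissible: "admissible fixpoint"
  unfolding admissible_def
proof (intro conjI allI)
  show "(\<lambda>t. fixpoint t n) \<in> borel_measurable borel" for n
    unfolding fixpoint_def
    using iterate_admissible by (intro borel_measurable_lim_metric) (simp add: admissible_def)
  show "energy s (fixpoint t) \<le> 1" for t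
    using iterate_admissible by (intro energy_limit[OF iterate_tendsto]) (simp add: admissible_def)
qed

lemma fixpoint_diff: "energy s (\<lambda>n. fixpoint t n - iterate m t n) \<le> ennreal (4 * (1 / 4) ^ m)"
proof (rule energy_limit)
  show "(\<lambda>i. iterate i t n - iterate m t n) \<longlonglongrightarrow> fixpoint t n - iterate m t n" for n
    by (intro tendsto_intros iterate_tendsto)
  show "\<forall>\<^sub>F i in sequentially. energy s (\<lambda>n. iterate i t n - iterate m t n) \<le> ennreal (4 * (1 / 4) ^ m)"
    using eventually_ge_at_top[of m]
  proof eventually_elim
    case (elim i)
    then show ?case using iterate_diff[of m "i - m" t] by simp
  qed
qed

text \<open>
  The step of the limit and the limit itself are both close to the same iterate.
\<close>

lemma fixpoint_eq: "step fixpoint t n = fixpoint t n"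
proof -
  have "energy s (\<lambda>n. step fixpoint t n - fixpoint t n) \<le> ennreal (4 * (1 / 4) ^ m)" for m
  proof -
    have "energy s (\<lambda>n. step fixpoint t n - fixpoint t n)
       \<le> 2 * energy s (\<lambda>n. step fixpoint t n - iterate (Suc m) t n)
         + 2 * energy s (\<lambda>n. iterate (Suc m) t n - fixpoint t n)"
      by (rule energy_triangle)
    also have "\<dots> \<le> 2 * ennreal (4 * (1 / 4) ^ m / 4) + 2 * ennreal (4 * (1 / 4) ^ Suc m)"
    proof (intro add_mono mult_left_mono)
      show "energy s (\<lambda>n. step fixpoint t n - iterate (Suc m) t n) \<le> ennreal (4 * (1 / 4) ^ m / 4)"
        unfolding iterate_Suc
        by (rule step_contraction[OF fixpoint_admissible iterate_admissible fixpoint_diff]) simp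
      show "energy s (\<lambda>n. iterate (Suc m) t n - fixpoint t n) \<le> ennreal (4 * (1 / 4) ^ Suc m)"
        by (subst energy_commute) (rule fixpoint_diff)
    qed auto
    also have "\<dots> = ennreal (2 * (4 * (1 / 4) ^ m / 4) + 2 * (4 * (1 / 4) ^ Suc m))"
      by (intro ennreal_double_add) auto
    also have "2 * (4 * (1 / 4) ^ m / 4) + 2 * (4 * (1 / 4) ^ Suc m) = 4 * (1 / 4 :: real) ^ m" by simp
    finally show ?thesis .
  qed
  moreover have "(\<lambda>m. 4 * (1 / 4 :: real) ^ m) \<longlonglongrightarrow> 0"
    using tendsto_mult[OF tendsto_const LIMSEQ_realpow_zero[of "1 / 4"], of 4] by simp
  ultimately have "energy s (\<lambda>n. step fixpoint t n - fixpoint t n) = 0"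
    by (rule ennreal_le_null_seq_imp_zero)
  then show ?thesis by (simp add: energy_eq_0_iff)
qed

lemma fixpoint_duhamel: "t \<in> {0..T} \<Longrightarrow> fixpoint t n = duhamel (N fixpoint) t n"
  using fixpoint_eq[of t n] by (simp add: step_def)

lemma fixpoint_cont_sobolev: "fixpoint \<in> cont_sobolev T s"
proof -
  have "fixpoint t = duhamel (N fixpoint) t" if "t \<in> {0..T}" for t
    using fixpoint_duhamel[OF that] by (rule ext)
  from cont_sobolev_cong[of T fixpoint "duhamel (N fixpoint)" s, OF this] show ?thesis
    using step_cont_sobolev[OF fixpoint_admissible] by blast
qed

lemma bbm_solution_iff:
  "bbm_solution T' u0 w u \<longleftrightarrow> (\<forall>t\<in>{0..T'}. \<forall>n.
     set_integrable lborel {0..t} (\<lambda>r. bbm_group (t - r) (N (\<lambda>t n. u t n - z t n) r) n) \<and>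
     u t n - z t n = duhamel (N (\<lambda>t n. u t n - z t n)) t n)"
  unfolding bbm_solution_def Let_def N_def duhamel_def z_def
  by (intro ball_cong refl all_cong1 conj_cong) (auto simp: algebra_simps)

definition solution :: "real \<Rightarrow> int \<Rightarrow> complex" where
  "solution t n = z t n + fixpoint t n"

lemma solution_remainder [simp]: "solution t n - z t n = fixpoint t n"
  by (simp add: solution_def)

lemma solution_in_class: "solution \<in> solution_class T s u0"
  using fixpoint_cont_sobolev by (simp add: solution_class_def flip: z_def)

lemma solution_initial: "solution 0 = u0"
proof
  fix n
  have "fixpoint 0 n = 0"
    using T_pos fixpoint_duhamel[of 0 n] by (simp only: duhamel_zero atLeastAtMost_iff order_refl less_imp_le)
  then show "solution 0 n = u0 n" by (simp add: solution_def z_def bbm_group_def)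
qed

lemma solution_solves: "bbm_solution T u0 w solution"
  unfolding bbm_solution_iff
  by (simp add: admissible_integrable[OF fixpoint_admissible] fixpoint_duhamel[symmetric])

lemma solution_unique:
  assumes u': "u' \<in> solution_class T s u0" "bbm_solution T u0 w u'" and t: "t \<in> {0..T}"
  shows "u' t = solution t"
proof -
  have "(\<lambda>t n. u' t n - z t n) t = fixpoint t"
  proof (rule duhamel_unique[of _ T])
    show "(\<lambda>t n. u' t n - z t n) \<in> cont_sobolev T s" using u'(1) by (simp add: solution_class_def z_def)
    show "fixpoint \<in> cont_sobolev T s" by (rule fixpoint_cont_sobolev)
    show "0 \<le> T" using T_pos by simp
    fix r n assume r: "r \<in> {0..T}"
    show "set_integrable lborel {0..r} (\<lambda>q. bbm_group (r - q) (N (\<lambda>t n. u' t n - z t n) q) n)"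
      "u' r n - z r n = duhamel (N (\<lambda>t n. u' t n - z t n)) r n"
      using u'(2) r by (auto simp: bbm_solution_iff)
    show "set_integrable lborel {0..r} (\<lambda>q. bbm_group (r - q) (N fixpoint q) n)"
      using r by (intro admissible_integrable fixpoint_admissible) simp
    show "fixpoint r n = duhamel (N fixpoint) r n" by (rule fixpoint_duhamel[OF r])
  qed (rule t)
  then have "u' t n - z t n = fixpoint t n" for n by (rule fun_cong)
  then show ?thesis by (simp add: fun_eq_iff solution_def algebra_simps)
qed

end

lemma solution_class_subset:
  assumes "energy r u0 < \<infinity>" and "r \<le> s"
  shows "solution_class T s u0 \<subseteq> cont_sobolev T r"
proof
  fix u assume "u \<in> solution_class T s u0"
  then have "(\<lambda>t n. u t n - bbm_group t u0 n) \<in> cont_sobolev T s"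
    by (simp add: solution_class_def)
  then have "(\<lambda>t n. u t n - bbm_group t u0 n) \<in> cont_sobolev T r"
    using \<open>r \<le> s\<close> by (rule cont_sobolev_mono)
  from cont_sobolev_add[OF this bbm_group_cont_sobolev[OF assms(1)]]
  show "u \<in> cont_sobolev T r" by simp
qed

theorem (in forced_bbm) local_well_posedness:
  "\<exists>T>0. \<exists>u. u \<in> solution_class T s u0 \<and> u 0 = u0 \<and> bbm_solution T u0 w u \<and>
     (\<forall>u'. u' \<in> solution_class T s u0 \<and> u' 0 = u0 \<and> bbm_solution T u0 w u' \<longrightarrow>
       (\<forall>t\<in>{0..T}. u' t = u t))"
proof (intro exI[of _ T] conjI exI[of _ solution] T_pos solution_in_class solution_initial solution_solves)
  show "\<forall>u'. u' \<in> solution_class T s u0 \<and> u' 0 = u0 \<and> bbm_solution T u0 w u' \<longrightarrow>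
      (\<forall>t\<in>{0..T}. u' t = solution t)"
    by (intro allI impI ballI, elim conjE) (rule solution_unique)
qed

section \<open>Gaussian moments and orthogonality of frequency pairs\<close>

lemma distributed_normal_moment_even:
  assumes D: "distributed M lborel X (normal_density 0 \<sigma>)" and "0 < \<sigma>"
  shows "integrable M (\<lambda>\<omega>. X \<omega> ^ (2 * k))"
    and "integral\<^sup>L M (\<lambda>\<omega>. X \<omega> ^ (2 * k)) = fact (2 * k) / ((2 / \<sigma>\<^sup>2) ^ k * fact k)"
proof -
  have *: "has_bochner_integral lborel (\<lambda>x. normal_density 0 \<sigma> x * x ^ (2 * k)) (fact (2 * k) / ((2 / \<sigma>\<^sup>2) ^ k * fact k))"
    using normal_moment_even[OF \<open>0 < \<sigma>\<close>, of 0 k] by simp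
  show "integrable M (\<lambda>\<omega>. X \<omega> ^ (2 * k))"
    using distributed_integrable[OF D, of "\<lambda>x. x ^ (2 * k)"] * by (simp add: has_bochner_integral_iff)
  show "integral\<^sup>L M (\<lambda>\<omega>. X \<omega> ^ (2 * k)) = fact (2 * k) / ((2 / \<sigma>\<^sup>2) ^ k * fact k)"
    using distributed_integral[OF D, of "\<lambda>x. x ^ (2 * k)"] * by (simp add: has_bochner_integral_iff)
qed

lemma distributed_normal_mean_zero:
  assumes D: "distributed M lborel X (normal_density 0 \<sigma>)" and "0 < \<sigma>"
  shows "integrable M X" and "integral\<^sup>L M X = 0"
proof -
  have *: "has_bochner_integral lborel (\<lambda>x. normal_density 0 \<sigma> x * x) 0"
    using normal_moment_odd[OF \<open>0 < \<sigma>\<close>, of 0 0] by simp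
  show "integrable M X"
    using distributed_integrable[OF D, of "\<lambda>x. x"] * by (simp add: has_bochner_integral_iff)
  show "integral\<^sup>L M X = 0"
    using distributed_integral[OF D, of "\<lambda>x. x"] * by (simp add: has_bochner_integral_iff)
qed

lemma cmod_power4_le: "(cmod x) ^ 4 \<le> 2 * Re x ^ 4 + 2 * Im x ^ 4"
proof -
  have "(cmod x) ^ 4 = ((cmod x)\<^sup>2)\<^sup>2" by simp
  also have "\<dots> = ((Re x)\<^sup>2 + (Im x)\<^sup>2)\<^sup>2" by (simp add: cmod_power2)
  also have "\<dots> \<le> 2 * ((Re x)\<^sup>2)\<^sup>2 + 2 * ((Im x)\<^sup>2)\<^sup>2"
    using sum_squares_bound[of "(Re x)\<^sup>2" "(Im x)\<^sup>2"] by (simp add: power2_sum)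
  finally show ?thesis by simp
qed

text \<open>
  Collecting equal absolute values turns a product of coefficients into a product over distinct indices,
  the form to which independence applies.
\<close>

lemma prod_list_group:
  "(\<Prod>a\<leftarrow>xs. f a) = (\<Prod>i\<in>abs ` set xs. \<Prod>a\<leftarrow>filter (\<lambda>a. \<bar>a\<bar> = i) xs. f (a::int) :: complex)"
proof -
  have "(\<Prod>a\<leftarrow>xs. f a) = (\<Prod>i\<in>I. \<Prod>a\<leftarrow>filter (\<lambda>a. \<bar>a\<bar> = i) xs. f a)"
    if "finite I" "abs ` set xs \<subseteq> I" for I
    using that(2)
  proof (induction xs)
    case (Cons b xs)
    then have b: "\<bar>b\<bar> \<in> I" by auto
    have "(\<Prod>i\<in>I. \<Prod>a\<leftarrow>filter (\<lambda>a. \<bar>a\<bar> = i) (b # xs). f a)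
       = (\<Prod>i\<in>I. (if i = \<bar>b\<bar> then f b else 1) * (\<Prod>a\<leftarrow>filter (\<lambda>a. \<bar>a\<bar> = i) xs. f a))"
      by (intro prod.cong) auto
    also have "\<dots> = f b * (\<Prod>i\<in>I. \<Prod>a\<leftarrow>filter (\<lambda>a. \<bar>a\<bar> = i) xs. f a)"
      using b that(1) by (simp add: prod.distrib)
    finally show ?case using Cons by simp
  qed simp
  then show ?thesis by simp
qed

text \<open>
  If \<open>{\<bar>k\<bar>, \<bar>n-k\<bar>}\<close> and \<open>{\<bar>j\<bar>, \<bar>n-j\<bar>}\<close> coincide as sets, then \<open>n \<noteq> 0\<close> forces \<open>j \<in> {k, n-k}\<close>. If they differ, an
  absolute value in one of them is missing from the other, and it occurs only once unless its pair is
  \<open>{n/2, n/2}\<close>; since \<open>\<bar>j\<bar> = \<bar>n-j\<bar>\<close> holds only for \<open>j = n/2\<close>, the other pair then provides one.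
\<close>

lemma unique_frequency:
  fixes n k j :: int
  assumes "n \<noteq> 0" "j \<noteq> k" "j \<noteq> n - k"
  shows "\<exists>i. length (filter (\<lambda>a. \<bar>a\<bar> = i) [k, n - k, - j, - (n - j)]) = 1"
proof -
  let ?L = "\<lambda>i. length (filter (\<lambda>a. \<bar>a\<bar> = i) [k, n - k, - j, - (n - j)])"
  have kk: "\<bar>k\<bar> = \<bar>n - k\<bar> \<longleftrightarrow> n = 2 * k" and jj: "\<bar>j\<bar> = \<bar>n - j\<bar> \<longleftrightarrow> n = 2 * j"
    using assms(1) by (auto simp: abs_eq_iff)
  have cross: "\<not> (\<bar>k\<bar> = \<bar>j\<bar> \<and> \<bar>n - k\<bar> = \<bar>n - j\<bar>)" "\<not> (\<bar>k\<bar> = \<bar>n - j\<bar> \<and> \<bar>n - k\<bar> = \<bar>j\<bar>)"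
    using assms unfolding abs_eq_iff by arith+
  have "\<not> (n = 2 * k \<and> n = 2 * j)" using assms by auto
  then have "(\<bar>k\<bar> \<notin> {\<bar>n - k\<bar>, \<bar>j\<bar>, \<bar>n - j\<bar>}) \<or> (\<bar>n - k\<bar> \<notin> {\<bar>k\<bar>, \<bar>j\<bar>, \<bar>n - j\<bar>})
      \<or> (\<bar>j\<bar> \<notin> {\<bar>k\<bar>, \<bar>n - k\<bar>, \<bar>n - j\<bar>}) \<or> (\<bar>n - j\<bar> \<notin> {\<bar>k\<bar>, \<bar>n - k\<bar>, \<bar>j\<bar>})"
    using kk jj cross unfolding insert_iff empty_iff by metis
  then have "?L \<bar>k\<bar> = 1 \<or> ?L \<bar>n - k\<bar> = 1 \<or> ?L \<bar>j\<bar> = 1 \<or> ?L \<bar>n - j\<bar> = 1"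
  proof (elim disjE)
    assume "\<bar>k\<bar> \<notin> {\<bar>n - k\<bar>, \<bar>j\<bar>, \<bar>n - j\<bar>}"
    then have "?L \<bar>k\<bar> = 1" by (auto simp: abs_minus_commute)
    then show ?thesis by blast
  next
    assume "\<bar>n - k\<bar> \<notin> {\<bar>k\<bar>, \<bar>j\<bar>, \<bar>n - j\<bar>}"
    then have "?L \<bar>n - k\<bar> = 1" by (auto simp: abs_minus_commute)
    then show ?thesis by blast
  next
    assume "\<bar>j\<bar> \<notin> {\<bar>k\<bar>, \<bar>n - k\<bar>, \<bar>n - j\<bar>}"
    then have "?L \<bar>j\<bar> = 1" by (auto simp: abs_minus_commute)
    then show ?thesis by blast
  next
    assume "\<bar>n - j\<bar> \<notin> {\<bar>k\<bar>, \<bar>n - k\<bar>, \<bar>j\<bar>}"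
    then have "?L \<bar>n - j\<bar> = 1" by (auto simp: abs_minus_commute)
    then show ?thesis by blast
  qed
  then show ?thesis by blast
qed

lemma borel_measurable_cnj [measurable (raw)]:
  assumes "f \<in> borel_measurable M"
  shows "(\<lambda>x. cnj (f x)) \<in> borel_measurable M"
proof -
  have "cnj \<in> borel_measurable borel"
    by (intro borel_measurable_continuous_onI continuous_intros)
  from measurable_compose[OF assms this] show ?thesis .
qed

locale gaussian_data = prob_space M for M :: "'a measure" +
  fixes g :: "int \<Rightarrow> 'a \<Rightarrow> complex"
  assumes family: "gaussian_family M g"
begin

lemma g_meas [measurable]: "g n \<in> borel_measurable M"
  using family by (simp add: gaussian_family_def)

lemma g_reflect: "AE \<omega> in M. g (- n) \<omega> = cnj (g n \<omega>)"
  using family by (simp add: gaussian_family_def)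

lemma g_indep: "indep_vars (\<lambda>_. borel) g {0..}"
  using family unfolding gaussian_family_def by (elim conjE)

lemma g_cmod_reflect: "AE \<omega> in M. cmod (g n \<omega>) = cmod (g \<bar>n\<bar> \<omega>)"
proof (cases "0 \<le> n")
  case False
  then show ?thesis using g_reflect[of n] by (auto simp: abs_if elim!: eventually_mono)
qed simp

lemma g_moments_nonneg:
  assumes "0 \<le> n"
  shows "integrable M (\<lambda>\<omega>. (cmod (g n \<omega>)) ^ 4)" and "integral\<^sup>L M (\<lambda>\<omega>. (cmod (g n \<omega>)) ^ 4) \<le> 3"
    and "integrable M (g n)" and "integral\<^sup>L M (g n) = 0"
proof -
  have "integrable M (\<lambda>\<omega>. (cmod (g n \<omega>)) ^ 4) \<and> integral\<^sup>L M (\<lambda>\<omega>. (cmod (g n \<omega>)) ^ 4) \<le> 3 \<and>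
     integrable M (g n) \<and> integral\<^sup>L M (g n) = 0"
  proof (cases "n = 0")
    case True
    have D: "distributed M lborel (\<lambda>\<omega>. Re (g 0 \<omega>)) (normal_density 0 1)" and R: "AE \<omega> in M. g 0 \<omega> \<in> \<real>"
      using family by (auto simp: gaussian_family_def)
    have R': "AE \<omega> in M. g 0 \<omega> = complex_of_real (Re (g 0 \<omega>))"
      using R by eventually_elim simp
    have R4: "AE \<omega> in M. (cmod (g 0 \<omega>)) ^ 4 = Re (g 0 \<omega>) ^ (2 * 2)"
      using R' by eventually_elim (metis norm_of_real power_even_abs_numeral even_numeral mult_2 numeral_Bit0 norm_power)
    have i4: "integrable M (\<lambda>\<omega>. (cmod (g 0 \<omega>)) ^ 4)"
      using distributed_normal_moment_even(1)[OF D, of 2] by (subst integrable_cong_AE[OF _ _ R4]) auto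
    have "integral\<^sup>L M (\<lambda>\<omega>. (cmod (g 0 \<omega>)) ^ 4) = integral\<^sup>L M (\<lambda>\<omega>. Re (g 0 \<omega>) ^ (2 * 2))"
      by (rule integral_cong_AE[OF _ _ R4]) auto
    also have "\<dots> = 3"
      by (subst distributed_normal_moment_even(2)[OF D]) (auto simp: fact_numeral)
    finally have v4: "integral\<^sup>L M (\<lambda>\<omega>. (cmod (g 0 \<omega>)) ^ 4) = 3" .
    have i1: "integrable M (g 0)"
      using distributed_normal_mean_zero(1)[OF D]
      by (subst integrable_cong_AE[OF _ _ R']) (auto intro: integrable_of_real)
    have "integral\<^sup>L M (g 0) = integral\<^sup>L M (\<lambda>\<omega>. complex_of_real (Re (g 0 \<omega>)))"
      by (rule integral_cong_AE[OF _ _ R']) auto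
    also have "\<dots> = 0" using distributed_normal_mean_zero[OF D] by simp
    finally show ?thesis using True i4 v4 i1 by simp
  next
    case False
    with assms have "std_complex_gaussian M (g n)"
      using family by (simp add: gaussian_family_def)
    then have D: "distributed M lborel (\<lambda>\<omega>. Re (g n \<omega>)) (normal_density 0 (1 / sqrt 2))"
      "distributed M lborel (\<lambda>\<omega>. Im (g n \<omega>)) (normal_density 0 (1 / sqrt 2))"
      by (auto simp: std_complex_gaussian_def)
    have m: "integrable M (\<lambda>\<omega>. Re (g n \<omega>) ^ 4)" "integral\<^sup>L M (\<lambda>\<omega>. Re (g n \<omega>) ^ 4) = 3 / 4"
      "integrable M (\<lambda>\<omega>. Im (g n \<omega>) ^ 4)" "integral\<^sup>L M (\<lambda>\<omega>. Im (g n \<omega>) ^ 4) = 3 / 4"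
      using distributed_normal_moment_even[OF D(1), of 2] distributed_normal_moment_even[OF D(2), of 2]
      by (auto simp: power_divide fact_numeral)
    have i4: "integrable M (\<lambda>\<omega>. (cmod (g n \<omega>)) ^ 4)"
      by (rule Bochner_Integration.integrable_bound[of M "\<lambda>\<omega>. 2 * Re (g n \<omega>) ^ 4 + 2 * Im (g n \<omega>) ^ 4"])
        (use m cmod_power4_le in \<open>auto intro!: AE_I2\<close>)
    have "integral\<^sup>L M (\<lambda>\<omega>. (cmod (g n \<omega>)) ^ 4) \<le> integral\<^sup>L M (\<lambda>\<omega>. 2 * Re (g n \<omega>) ^ 4 + 2 * Im (g n \<omega>) ^ 4)"
      using m by (intro integral_mono i4 cmod_power4_le) auto
    also have "\<dots> = 3" using m by simp
    finally have v4: "integral\<^sup>L M (\<lambda>\<omega>. (cmod (g n \<omega>)) ^ 4) \<le> 3" .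
    have r: "integrable M (\<lambda>\<omega>. Re (g n \<omega>))" "integral\<^sup>L M (\<lambda>\<omega>. Re (g n \<omega>)) = 0"
      "integrable M (\<lambda>\<omega>. Im (g n \<omega>))" "integral\<^sup>L M (\<lambda>\<omega>. Im (g n \<omega>)) = 0"
      using distributed_normal_mean_zero[OF D(1)] distributed_normal_mean_zero[OF D(2)] by auto
    have i1: "integrable M (g n)"
      by (rule Bochner_Integration.integrable_bound[of M "\<lambda>\<omega>. \<bar>Re (g n \<omega>)\<bar> + \<bar>Im (g n \<omega>)\<bar>"])
        (use r cmod_le in \<open>auto intro!: AE_I2\<close>)
    have "integral\<^sup>L M (g n) = 0"
      using r i1 by (intro complex_eqI) simp_all
    with i4 v4 i1 show ?thesis by simp
  qed
  then show "integrable M (\<lambda>\<omega>. (cmod (g n \<omega>)) ^ 4)" and "integral\<^sup>L M (\<lambda>\<omega>. (cmod (g n \<omega>)) ^ 4) \<le> 3"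
    and "integrable M (g n)" and "integral\<^sup>L M (g n) = 0" by auto
qed

lemma g_power4_integrable: "integrable M (\<lambda>\<omega>. (cmod (g n \<omega>)) ^ 4)"
  and g_power4_le: "integral\<^sup>L M (\<lambda>\<omega>. (cmod (g n \<omega>)) ^ 4) \<le> 3"
proof -
  have AE: "AE \<omega> in M. (cmod (g n \<omega>)) ^ 4 = (cmod (g \<bar>n\<bar> \<omega>)) ^ 4"
    using g_cmod_reflect[of n] by eventually_elim simp
  show "integrable M (\<lambda>\<omega>. (cmod (g n \<omega>)) ^ 4)"
    by (subst integrable_cong_AE[OF _ _ AE]) (auto intro: g_moments_nonneg)
  show "integral\<^sup>L M (\<lambda>\<omega>. (cmod (g n \<omega>)) ^ 4) \<le> 3"
    by (subst integral_cong_AE[OF _ _ AE]) (auto intro: g_moments_nonneg)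
qed

text \<open>
  Expresses \<open>g a\<close> through \<open>g \<bar>a\<bar>\<close>; independence is available for nonnegative indices.
\<close>

definition cnj_if_neg :: "int \<Rightarrow> complex \<Rightarrow> complex" where
  "cnj_if_neg a x = (if 0 \<le> a then x else cnj x)"

lemma cnj_if_neg_measurable [measurable]: "cnj_if_neg a \<in> borel_measurable borel"
  unfolding cnj_if_neg_def
  by (intro borel_measurable_continuous_onI, cases "0 \<le> a") (auto intro!: continuous_intros)

lemma cmod_cnj_if_neg [simp]: "cmod (cnj_if_neg a x) = cmod x"
  by (simp add: cnj_if_neg_def)

lemma g_eq_cnj_if_neg: "AE \<omega> in M. g a \<omega> = cnj_if_neg a (g \<bar>a\<bar> \<omega>)"
proof (cases "0 \<le> a")
  case False
  then show ?thesis using g_reflect[of "\<bar>a\<bar>"] by (auto simp: cnj_if_neg_def)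
qed (simp add: cnj_if_neg_def)

lemma g_prod_integrable:
  assumes "length xs \<le> 4"
  shows "integrable M (\<lambda>\<omega>. \<Prod>a\<leftarrow>xs. cnj_if_neg a (g n \<omega>))"
proof (rule Bochner_Integration.integrable_bound[of M "\<lambda>\<omega>. 1 + (cmod (g n \<omega>)) ^ 4"])
  show "integrable M (\<lambda>\<omega>. 1 + (cmod (g n \<omega>)) ^ 4)" using g_power4_integrable by simp
  show "(\<lambda>\<omega>. \<Prod>a\<leftarrow>xs. cnj_if_neg a (g n \<omega>)) \<in> borel_measurable M"
    by (induction xs) auto
  have "cmod (\<Prod>a\<leftarrow>xs. cnj_if_neg a x) = cmod x ^ length xs" for x
    by (induction xs) (auto simp: norm_mult)
  moreover have "r ^ length xs \<le> 1 + r ^ 4" if "0 \<le> r" for r :: real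
  proof (cases "r \<le> 1")
    case True
    then show ?thesis using that power_le_one[of r "length xs"] zero_le_power[of r 4] by linarith
  next
    case False
    then have "r ^ length xs \<le> r ^ 4" by (intro power_increasing assms) simp
    then show ?thesis by linarith
  qed
  ultimately show "AE \<omega> in M. norm (\<Prod>a\<leftarrow>xs. cnj_if_neg a (g n \<omega>)) \<le> norm (1 + (cmod (g n \<omega>)) ^ 4)"
    by (intro AE_I2) (simp add: abs_of_nonneg)
qed

text \<open>
  A factor whose frequency occurs once, up to sign, is centred and independent of all the others.
\<close>

lemma g_prod4_expectation_zero:
  assumes len: "length xs \<le> 4" and unique: "length (filter (\<lambda>a. \<bar>a\<bar> = i0) xs) = 1"
  shows "integral\<^sup>L M (\<lambda>\<omega>. \<Prod>a\<leftarrow>xs. g a \<omega>) = 0"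
proof -
  let ?I = "abs ` set xs"
  let ?f = "\<lambda>i x. \<Prod>a\<leftarrow>filter (\<lambda>a. \<bar>a\<bar> = i) xs. cnj_if_neg a x"
  have "AE \<omega> in M. \<forall>a\<in>set xs. g a \<omega> = cnj_if_neg a (g \<bar>a\<bar> \<omega>)"
    by (rule AE_finite_allI) (auto intro: g_eq_cnj_if_neg)
  then have AE: "AE \<omega> in M. (\<Prod>a\<leftarrow>xs. g a \<omega>) = (\<Prod>i\<in>?I. ?f i (g i \<omega>))"
  proof eventually_elim
    case (elim \<omega>)
    then have "(\<Prod>a\<leftarrow>xs. g a \<omega>) = (\<Prod>a\<leftarrow>xs. cnj_if_neg a (g \<bar>a\<bar> \<omega>))"
      by (intro arg_cong[where f=prod_list] map_cong) auto
    also have "\<dots> = (\<Prod>i\<in>?I. \<Prod>a\<leftarrow>filter (\<lambda>a. \<bar>a\<bar> = i) xs. cnj_if_neg a (g \<bar>a\<bar> \<omega>))"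
      by (rule prod_list_group)
    also have "\<dots> = (\<Prod>i\<in>?I. ?f i (g i \<omega>))"
      by (intro prod.cong arg_cong[where f=prod_list] map_cong refl) auto
    finally show ?case .
  qed
  have meas: "(\<lambda>x. ?f i x) \<in> borel_measurable borel" for i
  proof -
    have "(\<lambda>x. \<Prod>a\<leftarrow>ys. cnj_if_neg a x) \<in> borel_measurable borel" for ys
      by (induction ys) auto
    then show ?thesis .
  qed
  have meas': "(\<lambda>\<omega>. \<Prod>a\<leftarrow>ys. g a \<omega>) \<in> borel_measurable M" for ys
    by (induction ys) auto
  have "integral\<^sup>L M (\<lambda>\<omega>. \<Prod>a\<leftarrow>xs. g a \<omega>) = integral\<^sup>L M (\<lambda>\<omega>. \<Prod>i\<in>?I. ?f i (g i \<omega>))"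
    by (rule integral_cong_AE[OF meas' _ AE])
      (intro borel_measurable_prod measurable_compose[OF g_meas meas])
  also have "\<dots> = (\<Prod>i\<in>?I. integral\<^sup>L M (\<lambda>\<omega>. ?f i (g i \<omega>)))"
  proof (rule indep_vars_lebesgue_integral[where X="\<lambda>i \<omega>. ?f i (g i \<omega>)"])
    have "indep_vars (\<lambda>_. borel) g ?I"
      by (rule indep_vars_subset[OF g_indep]) auto
    then show "indep_vars (\<lambda>_. borel) (\<lambda>i \<omega>. ?f i (g i \<omega>)) ?I"
      by (rule indep_vars_compose2) (rule meas)
    show "integrable M (\<lambda>\<omega>. ?f i (g i \<omega>))" for i
      using len by (intro g_prod_integrable order_trans[OF length_filter_le])
  qed simp
  also have "\<dots> = 0"
  proof (rule prod_zero)
    obtain a where a: "filter (\<lambda>a. \<bar>a\<bar> = i0) xs = [a]"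
      using unique by (cases "filter (\<lambda>a. \<bar>a\<bar> = i0) xs") auto
    have "a \<in> set (filter (\<lambda>a. \<bar>a\<bar> = i0) xs)" by (simp add: a)
    then have ai: "a \<in> set xs" "\<bar>a\<bar> = i0" by auto
    have "integral\<^sup>L M (\<lambda>\<omega>. cnj_if_neg a (g i0 \<omega>)) = 0"
      using g_moments_nonneg[of i0] ai(2) by (cases "0 \<le> a") (auto simp: cnj_if_neg_def integral_cnj)
    then have "integral\<^sup>L M (\<lambda>\<omega>. ?f i0 (g i0 \<omega>)) = 0" by (simp add: a)
    then show "\<exists>i\<in>?I. integral\<^sup>L M (\<lambda>\<omega>. ?f i (g i \<omega>)) = 0" using ai by auto
  qed simp
  finally show ?thesis .
qed

end

section \<open>Summability of the variances\<close>

text \<open>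
  The variance, up to a constant, of the pair \<open>(k, n - k)\<close> in the \<open>n\<close>-th coefficient of the square.
\<close>

definition pair_weight :: "real \<Rightarrow> int \<Rightarrow> int \<Rightarrow> real" where
  "pair_weight \<alpha> n k = jap k powr - (2 * \<alpha>) * jap (n - k) powr - (2 * \<alpha>)"

lemma pair_weight_nonneg [simp]: "0 \<le> pair_weight \<alpha> n k"
  by (simp add: pair_weight_def)

lemma pair_weight_finite:
  assumes "1 / 4 < \<alpha>"
  shows "nnsum (\<lambda>k. ennreal (pair_weight \<alpha> n k)) < \<infinity>"
proof -
  let ?j = "\<lambda>k. ennreal (jap k powr - (2 * \<alpha>))"
  have sq: "(?j k)\<^sup>2 = ennreal (jap k powr - (4 * \<alpha>))" for k
  proof -
    have "(jap k powr - (2 * \<alpha>))\<^sup>2 = jap k powr - (4 * \<alpha>)"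
      by (simp add: power2_eq_square flip: powr_add)
    then show ?thesis by (simp add: ennreal_power)
  qed
  have fin: "nnsum (\<lambda>k. (?j k)\<^sup>2) < \<infinity>"
    unfolding sq using assms by (intro nnsum_jap_powr_finite) simp
  have "(nnsum (\<lambda>k. ennreal (pair_weight \<alpha> n k)))\<^sup>2 = (nnsum (\<lambda>k. ?j k * ?j (n - k)))\<^sup>2"
    by (simp add: pair_weight_def ennreal_mult)
  also have "\<dots> \<le> nnsum (\<lambda>k. (?j k)\<^sup>2) * nnsum (\<lambda>k. (?j k)\<^sup>2)"
    by (rule nnsum_convolution_le)
  also have "\<dots> < \<infinity>" using fin by (simp add: ennreal_mult_less_top)
  finally show ?thesis by (simp add: power_less_top_ennreal)
qed

text \<open>
  The larger of \<open>\<langle>k\<rangle>\<close> and \<open>\<langle>n-k\<rangle>\<close> is at least half of \<open>\<langle>n\<rangle>\<close>. Its decay is divided between \<open>n\<close>, which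
  receives the exponent \<open>b1\<close>, and the smaller of the two, which receives \<open>b2\<close>.
\<close>

lemma pair_weight_split:
  fixes a b b1 b2 :: real
  assumes "0 \<le> b1" "b1 \<le> 1" "0 \<le> b2" and b: "b = b1 + b2"
  shows "jap n powr - a * (jap k powr - b * jap (n - k) powr - b)
    \<le> 2 * (jap n powr - (a + b1) * jap (n - k) powr - (b + b2) + jap n powr - (a + b1) * jap k powr - (b + b2))"
proof -
  have two: "2 powr b1 \<le> 2" using powr_mono[of b1 1 2] assms by simp
  have main: "jap n powr - a * (x powr - b * y powr - b) \<le> 2 * (jap n powr - (a + b1) * y powr - (b + b2))"
    if xy: "y \<le> x" "1 \<le> y" and n: "jap n \<le> x + y" for x y
  proof -
    have "x powr - b = x powr - b1 * x powr - b2" using b by (simp flip: powr_add)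
    also have "\<dots> \<le> (2 * jap n powr - b1) * y powr - b2"
    proof (intro mult_mono)
      have "x powr - b1 \<le> (jap n / 2) powr - b1"
        using xy n assms by (intro powr_mono2') auto
      also have "\<dots> = jap n powr - b1 * 2 powr b1"
        by (simp add: powr_divide powr_minus field_simps)
      also have "\<dots> \<le> jap n powr - b1 * 2"
        by (intro mult_left_mono two) simp
      finally show "x powr - b1 \<le> 2 * jap n powr - b1" by simp
      show "x powr - b2 \<le> y powr - b2" using xy assms by (intro powr_mono2') auto
    qed auto
    finally have "jap n powr - a * (x powr - b * y powr - b)
       \<le> jap n powr - a * ((2 * jap n powr - b1 * y powr - b2) * y powr - b)"
      by (intro mult_left_mono mult_right_mono) auto
    also have "\<dots> = 2 * (jap n powr - (a + b1) * y powr - (b + b2))"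
      by (simp add: powr_add powr_minus powr_diff field_simps)
    finally show ?thesis .
  qed
  have tri: "jap n \<le> jap k + jap (n - k)" using jap_triangle[of k "n - k"] by simp
  show ?thesis
  proof (cases "jap (n - k) \<le> jap k")
    case True
    then show ?thesis using main[of "jap (n - k)" "jap k"] tri
      by (simp add: algebra_simps) (smt (verit) mult_nonneg_nonneg powr_ge_zero)
  next
    case False
    then show ?thesis using main[of "jap k" "jap (n - k)"] tri
      by (simp add: algebra_simps) (smt (verit) mult_nonneg_nonneg powr_ge_zero)
  qed
qed

text \<open>
  With \<open>a = 2 - 2s\<close> and \<open>b = 2\<alpha>\<close> the exponents \<open>a + b1\<close> and \<open>b + b2\<close> must both exceed 1 while
  \<open>b1 + b2 = b\<close> and \<open>b1, b2 \<ge> 0\<close>. This is possible because \<open>b \<le> 1\<close>, \<open>2b > 1\<close> and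
  \<open>a + 2b > 2\<close>, that is, \<open>\<alpha> \<le> 1/2\<close>, \<open>\<alpha> > 1/4\<close> and \<open>s < 2\<alpha>\<close>; \<open>\<delta>\<close> measures the room that is left.
\<close>

lemma pair_weight_total_finite:
  assumes \<alpha>: "1 / 4 < \<alpha>" "\<alpha> \<le> 1 / 2" and s: "s < 2 * \<alpha>"
  shows "nnsum (\<lambda>n. ennreal (jap n powr (2 * s - 2)) * nnsum (\<lambda>k. ennreal (pair_weight \<alpha> n k))) < \<infinity>"
proof -
  define a where "a = 2 - 2 * s"
  define b where "b = 2 * \<alpha>"
  define \<delta> where "\<delta> = min (2 * b - 1) (a + 2 * b - 2)"
  define b2 where "b2 = 1 - b + \<delta> / 2"
  define b1 where "b1 = b - b2"
  have \<delta>: "0 < \<delta>" "\<delta> \<le> 2 * b - 1" "\<delta> \<le> a + 2 * b - 2" using assms by (auto simp: \<delta>_def a_def b_def)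
  have b01: "b \<le> 1" using \<alpha> by (simp add: b_def)
  have b12: "0 \<le> b1" "b1 \<le> 1" "0 \<le> b2" "b = b1 + b2" "1 < a + b1" "1 < b + b2"
    using \<delta> b01 by (auto simp: b1_def b2_def)
  define p where "p n = ennreal (jap n powr - (a + b1))" for n
  define q where "q n = ennreal (jap n powr - (b + b2))" for n
  let ?Q = "\<lambda>n. nnsum (\<lambda>k. ennreal (pair_weight \<alpha> n k))"
  have "nnsum (\<lambda>n. ennreal (jap n powr (2 * s - 2)) * ?Q n)
      \<le> nnsum (\<lambda>n. nnsum (\<lambda>k. 2 * (p n * q (n - k) + p n * q k)))"
  proof (rule nn_integral_mono)
    fix n
    have "ennreal (jap n powr (2 * s - 2)) * ?Q n
       = nnsum (\<lambda>k. ennreal (jap n powr - a * (jap k powr - b * jap (n - k) powr - b)))"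
      by (simp add: pair_weight_def a_def b_def ennreal_mult nn_integral_cmult)
    also have "\<dots> \<le> nnsum (\<lambda>k. 2 * (p n * q (n - k) + p n * q k))"
    proof (rule nn_integral_mono)
      fix k
      from ennreal_leI[OF pair_weight_split[OF b12(1-4), of n a k]]
      show "ennreal (jap n powr - a * (jap k powr - b * jap (n - k) powr - b))
         \<le> 2 * (p n * q (n - k) + p n * q k)"
        by (simp add: ennreal_mult p_def q_def)
    qed
    finally show "ennreal (jap n powr (2 * s - 2)) * ?Q n
       \<le> nnsum (\<lambda>k. 2 * (p n * q (n - k) + p n * q k))" .
  qed
  also have "\<dots> = 2 * (nnsum p * nnsum q + nnsum p * nnsum q)"
    by (simp add: nn_integral_cmult nn_integral_add nn_integral_multc nnsum_reflect[of q])
  also have "\<dots> < \<infinity>"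
    using nnsum_jap_powr_finite[OF b12(5)] nnsum_jap_powr_finite[OF b12(6)]
    by (simp add: ennreal_mult_less_top p_def[abs_def] q_def[abs_def])
  finally show ?thesis .
qed

text \<open>
  The pairs \<open>(k, n - k)\<close> that a truncation at frequency \<open>K\<close> retains.
\<close>

definition window :: "int \<Rightarrow> nat \<Rightarrow> int set" where
  "window n K = {k. \<bar>k\<bar> \<le> int K \<and> \<bar>n - k\<bar> \<le> int K}"

lemma window_finite [simp]: "finite (window n K)"
  by (rule finite_subset[of _ "{- int K..int K}"]) (auto simp: window_def)

lemma window_mono: "K \<le> K' \<Longrightarrow> window n K \<subseteq> window n K'"
  by (auto simp: window_def)

definition window_tail :: "real \<Rightarrow> int \<Rightarrow> nat \<Rightarrow> ennreal" where
  "window_tail \<alpha> n K = nnsum (\<lambda>k. ennreal (pair_weight \<alpha> n k) * indicator (- window n K) k)"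

lemma window_tail_tendsto:
  assumes "1 / 4 < \<alpha>"
  shows "window_tail \<alpha> n \<longlonglongrightarrow> 0"
proof -
  have "window_tail \<alpha> n \<longlonglongrightarrow> nnsum (\<lambda>k::int. 0)"
    unfolding window_tail_def
  proof (rule nn_integral_dominated_convergence[where w="\<lambda>k. ennreal (pair_weight \<alpha> n k)"])
    show "AE k in count_space UNIV. (\<lambda>K. ennreal (pair_weight \<alpha> n k) * indicator (- window n K) k) \<longlonglongrightarrow> 0"
    proof (rule AE_I2)
      fix k
      have "eventually (\<lambda>K. ennreal (pair_weight \<alpha> n k) * indicator (- window n K) k = 0) sequentially"
        using eventually_ge_at_top[of "nat (\<bar>k\<bar> + \<bar>n - k\<bar>)"]
        by eventually_elim (auto simp: window_def indicator_def)
      then show "(\<lambda>K. ennreal (pair_weight \<alpha> n k) * indicator (- window n K) k) \<longlonglongrightarrow> 0"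
        by (rule tendsto_eventually)
    qed
  qed (use pair_weight_finite[OF assms] in \<open>auto split: split_indicator\<close>)
  then show ?thesis by simp
qed

context gaussian_data
begin

lemma g_pair_square_integrable: "integrable M (\<lambda>\<omega>. (cmod (g k \<omega> * g l \<omega>))\<^sup>2)"
  and g_pair_square_le: "integral\<^sup>L M (\<lambda>\<omega>. (cmod (g k \<omega> * g l \<omega>))\<^sup>2) \<le> 3"
proof -
  have pt: "(cmod (g k \<omega> * g l \<omega>))\<^sup>2 \<le> (cmod (g k \<omega>) ^ 4 + cmod (g l \<omega>) ^ 4) / 2" for \<omega>
    using sum_squares_bound[of "(cmod (g k \<omega>))\<^sup>2" "(cmod (g l \<omega>))\<^sup>2"]
    by (simp add: norm_mult power_mult_distrib)
  have int: "integrable M (\<lambda>\<omega>. (cmod (g k \<omega>) ^ 4 + cmod (g l \<omega>) ^ 4) / 2)"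
    using g_power4_integrable by simp
  show *: "integrable M (\<lambda>\<omega>. (cmod (g k \<omega> * g l \<omega>))\<^sup>2)"
    by (rule Bochner_Integration.integrable_bound[OF int]) (use pt in \<open>auto intro!: AE_I2\<close>)
  have "integral\<^sup>L M (\<lambda>\<omega>. (cmod (g k \<omega> * g l \<omega>))\<^sup>2)
     \<le> integral\<^sup>L M (\<lambda>\<omega>. (cmod (g k \<omega>) ^ 4 + cmod (g l \<omega>) ^ 4) / 2)"
    by (intro integral_mono * int pt)
  also have "\<dots> \<le> 3"
    using g_power4_integrable g_power4_le[of k] g_power4_le[of l] by simp
  finally show "integral\<^sup>L M (\<lambda>\<omega>. (cmod (g k \<omega> * g l \<omega>))\<^sup>2) \<le> 3" .
qed

lemma g_covariance_integrable: "integrable M (\<lambda>\<omega>. (g k \<omega> * g l \<omega>) * cnj (g j \<omega> * g i \<omega>))"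
  and g_covariance_le: "cmod (integral\<^sup>L M (\<lambda>\<omega>. (g k \<omega> * g l \<omega>) * cnj (g j \<omega> * g i \<omega>))) \<le> 3"
proof -
  let ?b = "\<lambda>\<omega>. ((cmod (g k \<omega> * g l \<omega>))\<^sup>2 + (cmod (g j \<omega> * g i \<omega>))\<^sup>2) / 2"
  have pt: "cmod ((g k \<omega> * g l \<omega>) * cnj (g j \<omega> * g i \<omega>)) \<le> ?b \<omega>" for \<omega>
    using sum_squares_bound[of "cmod (g k \<omega> * g l \<omega>)" "cmod (g j \<omega> * g i \<omega>)"]
    by (simp add: norm_mult)
  have int: "integrable M ?b" using g_pair_square_integrable by simp
  have m: "(\<lambda>\<omega>. (g k \<omega> * g l \<omega>) * cnj (g j \<omega> * g i \<omega>)) \<in> borel_measurable M"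
    by measurable
  show *: "integrable M (\<lambda>\<omega>. (g k \<omega> * g l \<omega>) * cnj (g j \<omega> * g i \<omega>))"
    by (rule Bochner_Integration.integrable_bound[OF int m])
      (rule AE_I2, use pt in \<open>simp only: real_norm_def\<close>, meson abs_ge_self order_trans)
  have "cmod (integral\<^sup>L M (\<lambda>\<omega>. (g k \<omega> * g l \<omega>) * cnj (g j \<omega> * g i \<omega>))) \<le> integral\<^sup>L M ?b"
    by (rule order_trans[OF integral_norm_bound]) (intro integral_mono integrable_norm * int pt)
  also have "\<dots> \<le> 3"
    using g_pair_square_integrable g_pair_square_le[of k l] g_pair_square_le[of j i] by simp
  finally show "cmod (integral\<^sup>L M (\<lambda>\<omega>. (g k \<omega> * g l \<omega>) * cnj (g j \<omega> * g i \<omega>))) \<le> 3" .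
qed

lemma g_covariance_zero:
  assumes "n \<noteq> 0" "j \<noteq> k" "j \<noteq> n - k"
  shows "integral\<^sup>L M (\<lambda>\<omega>. (g k \<omega> * g (n - k) \<omega>) * cnj (g j \<omega> * g (n - j) \<omega>)) = 0"
proof -
  let ?xs = "[k, n - k, - j, - (n - j)]"
  obtain i where i: "length (filter (\<lambda>a. \<bar>a\<bar> = i) ?xs) = 1"
    using unique_frequency[OF assms] by blast
  have AE: "AE \<omega> in M. (g k \<omega> * g (n - k) \<omega>) * cnj (g j \<omega> * g (n - j) \<omega>) = (\<Prod>a\<leftarrow>?xs. g a \<omega>)"
    using g_reflect[of j] g_reflect[of "n - j"] by eventually_elim (simp add: mult.assoc)
  have "integral\<^sup>L M (\<lambda>\<omega>. (g k \<omega> * g (n - k) \<omega>) * cnj (g j \<omega> * g (n - j) \<omega>))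
     = integral\<^sup>L M (\<lambda>\<omega>. \<Prod>a\<leftarrow>?xs. g a \<omega>)"
    by (rule integral_cong_AE[OF _ _ AE]) (simp_all, measurable)
  also have "\<dots> = 0" by (rule g_prod4_expectation_zero[OF _ i]) simp
  finally show ?thesis .
qed

text \<open>
  By orthogonality only the terms with \<open>j \<in> {k, n - k}\<close> of the double sum survive; each is bounded by
  the fourth moments, and every \<open>k\<close> has at most two partners.
\<close>

lemma quadratic_second_moment:
  assumes n: "n \<noteq> 0" and A: "finite A"
  shows "(\<integral>\<^sup>+\<omega>. ennreal ((cmod (\<Sum>k\<in>A. c k * (g k \<omega> * g (n - k) \<omega>)))\<^sup>2) \<partial>M)
    \<le> ennreal (6 * (\<Sum>k\<in>A. (cmod (c k))\<^sup>2))"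
proof -
  let ?p = "\<lambda>k \<omega>. g k \<omega> * g (n - k) \<omega>"
  let ?S = "\<lambda>\<omega>. \<Sum>k\<in>A. c k * ?p k \<omega>"
  let ?E = "\<lambda>k j. integral\<^sup>L M (\<lambda>\<omega>. ?p k \<omega> * cnj (?p j \<omega>))"
  have expand: "complex_of_real ((cmod (?S \<omega>))\<^sup>2) = (\<Sum>k\<in>A. \<Sum>j\<in>A. (c k * cnj (c j)) * (?p k \<omega> * cnj (?p j \<omega>)))" for \<omega>
    by (simp only: complex_norm_square cnj_sum sum_product complex_cnj_mult) (simp add: ac_simps)
  have int: "integrable M (\<lambda>\<omega>. complex_of_real ((cmod (?S \<omega>))\<^sup>2))"
    unfolding expand by (intro Bochner_Integration.integrable_sum integrable_mult_right g_covariance_integrable)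
  then have int': "integrable M (\<lambda>\<omega>. (cmod (?S \<omega>))\<^sup>2)"
    using integrable_Re[OF int] by simp
  have val: "complex_of_real (integral\<^sup>L M (\<lambda>\<omega>. (cmod (?S \<omega>))\<^sup>2)) = (\<Sum>k\<in>A. \<Sum>j\<in>A. (c k * cnj (c j)) * ?E k j)"
  proof -
    have "complex_of_real (integral\<^sup>L M (\<lambda>\<omega>. (cmod (?S \<omega>))\<^sup>2)) = integral\<^sup>L M (\<lambda>\<omega>. complex_of_real ((cmod (?S \<omega>))\<^sup>2))"
      by (rule integral_complex_of_real[symmetric])
    also have "\<dots> = (\<Sum>k\<in>A. \<Sum>j\<in>A. integral\<^sup>L M (\<lambda>\<omega>. (c k * cnj (c j)) * (?p k \<omega> * cnj (?p j \<omega>))))"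
      unfolding expand
      by (simp only: Bochner_Integration.integral_sum Bochner_Integration.integrable_sum integrable_mult_right g_covariance_integrable)
    also have "\<dots> = (\<Sum>k\<in>A. \<Sum>j\<in>A. (c k * cnj (c j)) * ?E k j)"
      by (intro sum.cong refl integral_mult_right_zero)
    finally show ?thesis .
  qed
  \<comment> \<open>The relation is symmetric, so \<open>2\<bar>c k\<bar>\<bar>c j\<bar> \<le> \<bar>c k\<bar>\<^sup>2 + \<bar>c j\<bar>\<^sup>2\<close> reduces the double sum to counting partners.\<close>
  let ?R = "\<lambda>k j. if j = k \<or> j = n - k then 1 else (0::real)"
  have summand: "cmod ((c k * cnj (c j)) * ?E k j) \<le> 3 / 2 * (?R k j * (cmod (c k))\<^sup>2 + ?R j k * (cmod (c j))\<^sup>2)" for k j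
  proof (cases "j = k \<or> j = n - k")
    case True
    then have R: "?R k j = 1" "?R j k = 1" by auto
    have "cmod ((c k * cnj (c j)) * ?E k j) \<le> (cmod (c k) * cmod (c j)) * 3"
      unfolding norm_mult[of _ "?E k j"] using g_covariance_le by (intro mult_mono) (auto simp: norm_mult)
    also have "\<dots> \<le> 3 / 2 * ((cmod (c k))\<^sup>2 + (cmod (c j))\<^sup>2)"
      using sum_squares_bound[of "cmod (c k)" "cmod (c j)"] by simp
    finally show ?thesis unfolding R by simp
  next
    case False
    then have "?E k j = 0" using n by (intro g_covariance_zero) auto
    then show ?thesis by simp
  qed
  have card: "(\<Sum>j\<in>A. ?R k j) \<le> 2" for k
  proof -
    have "(\<Sum>j\<in>A. ?R k j) = (\<Sum>j\<in>A \<inter> {k, n - k}. 1)"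
      using A by (subst sum.inter_restrict) (auto intro!: sum.cong)
    also have "\<dots> = real (card (A \<inter> {k, n - k}))" by simp
    also have "\<dots> \<le> real (card {k, n - k})" by (intro of_nat_mono card_mono) auto
    also have "\<dots> \<le> 2" using card_insert_le_m1[of 2 "{n - k}" k] by simp
    finally show ?thesis .
  qed
  have "integral\<^sup>L M (\<lambda>\<omega>. (cmod (?S \<omega>))\<^sup>2) \<le> cmod (complex_of_real (integral\<^sup>L M (\<lambda>\<omega>. (cmod (?S \<omega>))\<^sup>2)))"
    by simp
  also have "\<dots> \<le> (\<Sum>k\<in>A. \<Sum>j\<in>A. cmod ((c k * cnj (c j)) * ?E k j))"
    unfolding val by (rule order_trans[OF norm_sum]) (intro sum_mono norm_sum)
  also have "\<dots> \<le> (\<Sum>k\<in>A. \<Sum>j\<in>A. 3 / 2 * (?R k j * (cmod (c k))\<^sup>2 + ?R j k * (cmod (c j))\<^sup>2))"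
    by (intro sum_mono summand)
  also have "\<dots> = 3 / 2 * ((\<Sum>k\<in>A. \<Sum>j\<in>A. ?R k j * (cmod (c k))\<^sup>2) + (\<Sum>k\<in>A. \<Sum>j\<in>A. ?R j k * (cmod (c j))\<^sup>2))"
    by (simp only: sum_distrib_left[symmetric] sum.distrib)
  also have "(\<Sum>k\<in>A. \<Sum>j\<in>A. ?R j k * (cmod (c j))\<^sup>2) = (\<Sum>k\<in>A. \<Sum>j\<in>A. ?R k j * (cmod (c k))\<^sup>2)"
    by (rule sum.swap)
  also have "(\<Sum>k\<in>A. \<Sum>j\<in>A. ?R k j * (cmod (c k))\<^sup>2) = (\<Sum>k\<in>A. (\<Sum>j\<in>A. ?R k j) * (cmod (c k))\<^sup>2)"
    by (simp only: sum_distrib_right)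
  also have "3 / 2 * ((\<Sum>k\<in>A. (\<Sum>j\<in>A. ?R k j) * (cmod (c k))\<^sup>2) + (\<Sum>k\<in>A. (\<Sum>j\<in>A. ?R k j) * (cmod (c k))\<^sup>2))
     \<le> 3 / 2 * ((\<Sum>k\<in>A. 2 * (cmod (c k))\<^sup>2) + (\<Sum>k\<in>A. 2 * (cmod (c k))\<^sup>2))"
    by (intro mult_left_mono add_mono sum_mono mult_right_mono card) auto
  also have "\<dots> = 6 * (\<Sum>k\<in>A. (cmod (c k))\<^sup>2)"
    by (simp flip: sum_distrib_left)
  finally have "integral\<^sup>L M (\<lambda>\<omega>. (cmod (?S \<omega>))\<^sup>2) \<le> 6 * (\<Sum>k\<in>A. (cmod (c k))\<^sup>2)" .
  then show ?thesis
    using nn_integral_eq_integral[OF int'] by (simp add: ennreal_leI)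
qed

end

section \<open>The square of the random data\<close>

lemma nn_integral_square_diff_limit:
  fixes X :: "nat \<Rightarrow> 'a \<Rightarrow> complex"
  assumes [measurable]: "\<And>l. X l \<in> borel_measurable M" "c \<in> borel_measurable M"
    and lim: "AE \<omega> in M. (\<lambda>l. X l \<omega>) \<longlonglongrightarrow> Y \<omega>"
    and le: "eventually (\<lambda>l. (\<integral>\<^sup>+\<omega>. ennreal ((cmod (c \<omega> - X l \<omega>))\<^sup>2) \<partial>M) \<le> b) sequentially"
  shows "(\<integral>\<^sup>+\<omega>. ennreal ((cmod (c \<omega> - Y \<omega>))\<^sup>2) \<partial>M) \<le> b"
proof -
  have "AE \<omega> in M. ennreal ((cmod (c \<omega> - Y \<omega>))\<^sup>2) = liminf (\<lambda>l. ennreal ((cmod (c \<omega> - X l \<omega>))\<^sup>2))"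
    using lim
  proof eventually_elim
    case (elim \<omega>)
    then have "(\<lambda>l. ennreal ((cmod (c \<omega> - X l \<omega>))\<^sup>2)) \<longlonglongrightarrow> ennreal ((cmod (c \<omega> - Y \<omega>))\<^sup>2)"
      by (intro tendsto_ennrealI tendsto_intros)
    then show ?case by (intro lim_imp_Liminf[symmetric]) auto
  qed
  then have "(\<integral>\<^sup>+\<omega>. ennreal ((cmod (c \<omega> - Y \<omega>))\<^sup>2) \<partial>M)
     = (\<integral>\<^sup>+\<omega>. liminf (\<lambda>l. ennreal ((cmod (c \<omega> - X l \<omega>))\<^sup>2)) \<partial>M)"
    by (rule nn_integral_cong_AE)
  also have "\<dots> \<le> liminf (\<lambda>l. \<integral>\<^sup>+\<omega>. ennreal ((cmod (c \<omega> - X l \<omega>))\<^sup>2) \<partial>M)"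
    by (rule nn_integral_liminf) measurable
  also have "\<dots> \<le> liminf (\<lambda>l. b)"
    by (rule Liminf_mono) (rule le)
  finally show ?thesis by (simp add: Liminf_const)
qed

text \<open>
  The increments have summable first moments. Instead of a square root of the second moment, the
  inequality \<open>x \<le> 2\<^sup>-\<^sup>l + 2\<^sup>l x\<^sup>2\<close> is integrated.
\<close>

lemma (in prob_space) AE_convergent_of_square_increments:
  fixes X :: "nat \<Rightarrow> 'a \<Rightarrow> complex"
  assumes [measurable]: "\<And>l. X l \<in> borel_measurable M"
    and le: "\<And>l. (\<integral>\<^sup>+\<omega>. ennreal ((cmod (X (Suc l) \<omega> - X l \<omega>))\<^sup>2) \<partial>M) \<le> ennreal (c * (1 / 4) ^ l)"
    and c: "0 \<le> c"
  shows "AE \<omega> in M. convergent (\<lambda>l. X l \<omega>)"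
proof -
  let ?d = "\<lambda>l \<omega>. cmod (X (Suc l) \<omega> - X l \<omega>)"
  have pt: "x \<le> (1 / 2) ^ l + 2 ^ l * x\<^sup>2" if "0 \<le> x" for x :: real and l :: nat
  proof (cases "x \<le> (1 / 2) ^ l")
    case True
    then show ?thesis using that by (smt (verit) mult_nonneg_nonneg zero_le_power zero_le_power2)
  next
    case False
    then have "1 \<le> 2 ^ l * x" by (simp add: power_divide field_simps)
    then have "1 * x \<le> (2 ^ l * x) * x" using that by (intro mult_right_mono)
    then show ?thesis by (simp add: power2_eq_square mult.assoc add_increasing)
  qed
  have each: "(\<integral>\<^sup>+\<omega>. ennreal (?d l \<omega>) \<partial>M) \<le> ennreal ((1 + c) * (1 / 2) ^ l)" for l
  proof -
    have "(\<integral>\<^sup>+\<omega>. ennreal (?d l \<omega>) \<partial>M) \<le> (\<integral>\<^sup>+\<omega>. ennreal ((1 / 2) ^ l) + ennreal (2 ^ l) * ennreal ((?d l \<omega>)\<^sup>2) \<partial>M)"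
    proof (rule nn_integral_mono)
      fix \<omega>
      from ennreal_leI[OF pt[of "?d l \<omega>" l]]
      show "ennreal (?d l \<omega>) \<le> ennreal ((1 / 2) ^ l) + ennreal (2 ^ l) * ennreal ((?d l \<omega>)\<^sup>2)"
        by (simp add: ennreal_mult)
    qed
    also have "\<dots> = ennreal ((1 / 2) ^ l) + ennreal (2 ^ l) * (\<integral>\<^sup>+\<omega>. ennreal ((?d l \<omega>)\<^sup>2) \<partial>M)"
      by (subst nn_integral_add) (auto simp: nn_integral_cmult emeasure_space_1)
    also have "\<dots> \<le> ennreal ((1 / 2) ^ l) + ennreal (2 ^ l) * ennreal (c * (1 / 4) ^ l)"
      by (intro add_mono mult_left_mono le) auto
    also have "\<dots> = ennreal ((1 / 2) ^ l + 2 ^ l * (c * (1 / 4) ^ l))"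
      using c by (simp add: ennreal_mult)
    also have "(1 / 2) ^ l + 2 ^ l * (c * (1 / 4) ^ l) = (1 + c) * (1 / 2 :: real) ^ l"
    proof -
      have "2 ^ l * (1 / 4 :: real) ^ l = (1 / 2) ^ l" by (simp flip: power_mult_distrib)
      then show ?thesis by (simp add: algebra_simps)
    qed
    finally show ?thesis .
  qed
  have "(\<integral>\<^sup>+\<omega>. (\<Sum>l. ennreal (?d l \<omega>)) \<partial>M) = (\<Sum>l. \<integral>\<^sup>+\<omega>. ennreal (?d l \<omega>) \<partial>M)"
    by (rule nn_integral_suminf) measurable
  also have "\<dots> \<le> (\<Sum>l. ennreal ((1 + c) * (1 / 2) ^ l))"
    by (intro suminf_le each) auto
  also have "\<dots> = ennreal (\<Sum>l. (1 + c) * (1 / 2) ^ l)"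
    using c by (intro suminf_ennreal2 summable_mult summable_geometric) auto
  also have "\<dots> < \<infinity>" by simp
  finally have "AE \<omega> in M. (\<Sum>l. ennreal (?d l \<omega>)) \<noteq> \<infinity>"
    by (intro nn_integral_PInf_AE) auto
  then show ?thesis
  proof eventually_elim
    case (elim \<omega>)
    then have "summable (\<lambda>l. ?d l \<omega>)"
      by (intro summable_suminf_not_top) auto
    then have "summable (\<lambda>l. X (Suc l) \<omega> - X l \<omega>)" by (rule summable_norm_cancel)
    then have "convergent (\<lambda>n. \<Sum>l<n. X (Suc l) \<omega> - X l \<omega>)" by (simp add: summable_iff_convergent)
    then have "convergent (\<lambda>n. X n \<omega> - X 0 \<omega>)" by (simp only: sum_lessThan_telescope[of "\<lambda>l. X l \<omega>"])
    then have "convergent (\<lambda>n. (X n \<omega> - X 0 \<omega>) + X 0 \<omega>)" by (intro convergent_add convergent_const)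
    then show ?case by simp
  qed
qed

context gaussian_data
begin

definition square_trunc :: "real \<Rightarrow> int \<Rightarrow> nat \<Rightarrow> real \<Rightarrow> 'a \<Rightarrow> complex" where
  "square_trunc \<alpha> n K t \<omega> = trunc_square K (bbm_group t (random_data \<alpha> g \<omega>)) n"

definition square_coeff :: "real \<Rightarrow> int \<Rightarrow> real \<Rightarrow> int \<Rightarrow> complex" where
  "square_coeff \<alpha> n t k = exp (- \<i> * complex_of_real (t * bbm_symbol k)) * exp (- \<i> * complex_of_real (t * bbm_symbol (n - k)))
     / (complex_of_real (jap k powr \<alpha>) * complex_of_real (jap (n - k) powr \<alpha>))"

lemma square_trunc_eq: "square_trunc \<alpha> n K t \<omega> = (\<Sum>k\<in>window n K. square_coeff \<alpha> n t k * (g k \<omega> * g (n - k) \<omega>))"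
  unfolding square_trunc_def trunc_square_def window_def[symmetric]
  by (intro sum.cong refl) (simp add: square_coeff_def bbm_group_def random_data_def)

lemma cmod_square_coeff: "(cmod (square_coeff \<alpha> n t k))\<^sup>2 = pair_weight \<alpha> n k"
proof -
  have "cmod (square_coeff \<alpha> n t k) = jap k powr - \<alpha> * jap (n - k) powr - \<alpha>"
    by (simp add: square_coeff_def norm_mult norm_divide powr_minus field_simps)
  then show ?thesis
    by (simp add: pair_weight_def power_mult_distrib powr_half_square)
qed

lemma square_trunc_measurable_pair: "(\<lambda>(t, \<omega>). square_trunc \<alpha> n K t \<omega>) \<in> borel_measurable (borel \<Otimes>\<^sub>M M)"
  unfolding square_trunc_eq square_coeff_def by measurable

lemma square_trunc_measurable [measurable]: "square_trunc \<alpha> n K t \<in> borel_measurable M"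
  unfolding square_trunc_eq[abs_def] by measurable

lemma square_trunc_energy:
  assumes "n \<noteq> 0"
  shows "(\<integral>\<^sup>+\<omega>. ennreal ((cmod (square_trunc \<alpha> n K t \<omega>))\<^sup>2) \<partial>M) \<le> 6 * nnsum (\<lambda>k. ennreal (pair_weight \<alpha> n k))"
proof -
  have "(\<integral>\<^sup>+\<omega>. ennreal ((cmod (square_trunc \<alpha> n K t \<omega>))\<^sup>2) \<partial>M) \<le> ennreal (6 * (\<Sum>k\<in>window n K. pair_weight \<alpha> n k))"
    using quadratic_second_moment[OF assms window_finite[of n K], of "square_coeff \<alpha> n t"]
    by (simp add: square_trunc_eq cmod_square_coeff)
  also have "\<dots> = 6 * (\<Sum>k\<in>window n K. ennreal (pair_weight \<alpha> n k))"
    by (simp add: ennreal_mult sum_nonneg sum_ennreal)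
  also have "\<dots> \<le> 6 * nnsum (\<lambda>k. ennreal (pair_weight \<alpha> n k))"
    by (intro mult_left_mono nnsum_finite_le) auto
  finally show ?thesis .
qed

text \<open>
  The difference is a sum over pairs outside the smaller of the two windows; the symmetric form of the
  bound dispenses with ordering \<open>K\<close> and \<open>K'\<close>.
\<close>

lemma square_trunc_diff_energy:
  assumes "n \<noteq> 0"
  shows "(\<integral>\<^sup>+\<omega>. ennreal ((cmod (square_trunc \<alpha> n K t \<omega> - square_trunc \<alpha> n K' t \<omega>))\<^sup>2) \<partial>M)
    \<le> 6 * (window_tail \<alpha> n K + window_tail \<alpha> n K')"
proof -
  have *: "(\<integral>\<^sup>+\<omega>. ennreal ((cmod (square_trunc \<alpha> n K' t \<omega> - square_trunc \<alpha> n K t \<omega>))\<^sup>2) \<partial>M) \<le> 6 * window_tail \<alpha> n K"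
    if "K \<le> K'" for K K'
  proof -
    let ?A = "window n K' - window n K"
    have diff: "square_trunc \<alpha> n K' t \<omega> - square_trunc \<alpha> n K t \<omega> = (\<Sum>k\<in>?A. square_coeff \<alpha> n t k * (g k \<omega> * g (n - k) \<omega>))" for \<omega>
      unfolding square_trunc_eq using window_mono[OF that] by (simp add: sum_diff)
    have "(\<integral>\<^sup>+\<omega>. ennreal ((cmod (square_trunc \<alpha> n K' t \<omega> - square_trunc \<alpha> n K t \<omega>))\<^sup>2) \<partial>M)
        \<le> ennreal (6 * (\<Sum>k\<in>?A. pair_weight \<alpha> n k))"
      unfolding diff using quadratic_second_moment[OF assms, of ?A "square_coeff \<alpha> n t"]
      by (simp add: cmod_square_coeff)
    also have "\<dots> = 6 * (\<Sum>k\<in>?A. ennreal (pair_weight \<alpha> n k))"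
      by (simp add: ennreal_mult sum_nonneg sum_ennreal)
    also have "(\<Sum>k\<in>?A. ennreal (pair_weight \<alpha> n k)) = (\<Sum>k\<in>?A. ennreal (pair_weight \<alpha> n k) * indicator (- window n K) k)"
      by (intro sum.cong) auto
    also have "6 * \<dots> \<le> 6 * window_tail \<alpha> n K"
      unfolding window_tail_def by (intro mult_left_mono nnsum_finite_le) auto
    finally show ?thesis .
  qed
  let ?D = "\<integral>\<^sup>+\<omega>. ennreal ((cmod (square_trunc \<alpha> n K t \<omega> - square_trunc \<alpha> n K' t \<omega>))\<^sup>2) \<partial>M"
  show ?thesis
  proof (cases "K \<le> K'")
    case True
    have "?D \<le> 6 * window_tail \<alpha> n K"
      using *[OF True] by (simp add: norm_minus_commute)
    also have "\<dots> \<le> 6 * (window_tail \<alpha> n K + window_tail \<alpha> n K')"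
      by (intro mult_left_mono) auto
    finally show ?thesis .
  next
    case False
    then have "?D \<le> 6 * window_tail \<alpha> n K'"
      by (intro *) simp
    also have "\<dots> \<le> 6 * (window_tail \<alpha> n K + window_tail \<alpha> n K')"
      by (intro mult_left_mono) auto
    finally show ?thesis .
  qed
qed

text \<open>
  The tails do not depend on time, so one subsequence works for all times. Its truncations converge
  almost surely for each time, and their pointwise limit is jointly measurable by construction; Fatou's
  lemma identifies it as the limit in \<open>L\<^sup>2\<close> of the full sequence.
\<close>

lemma square_limit_exists:
  assumes \<alpha>: "1 / 4 < \<alpha>" and n: "n \<noteq> 0"
  shows "\<exists>W. (\<lambda>(t, \<omega>). W t \<omega>) \<in> borel_measurable (borel \<Otimes>\<^sub>M M) \<and>
    (\<forall>t. L2_limit M (\<lambda>K. square_trunc \<alpha> n K t) (W t))"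
proof -
  have "\<exists>K. window_tail \<alpha> n K \<le> ennreal ((1 / 4) ^ l)" for l
  proof -
    have "eventually (\<lambda>K. window_tail \<alpha> n K < ennreal ((1 / 4) ^ l)) sequentially"
      by (rule order_tendstoD(2)[OF window_tail_tendsto[OF \<alpha>]]) simp
    then show ?thesis by (auto simp: eventually_sequentially intro: less_imp_le)
  qed
  then obtain r where r: "\<And>l. window_tail \<alpha> n (r l) \<le> ennreal ((1 / 4) ^ l)" by metis
  define W where "W t \<omega> = lim (\<lambda>l. square_trunc \<alpha> n (r l) t \<omega>)" for t \<omega>
  have Wm: "(\<lambda>(t, \<omega>). W t \<omega>) \<in> borel_measurable (borel \<Otimes>\<^sub>M M)"
  proof -
    have "(\<lambda>p. lim (\<lambda>l. (\<lambda>(t, \<omega>). square_trunc \<alpha> n (r l) t \<omega>) p)) \<in> borel_measurable (borel \<Otimes>\<^sub>M M)"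
      by (intro borel_measurable_lim_metric square_trunc_measurable_pair)
    then show ?thesis by (simp add: W_def case_prod_beta')
  qed
  have [measurable]: "W t \<in> borel_measurable M" for t
    unfolding W_def[abs_def] by (intro borel_measurable_lim_metric square_trunc_measurable)
  have conv: "AE \<omega> in M. (\<lambda>l. square_trunc \<alpha> n (r l) t \<omega>) \<longlonglongrightarrow> W t \<omega>" for t
  proof -
    have "AE \<omega> in M. convergent (\<lambda>l. square_trunc \<alpha> n (r l) t \<omega>)"
    proof (rule AE_convergent_of_square_increments[where c=12])
      fix l
      have "(\<integral>\<^sup>+\<omega>. ennreal ((cmod (square_trunc \<alpha> n (r (Suc l)) t \<omega> - square_trunc \<alpha> n (r l) t \<omega>))\<^sup>2) \<partial>M)
          \<le> 6 * (window_tail \<alpha> n (r (Suc l)) + window_tail \<alpha> n (r l))"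
        by (rule square_trunc_diff_energy[OF n])
      also have "\<dots> \<le> 6 * (ennreal ((1 / 4) ^ l) + ennreal ((1 / 4) ^ l))"
        using order_trans[OF r[of "Suc l"] ennreal_leI[of "(1/4) ^ Suc l" "(1/4) ^ l"]]
        by (intro mult_left_mono add_mono r) auto
      also have "\<dots> = ennreal (12 * (1 / 4) ^ l)"
        by (simp add: ennreal_mult distrib_left flip: distrib_right)
      finally show "(\<integral>\<^sup>+\<omega>. ennreal ((cmod (square_trunc \<alpha> n (r (Suc l)) t \<omega> - square_trunc \<alpha> n (r l) t \<omega>))\<^sup>2) \<partial>M)
         \<le> ennreal (12 * (1 / 4) ^ l)" .
    qed auto
    then show ?thesis by (simp add: W_def convergent_LIMSEQ_iff)
  qed
  have "L2_limit M (\<lambda>K. square_trunc \<alpha> n K t) (W t)" for t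
    unfolding L2_limit_def
  proof (intro conjI)
    show "W t \<in> borel_measurable M" by simp
    have "(\<integral>\<^sup>+\<omega>. ennreal ((cmod (0 - W t \<omega>))\<^sup>2) \<partial>M) \<le> 6 * nnsum (\<lambda>k. ennreal (pair_weight \<alpha> n k))"
      by (rule nn_integral_square_diff_limit[OF _ _ conv]) (auto simp: square_trunc_energy[OF n])
    also have "\<dots> < \<infinity>" using pair_weight_finite[OF \<alpha>] by (simp add: ennreal_mult_less_top)
    finally show "integrable M (\<lambda>\<omega>. (cmod (W t \<omega>))\<^sup>2)"
      by (simp add: integrable_iff_bounded)
    have bound: "(\<integral>\<^sup>+\<omega>. ennreal ((cmod (square_trunc \<alpha> n K t \<omega> - W t \<omega>))\<^sup>2) \<partial>M)
        \<le> 6 * (window_tail \<alpha> n K + ennreal ((1 / 4) ^ K))" for K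
    proof (rule nn_integral_square_diff_limit[OF _ _ conv])
      show "\<forall>\<^sub>F l in sequentially. (\<integral>\<^sup>+\<omega>. ennreal ((cmod (square_trunc \<alpha> n K t \<omega> - square_trunc \<alpha> n (r l) t \<omega>))\<^sup>2) \<partial>M)
         \<le> 6 * (window_tail \<alpha> n K + ennreal ((1 / 4) ^ K))"
        using eventually_ge_at_top[of K]
      proof eventually_elim
        \<comment> \<open>Truncation index and position in the subsequence are tied together by \<open>l \<ge> K\<close>, so that a single
          null sequence bounds the error.\<close>
        case (elim l)
        have "window_tail \<alpha> n (r l) \<le> ennreal ((1 / 4) ^ K)"
          by (rule order_trans[OF r]) (intro ennreal_leI power_decreasing elim; simp)
        then show ?case
          by (intro order_trans[OF square_trunc_diff_energy[OF n]] mult_left_mono add_mono) auto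
      qed
    qed auto
    have "(\<lambda>K. 6 * (window_tail \<alpha> n K + ennreal ((1 / 4) ^ K))) \<longlonglongrightarrow> 6 * (0 + ennreal 0)"
      by (intro ennreal_tendsto_cmult tendsto_add window_tail_tendsto[OF \<alpha>] tendsto_ennrealI LIMSEQ_realpow_zero) auto
    then have lim0: "(\<lambda>K. 6 * (window_tail \<alpha> n K + ennreal ((1 / 4) ^ K))) \<longlonglongrightarrow> 0" by simp
    show "(\<lambda>K. \<integral>\<^sup>+\<omega>. ennreal ((cmod (square_trunc \<alpha> n K t \<omega> - W t \<omega>))\<^sup>2) \<partial>M) \<longlonglongrightarrow> 0"
      by (rule tendsto_sandwich[OF _ _ tendsto_const lim0]) (intro always_eventually allI zero_le bound)+
  qed
  with Wm show ?thesis by blast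
qed

lemma square_version_iff:
  "square_version M (\<lambda>t \<omega>. bbm_group t (random_data \<alpha> g \<omega>)) w \<longleftrightarrow> (\<forall>n. n \<noteq> 0 \<longrightarrow>
     (\<lambda>(t, \<omega>). w t \<omega> n) \<in> borel_measurable (borel \<Otimes>\<^sub>M M) \<and>
     (\<forall>t. L2_limit M (\<lambda>K. square_trunc \<alpha> n K t) (\<lambda>\<omega>. w t \<omega> n)))"
  unfolding square_version_def square_trunc_def[abs_def] by simp

lemma square_version_exists:
  assumes "1 / 4 < \<alpha>"
  shows "\<exists>w. square_version M (\<lambda>t \<omega>. bbm_group t (random_data \<alpha> g \<omega>)) w"
proof -
  have "\<forall>n. \<exists>W. n \<noteq> 0 \<longrightarrow> (\<lambda>(t, \<omega>). W t \<omega>) \<in> borel_measurable (borel \<Otimes>\<^sub>M M) \<and>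
    (\<forall>t. L2_limit M (\<lambda>K. square_trunc \<alpha> n K t) (W t))"
    using square_limit_exists[OF assms] by blast
  then obtain W where W: "\<And>n. n \<noteq> 0 \<Longrightarrow> (\<lambda>(t, \<omega>). W n t \<omega>) \<in> borel_measurable (borel \<Otimes>\<^sub>M M) \<and>
    (\<forall>t. L2_limit M (\<lambda>K. square_trunc \<alpha> n K t) (W n t))"
    by metis
  then have "square_version M (\<lambda>t \<omega>. bbm_group t (random_data \<alpha> g \<omega>)) (\<lambda>t \<omega> n. W n t \<omega>)"
    unfolding square_version_iff by simp
  then show ?thesis by blast
qed

text \<open>
  Second moments pass to \<open>L\<^sup>2\<close> limits; the inequality \<open>\<bar>a + b\<bar>\<^sup>2 \<le> 2\<bar>a\<bar>\<^sup>2 + 2\<bar>b\<bar>\<^sup>2\<close> doubles the constant.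
\<close>

lemma L2_limit_energy:
  assumes n: "n \<noteq> 0" and L: "L2_limit M (\<lambda>K. square_trunc \<alpha> n K t) Y"
  shows "(\<integral>\<^sup>+\<omega>. ennreal ((cmod (Y \<omega>))\<^sup>2) \<partial>M) \<le> 12 * nnsum (\<lambda>k. ennreal (pair_weight \<alpha> n k))"
proof -
  let ?Q = "nnsum (\<lambda>k. ennreal (pair_weight \<alpha> n k))"
  let ?e = "\<lambda>K. \<integral>\<^sup>+\<omega>. ennreal ((cmod (square_trunc \<alpha> n K t \<omega> - Y \<omega>))\<^sup>2) \<partial>M"
  have [measurable]: "Y \<in> borel_measurable M" and lim: "?e \<longlonglongrightarrow> 0"
    using L by (auto simp: L2_limit_def)
  have le: "(\<integral>\<^sup>+\<omega>. ennreal ((cmod (Y \<omega>))\<^sup>2) \<partial>M) \<le> 12 * ?Q + 2 * ?e K" for K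
  proof -
    have "(\<integral>\<^sup>+\<omega>. ennreal ((cmod (Y \<omega>))\<^sup>2) \<partial>M)
      \<le> (\<integral>\<^sup>+\<omega>. 2 * ennreal ((cmod (square_trunc \<alpha> n K t \<omega>))\<^sup>2) + 2 * ennreal ((cmod (square_trunc \<alpha> n K t \<omega> - Y \<omega>))\<^sup>2) \<partial>M)"
    proof (rule nn_integral_mono)
      fix \<omega>
      have "(cmod (Y \<omega>))\<^sup>2 \<le> 2 * (cmod (square_trunc \<alpha> n K t \<omega>))\<^sup>2 + 2 * (cmod (square_trunc \<alpha> n K t \<omega> - Y \<omega>))\<^sup>2"
        using cmod_square_add_le[of "square_trunc \<alpha> n K t \<omega>" "Y \<omega> - square_trunc \<alpha> n K t \<omega>"] by (simp add: norm_minus_commute)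
      from ennreal_leI[OF this]
      show "ennreal ((cmod (Y \<omega>))\<^sup>2) \<le> 2 * ennreal ((cmod (square_trunc \<alpha> n K t \<omega>))\<^sup>2) + 2 * ennreal ((cmod (square_trunc \<alpha> n K t \<omega> - Y \<omega>))\<^sup>2)"
        by (simp add: ennreal_mult)
    qed
    also have "\<dots> = 2 * (\<integral>\<^sup>+\<omega>. ennreal ((cmod (square_trunc \<alpha> n K t \<omega>))\<^sup>2) \<partial>M) + 2 * ?e K"
      by (simp add: nn_integral_add nn_integral_cmult)
    also have "\<dots> \<le> 2 * (6 * ?Q) + 2 * ?e K"
      by (intro add_mono mult_left_mono square_trunc_energy[OF n]) auto
    also have "\<dots> = 12 * ?Q + 2 * ?e K" by (simp flip: mult.assoc)
    finally show ?thesis .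
  qed
  have "(\<lambda>K. 12 * ?Q + 2 * ?e K) \<longlonglongrightarrow> 12 * ?Q + 2 * 0"
    by (intro tendsto_add tendsto_const ennreal_tendsto_cmult lim) auto
  then show ?thesis using le by (intro LIMSEQ_le_const) auto
qed

text \<open>
  Fubini, with the second moment bound for each fixed time inside. This is where joint measurability of
  \<open>w\<close> is used.
\<close>

lemma forcing_energy_finite_AE:
  assumes \<alpha>: "1 / 4 < \<alpha>" "\<alpha> \<le> 1 / 2" and s: "s < 2 * \<alpha>"
    and w: "square_version M (\<lambda>t \<omega>. bbm_group t (random_data \<alpha> g \<omega>)) w"
  shows "AE \<omega> in M. (\<integral>\<^sup>+t. energy s (bbm_forcing (w t \<omega>)) * indicator {0..1} t \<partial>lborel) < \<infinity>"
proof -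
  interpret P: pair_sigma_finite lborel M ..
  have [measurable]: "(\<lambda>p. w (fst p) (snd p) n) \<in> borel_measurable (lborel \<Otimes>\<^sub>M M)" if "n \<noteq> 0" for n
    using w that by (auto simp: square_version_iff case_prod_beta' cong: measurable_cong_sets)
  have f[measurable]: "(\<lambda>p. bbm_forcing (w (fst p) (snd p)) n) \<in> borel_measurable (lborel \<Otimes>\<^sub>M M)" for n
    unfolding bbm_forcing_def by (cases "n = 0") auto
  have E[measurable]: "(\<lambda>p. energy s (bbm_forcing (w (fst p) (snd p)))) \<in> borel_measurable (lborel \<Otimes>\<^sub>M M)"
    unfolding energy_def by (rule borel_measurable_nnsum) measurable
  define H where "H = (\<lambda>(t, \<omega>). energy s (bbm_forcing (w t \<omega>)) * indicator {0..1::real} t)"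
  have H: "H \<in> borel_measurable (lborel \<Otimes>\<^sub>M M)"
    unfolding H_def case_prod_beta' by measurable
  have fixed: "(\<lambda>\<omega>. bbm_forcing (w t \<omega>) n) \<in> borel_measurable M" for t n
    using measurable_compose[OF measurable_Pair1'[of t lborel M] f[of n]] by simp
  let ?Q = "\<lambda>n. nnsum (\<lambda>k. ennreal (pair_weight \<alpha> n k))"
  let ?tot = "nnsum (\<lambda>n. ennreal (jap n powr (2 * s - 2)) * ?Q n)"
  have slice: "(\<integral>\<^sup>+\<omega>. energy s (bbm_forcing (w t \<omega>)) \<partial>M) \<le> 12 * ?tot" for t
  proof -
    have "(\<integral>\<^sup>+\<omega>. energy s (bbm_forcing (w t \<omega>)) \<partial>M)
       = nnsum (\<lambda>n. \<integral>\<^sup>+\<omega>. ennreal (jap n powr (2 * s) * (cmod (bbm_forcing (w t \<omega>) n))\<^sup>2) \<partial>M)"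
      unfolding energy_def using fixed by (intro nnsum_swap) measurable
    also have "\<dots> \<le> nnsum (\<lambda>n. 12 * (ennreal (jap n powr (2 * s - 2)) * ?Q n))"
    proof (rule nn_integral_mono)
      fix n
      show "(\<integral>\<^sup>+\<omega>. ennreal (jap n powr (2 * s) * (cmod (bbm_forcing (w t \<omega>) n))\<^sup>2) \<partial>M)
         \<le> 12 * (ennreal (jap n powr (2 * s - 2)) * ?Q n)"
      proof (cases "n = 0")
        case True
        then show ?thesis by (simp add: bbm_forcing_def)
      next
        case False
        then have L: "L2_limit M (\<lambda>K. square_trunc \<alpha> n K t) (\<lambda>\<omega>. w t \<omega> n)"
          using w by (simp add: square_version_iff)
        then have [measurable]: "(\<lambda>\<omega>. w t \<omega> n) \<in> borel_measurable M" by (simp add: L2_limit_def)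
        have "jap n powr (2 * s) * (cmod (bbm_forcing (w t \<omega>) n))\<^sup>2 \<le> jap n powr (2 * s - 2) * (cmod (w t \<omega> n))\<^sup>2" for \<omega>
        proof -
          have "cmod (bbm_forcing (w t \<omega>) n) \<le> 1 / jap n * cmod (w t \<omega> n)"
            using False bbm_symbol_bound[of n] by (simp add: bbm_forcing_def norm_mult mult_right_mono del: times_divide_eq_left)
          then have "jap n powr (2 * s) * (cmod (bbm_forcing (w t \<omega>) n))\<^sup>2
             \<le> jap n powr (2 * s) * (1 / jap n * cmod (w t \<omega> n))\<^sup>2"
            by (intro mult_left_mono power_mono) auto
          also have "\<dots> = jap n powr (2 * s - 2) * (cmod (w t \<omega> n))\<^sup>2"
            by (simp add: powr_diff power_mult_distrib power_divide powr_numeral)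
          finally show ?thesis .
        qed
        then have "(\<integral>\<^sup>+\<omega>. ennreal (jap n powr (2 * s) * (cmod (bbm_forcing (w t \<omega>) n))\<^sup>2) \<partial>M)
           \<le> (\<integral>\<^sup>+\<omega>. ennreal (jap n powr (2 * s - 2)) * ennreal ((cmod (w t \<omega> n))\<^sup>2) \<partial>M)"
          by (intro nn_integral_mono) (simp add: ennreal_leI flip: ennreal_mult)
        also have "\<dots> = ennreal (jap n powr (2 * s - 2)) * (\<integral>\<^sup>+\<omega>. ennreal ((cmod (w t \<omega> n))\<^sup>2) \<partial>M)"
          by (simp add: nn_integral_cmult)
        also have "\<dots> \<le> ennreal (jap n powr (2 * s - 2)) * (12 * ?Q n)"
          by (intro mult_left_mono L2_limit_energy[OF False L]) simp
        finally show ?thesis by (simp add: mult.left_commute)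
      qed
    qed
    also have "\<dots> = 12 * ?tot" by (simp add: nn_integral_cmult)
    finally show ?thesis .
  qed
  have "(\<integral>\<^sup>+\<omega>. \<integral>\<^sup>+t. H (t, \<omega>) \<partial>lborel \<partial>M) = (\<integral>\<^sup>+t. \<integral>\<^sup>+\<omega>. H (t, \<omega>) \<partial>M \<partial>lborel)"
    by (rule P.Fubini') (use H in simp)
  also have "\<dots> \<le> (\<integral>\<^sup>+t. (12 * ?tot) * indicator {0..1} t \<partial>(lborel :: real measure))"
  proof (rule nn_integral_mono)
    fix t :: real
    show "(\<integral>\<^sup>+\<omega>. H (t, \<omega>) \<partial>M) \<le> (12 * ?tot) * indicator {0..1} t"
      using slice[of t] by (simp add: H_def split: split_indicator)
  qed
  also have "\<dots> = 12 * ?tot" by (simp add: nn_integral_cmult)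
  also have "\<dots> < \<infinity>"
    using pair_weight_total_finite[OF \<alpha> s] by (simp add: ennreal_mult_less_top)
  finally have "(\<integral>\<^sup>+\<omega>. \<integral>\<^sup>+t. H (t, \<omega>) \<partial>lborel \<partial>M) \<noteq> \<infinity>" by simp
  moreover have "(\<lambda>\<omega>. \<integral>\<^sup>+t. H (t, \<omega>) \<partial>lborel) \<in> borel_measurable M"
    using H by measurable
  ultimately have "AE \<omega> in M. (\<integral>\<^sup>+t. H (t, \<omega>) \<partial>lborel) \<noteq> \<infinity>"
    by (intro nn_integral_PInf_AE)
  then show ?thesis by (simp add: H_def less_top)
qed

text \<open>
  The expected energy is at most a constant times \<open>\<Sum>\<^sub>n \<langle>n\<rangle>^(-2\<sigma>-2\<alpha>)\<close>.
\<close>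

lemma random_data_energy_finite_AE:
  assumes \<sigma>: "1 / 2 - \<alpha> < \<sigma>"
  shows "AE \<omega> in M. energy (- \<sigma>) (random_data \<alpha> g \<omega>) < \<infinity>"
proof -
  have second: "(\<integral>\<^sup>+\<omega>. ennreal ((cmod (g n \<omega>))\<^sup>2) \<partial>M) \<le> 4" for n
  proof -
    have "(\<integral>\<^sup>+\<omega>. ennreal ((cmod (g n \<omega>))\<^sup>2) \<partial>M) \<le> (\<integral>\<^sup>+\<omega>. 1 + ennreal ((cmod (g n \<omega>)) ^ 4) \<partial>M)"
    proof (rule nn_integral_mono)
      fix \<omega>
      have "2 * (cmod (g n \<omega>))\<^sup>2 \<le> 1 + (cmod (g n \<omega>)) ^ 4"
        using sum_squares_bound[of 1 "(cmod (g n \<omega>))\<^sup>2"] by simp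
      then have "(cmod (g n \<omega>))\<^sup>2 \<le> 1 + (cmod (g n \<omega>)) ^ 4"
        using zero_le_power2[of "cmod (g n \<omega>)"] by linarith
      from ennreal_leI[OF this] show "ennreal ((cmod (g n \<omega>))\<^sup>2) \<le> 1 + ennreal ((cmod (g n \<omega>)) ^ 4)"
        by simp
    qed
    also have "\<dots> = 1 + ennreal (integral\<^sup>L M (\<lambda>\<omega>. (cmod (g n \<omega>)) ^ 4))"
      using nn_integral_eq_integral[OF g_power4_integrable[of n]]
      by (simp add: nn_integral_add emeasure_space_1)
    also have "\<dots> \<le> 1 + ennreal 3"
      by (intro add_mono ennreal_leI g_power4_le order_refl)
    finally show ?thesis by simp
  qed
  have eq: "ennreal (jap n powr (2 * - \<sigma>) * (cmod (random_data \<alpha> g \<omega> n))\<^sup>2)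
     = ennreal (jap n powr - (2 * \<sigma> + 2 * \<alpha>)) * ennreal ((cmod (g n \<omega>))\<^sup>2)" for n \<omega>
  proof -
    have "jap n powr (2 * - \<sigma>) * (cmod (random_data \<alpha> g \<omega> n))\<^sup>2
       = (jap n powr (2 * - \<sigma>) / (jap n powr \<alpha>)\<^sup>2) * (cmod (g n \<omega>))\<^sup>2"
      by (simp add: random_data_def norm_divide power_divide)
    also have "(jap n powr \<alpha>)\<^sup>2 = jap n powr (2 * \<alpha>)"
      by (simp add: power2_eq_square flip: powr_add)
    also have "jap n powr (2 * - \<sigma>) / jap n powr (2 * \<alpha>) = jap n powr - (2 * \<sigma> + 2 * \<alpha>)"
      by (simp flip: powr_diff)
    finally show ?thesis by (simp add: ennreal_mult)
  qed
  have [measurable]: "(\<lambda>\<omega>. energy (- \<sigma>) (random_data \<alpha> g \<omega>)) \<in> borel_measurable M"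
    unfolding energy_def eq by (rule borel_measurable_nnsum) measurable
  have "(\<integral>\<^sup>+\<omega>. energy (- \<sigma>) (random_data \<alpha> g \<omega>) \<partial>M)
     = nnsum (\<lambda>n. ennreal (jap n powr - (2 * \<sigma> + 2 * \<alpha>)) * (\<integral>\<^sup>+\<omega>. ennreal ((cmod (g n \<omega>))\<^sup>2) \<partial>M))"
    unfolding energy_def eq by (subst nnsum_swap) (auto simp: nn_integral_cmult)
  also have "\<dots> \<le> nnsum (\<lambda>n. ennreal (jap n powr - (2 * \<sigma> + 2 * \<alpha>)) * 4)"
    by (intro nn_integral_mono mult_left_mono second) auto
  also have "\<dots> < \<infinity>"
    using nnsum_jap_powr_finite[of "2 * \<sigma> + 2 * \<alpha>"] \<sigma>
    by (simp add: nn_integral_multc ennreal_mult_less_top)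
  finally have "AE \<omega> in M. energy (- \<sigma>) (random_data \<alpha> g \<omega>) \<noteq> \<infinity>"
    by (intro nn_integral_PInf_AE) auto
  then show ?thesis by (simp add: less_top)
qed

end

section \<open>Almost sure local well-posedness\<close>

theorem theorem1p1:
  fixes M :: "'a measure" and g :: "int \<Rightarrow> 'a \<Rightarrow> complex" and \<alpha> s :: real
  assumes "prob_space M"
    and "gaussian_family M g"
    and "1 / 4 < \<alpha>" and "\<alpha> \<le> 1 / 2"
    and "1 / 2 - \<alpha> < s" and "s < 2 * \<alpha>"
  shows "(\<exists>w. square_version M (\<lambda>t \<omega>. bbm_group t (random_data \<alpha> g \<omega>)) w) \<and>
    (\<forall>w. square_version M (\<lambda>t \<omega>. bbm_group t (random_data \<alpha> g \<omega>)) w \<longrightarrow>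
      (\<exists>\<Sigma>\<in>sets M. measure M \<Sigma> = 1 \<and>
        (\<forall>\<omega>\<in>\<Sigma>. \<exists>T>0.
          (\<exists>u. u \<in> solution_class T s (random_data \<alpha> g \<omega>) \<and>
               u 0 = random_data \<alpha> g \<omega> \<and>
               bbm_solution T (random_data \<alpha> g \<omega>) (\<lambda>t. w t \<omega>) u \<and>
               (\<forall>u'. u' \<in> solution_class T s (random_data \<alpha> g \<omega>) \<and>
                     u' 0 = random_data \<alpha> g \<omega> \<and>
                     bbm_solution T (random_data \<alpha> g \<omega>) (\<lambda>t. w t \<omega>) u' \<longrightarrow>
                     (\<forall>t\<in>{0..T}. u' t = u t))) \<and>
          (\<forall>\<epsilon>>0. solution_class T s (random_data \<alpha> g \<omega>)
                    \<subseteq> cont_sobolev T (\<alpha> - 1 / 2 - \<epsilon>)))))"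
proof -
  interpret gaussian_data M g
    using assms(1,2) by (simp add: gaussian_data_def gaussian_data_axioms_def)
  let ?wp = "\<lambda>w \<omega>. \<exists>T>0.
          (\<exists>u. u \<in> solution_class T s (random_data \<alpha> g \<omega>) \<and>
               u 0 = random_data \<alpha> g \<omega> \<and>
               bbm_solution T (random_data \<alpha> g \<omega>) (\<lambda>t. w t \<omega>) u \<and>
               (\<forall>u'. u' \<in> solution_class T s (random_data \<alpha> g \<omega>) \<and>
                     u' 0 = random_data \<alpha> g \<omega> \<and>
                     bbm_solution T (random_data \<alpha> g \<omega>) (\<lambda>t. w t \<omega>) u' \<longrightarrow>
                     (\<forall>t\<in>{0..T}. u' t = u t))) \<and>
          (\<forall>\<epsilon>>0. solution_class T s (random_data \<alpha> g \<omega>)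
                    \<subseteq> cont_sobolev T (\<alpha> - 1 / 2 - \<epsilon>))"
  have main: "\<exists>\<Sigma>\<in>sets M. measure M \<Sigma> = 1 \<and> (\<forall>\<omega>\<in>\<Sigma>. ?wp w \<omega>)"
    if w: "square_version M (\<lambda>t \<omega>. bbm_group t (random_data \<alpha> g \<omega>)) w" for w
  proof -
    \<comment> \<open>Countably many regularities suffice for all \<open>\<epsilon>\<close>, so that one null set serves them all.\<close>
    let ?good = "\<lambda>\<omega>. (\<forall>m::nat. energy (\<alpha> - 1 / 2 - 1 / real (Suc m)) (random_data \<alpha> g \<omega>) < \<infinity>) \<and>
      (\<integral>\<^sup>+t. energy s (bbm_forcing (w t \<omega>)) * indicator {0..1} t \<partial>lborel) < \<infinity>"
    have "AE \<omega> in M. ?good \<omega>"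
      unfolding AE_conj_iff AE_all_countable
    proof (intro conjI allI)
      show "AE \<omega> in M. energy (\<alpha> - 1 / 2 - 1 / real (Suc m)) (random_data \<alpha> g \<omega>) < \<infinity>" for m
        using random_data_energy_finite_AE[of \<alpha> "1 / 2 - \<alpha> + 1 / real (Suc m)"] by (simp add: algebra_simps)
    qed (rule forcing_energy_finite_AE[OF assms(3,4,6) w])
    then obtain \<Sigma> where \<Sigma>: "\<Sigma> \<subseteq> {\<omega> \<in> space M. ?good \<omega>}" "\<Sigma> \<in> events" "prob \<Sigma> = 1"
      by (rule AE_E_prob)
    have "?wp w \<omega>" if "\<omega> \<in> \<Sigma>" for \<omega>
    proof -
      have \<omega>: "\<omega> \<in> space M" and good: "?good \<omega>" using that \<Sigma>(1) by auto
      let ?u0 = "random_data \<alpha> g \<omega>"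
      have u0: "energy (\<alpha> - 1 / 2 - \<epsilon>) ?u0 < \<infinity>" if pos: "0 < \<epsilon>" for \<epsilon>
      proof -
        obtain m where "1 / real (Suc m) < \<epsilon>" using nat_approx_posE[OF pos] by blast
        then have "energy (\<alpha> - 1 / 2 - \<epsilon>) ?u0 \<le> energy (\<alpha> - 1 / 2 - 1 / real (Suc m)) ?u0"
          by (intro energy_mono_index) simp
        also have "\<dots> < \<infinity>" using good by blast
        finally show ?thesis .
      qed
      \<comment> \<open>The hypotheses on \<open>\<alpha>\<close> and \<open>s\<close> leave room for \<open>\<sigma> = 1/2 - \<alpha> + \<epsilon>\<close> to satisfy the conditions of
        the product estimate: \<open>\<sigma> \<le> s\<close> because \<open>1/2 - \<alpha> < s\<close>, and \<open>s + \<sigma> \<le> 1\<close> because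
        \<open>s < 2\<alpha> \<le> 1/2 + \<alpha>\<close>.\<close>
      obtain \<epsilon> where \<epsilon>: "0 < \<epsilon>" "1 / 2 - \<alpha> + \<epsilon> < 1 / 2" "1 / 2 - \<alpha> + \<epsilon> \<le> s" "s + (1 / 2 - \<alpha> + \<epsilon>) \<le> 1"
      proof
        let ?e = "min (\<alpha> / 2) (min (s - (1 / 2 - \<alpha>)) (1 / 2 + \<alpha> - s))"
        show "0 < ?e" "1 / 2 - \<alpha> + ?e < 1 / 2" "1 / 2 - \<alpha> + ?e \<le> s" "s + (1 / 2 - \<alpha> + ?e) \<le> 1"
          using assms(3-6) by auto
      qed
      define \<sigma> where "\<sigma> = 1 / 2 - \<alpha> + \<epsilon>"
      have "energy (- \<sigma>) ?u0 < \<infinity>" using u0[OF \<epsilon>(1)] by (simp add: \<sigma>_def algebra_simps)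
      then obtain A where A: "energy (- \<sigma>) ?u0 = ennreal A" "0 \<le> A"
        by (cases "energy (- \<sigma>) ?u0") auto
      let ?F = "\<integral>\<^sup>+t. energy s (bbm_forcing (w t \<omega>)) * indicator {0..1} t \<partial>lborel"
      have "?F < \<infinity>"
        using good by blast
      then obtain B where B: "?F = ennreal B" "0 \<le> B"
        by (cases ?F) auto
      have "forced_bbm \<sigma> s A B ?u0 (\<lambda>t. w t \<omega>)"
      proof (rule forced_bbm.intro)
        show "0 \<le> \<sigma>" "\<sigma> < 1 / 2" "\<sigma> \<le> s" "s + \<sigma> \<le> 1" using \<epsilon> assms(4) by (auto simp: \<sigma>_def)
        show "(\<lambda>t. w t \<omega> n) \<in> borel_measurable borel" if "n \<noteq> 0" for n
        proof -
          have "(\<lambda>(t, \<omega>). w t \<omega> n) \<in> borel_measurable (borel \<Otimes>\<^sub>M M)"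
            using w that by (simp add: square_version_iff)
          from measurable_compose[OF measurable_Pair2'[OF \<omega>] this] show ?thesis by simp
        qed
        show "0 \<le> A" "0 \<le> B" by (rule A(2), rule B(2))
        show "energy (- \<sigma>) ?u0 \<le> ennreal A" by (rule eq_refl[OF A(1)])
        show "?F \<le> ennreal B"
          by (rule eq_refl[OF B(1)])
      qed
      note lwp = forced_bbm.local_well_posedness[OF this]
      have incl: "solution_class T s ?u0 \<subseteq> cont_sobolev T (\<alpha> - 1 / 2 - \<epsilon>')" if "0 < \<epsilon>'" for T \<epsilon>'
        by (rule solution_class_subset[OF u0[OF that]]) (use that assms(4,5) in linarith)
      show ?thesis
        by (rule ex_forward[OF lwp], elim conjE, intro conjI allI impI incl)
    qed
    with \<Sigma>(2,3) show ?thesis by (intro bexI[of _ \<Sigma>] conjI ballI)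
  qed
  show ?thesis
    by (intro conjI allI impI square_version_exists assms(3) main)
qed

end
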